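(* Let $1\le n_1<n_2<\dots<n_r<n$ be integers, write $\underline{n}=\{n_1,\dots,n_r\}$, let $G=SL(n,\mathbb{C})$ and let $P$ be the parabolic subgroup with $\Delta_P=\{\alpha_i\mid i\notin\underline{n}\}$, so that $G/P=\mathrm{Fl}(\underline{n})$, with projection $\pi_P\colon G/B\to\mathrm{Fl}(\underline{n})$. Let $i\in[n-1]$. (1) If $i\in\underline{n}$, then $\pi_P(X_{\mathrm{id}}^{w_0s_iw_P})$ is the Schubert divisor of $\mathrm{Fl}(\underline{n})$ defined by the Plücker coordinate hyperplane $x_{(n-i,n]}=0$. (2) If $i\in\underline{n}$, then $\pi_P(X_{s_i}^{w_0w_P})$ is the Schubert divisor of $\mathrm{Fl}(\underline{n})$ defined by the Plücker coordinate hyperplane $x_{[i]}=0$. (3) If $i<n_1$, then $\pi_P(X_{s_i}^{w_0w_P})$ is given by $x_{[i],(n-n_1+i,n]}=0$. (4) If $i>n_r$, then $\pi_P(X_{s_i}^{w_0w_P})$ is given by $x_{(i-n_r,i]}=0$. (5) If $n_j<i<n_{j+1}$ for some $j\in[r-1]$, set $k:=i-n_j$ and $l:=\min\{i,\,n-n_{j+1}+k\}$. Then $\pi_P(X_{s_i}^{w_0w_P})$ is given by $$\sum_{J\in\binom{[l]}{k}}(-1)^{|J|}\,x_{[i]\setminus J}\cdot x_{J,(n-n_{j+1}+k,n]}=0,$$ where $|J|$ denotes the sum of the elements of $J$.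
   Context: $W=S_n$ with simple transpositions $s_i=s_{\alpha_i}$, $i\in[n-1]$; $w_0$ is the longest element of $S_n$ and $w_P$ the longest element of the subgroup $W_P$ generated by $s_i$, $i\notin\underline n$. $B$ is a Borel subgroup, $B^-=w_0Bw_0$; $X_u$ (resp. $X^u$) denotes the closure of $B^-uB/B$ (resp. $BuB/B$) in $G/B$, and $X_v^u=X_v\cap X^u$. $\mathrm{Fl}(\underline n)$ is the variety of flags $F_{n_1}\subset\dots\subset F_{n_r}\subset\mathbb{C}^n$ with $\dim F_{n_j}=n_j$. A point is represented by a full-rank $n_r\times n$ matrix whose first $n_j$ rows span $F_{n_j}$. For $m\ge1$, $[m]=\{1,\dots,m\}$, $(a,b]=\{a+1,\dots,b\}$, $\binom{[m]}{j}$ is the set of $j$-element subsets of $[m]$; for disjoint index sets $J,J'$, "$J,J'$" denotes $J\cup J'$. For $J\subset[n]$ with $|J|=n_j$, the Plücker coordinate $x_J$ is the minor of the first $n_j$ rows in the columns $J$ (columns taken in increasing order). Conventions: the hypersurface $X_{s_i}$ of the complete flag variety $G/B$ is defined by $x_{[i]}=0$, and the dense Schubert cell $\pi_P(\mathring X^{w_0w_P})$ of $\mathrm{Fl}(\underline n)$ consists of the flags represented by the $n_r\times n$ matrices which, with row blocks of sizes $a_1=n_1,a_2=n_2-n_1,\dots,a_r=n_r-n_{r-1}$ and column blocks (left to right) of sizes $n-n_r,a_r,a_{r-1},\dots,a_1$, have an identity matrix $I_{a_s}$ in row block $s$ and column block $r+2-s$, arbitrary entries to its left and zeros to its right. "Given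 by" an equation means cut out in $\mathrm{Fl}(\underline n)$ by that equation. *)

theory Defs
  imports "HOL-Analysis.Analysis" "HOL-Combinatorics.Permutations"
begin

text \<open>Matrices are functions nat => nat => complex, indexed from 1; an n x n matrix
  is zero outside {1..n} x {1..n}.  Vectors of C^n are functions nat => complex
  supported on {1..n}.\<close>

definition supp_mat :: "nat \<Rightarrow> (nat \<Rightarrow> nat \<Rightarrow> complex) \<Rightarrow> bool" where
  "supp_mat n A \<longleftrightarrow> (\<forall>a b. (a \<notin> {1..n} \<or> b \<notin> {1..n}) \<longrightarrow> A a b = 0)"

definition detm :: "nat \<Rightarrow> (nat \<Rightarrow> nat \<Rightarrow> complex) \<Rightarrow> complex" where
  "detm m A = (\<Sum>p | p permutes {1..m}. of_int (sign p) * (\<Prod>a\<in>{1..m}. A a (p a)))"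

definition mmul :: "nat \<Rightarrow> (nat \<Rightarrow> nat \<Rightarrow> complex) \<Rightarrow> (nat \<Rightarrow> nat \<Rightarrow> complex) \<Rightarrow> (nat \<Rightarrow> nat \<Rightarrow> complex)" where
  "mmul n A C = (\<lambda>a b. if a \<in> {1..n} \<and> b \<in> {1..n} then (\<Sum>k=1..n. A a k * C k b) else 0)"

definition SLn :: "nat \<Rightarrow> (nat \<Rightarrow> nat \<Rightarrow> complex) set" where
  "SLn n = {g. supp_mat n g \<and> detm n g = 1}"

definition Bor :: "nat \<Rightarrow> (nat \<Rightarrow> nat \<Rightarrow> complex) set" where
  "Bor n = {b \<in> SLn n. \<forall>a c. c < a \<longrightarrow> b a c = 0}"

definition stra :: "nat \<Rightarrow> nat \<Rightarrow> nat" where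
  "stra i = (\<lambda>x. if x = i then i + 1 else if x = i + 1 then i else x)"

definition wordperm :: "nat list \<Rightarrow> nat \<Rightarrow> nat" where
  "wordperm ws = foldr (\<lambda>i w. stra i \<circ> w) ws id"

definition Weyl :: "nat \<Rightarrow> (nat \<Rightarrow> nat) set" where
  "Weyl n = {wordperm ws | ws. set ws \<subseteq> {1..<n}}"

definition WeylP :: "nat \<Rightarrow> nat list \<Rightarrow> (nat \<Rightarrow> nat) set" where
  "WeylP n ns = {wordperm ws | ws. set ws \<subseteq> {1..<n} - set ns}"

definition wlen :: "nat \<Rightarrow> (nat \<Rightarrow> nat) \<Rightarrow> nat" where
  "wlen n w = (LEAST m. \<exists>ws. set ws \<subseteq> {1..<n} \<and> length ws = m \<and> wordperm ws = w)"

definition longest :: "nat \<Rightarrow> (nat \<Rightarrow> nat) set \<Rightarrow> (nat \<Rightarrow> nat)" where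
  "longest n S = (THE w. w \<in> S \<and> (\<forall>v\<in>S. wlen n v \<le> wlen n w))"

definition w0 :: "nat \<Rightarrow> nat \<Rightarrow> nat" where
  "w0 n = longest n (Weyl n)"

definition wP :: "nat \<Rightarrow> nat list \<Rightarrow> nat \<Rightarrow> nat" where
  "wP n ns = longest n (WeylP n ns)"

text \<open>A lift of w to SL(n): the permutation matrix with (w j, j) entries equal to 1,
  the first column rescaled by sign w so that the determinant is 1.\<close>
definition pmat :: "nat \<Rightarrow> (nat \<Rightarrow> nat) \<Rightarrow> (nat \<Rightarrow> nat \<Rightarrow> complex)" where
  "pmat n w = (\<lambda>a b. if a \<in> {1..n} \<and> b \<in> {1..n} \<and> a = w b
                      then (if b = 1 then of_int (sign w) else 1) else 0)"

definition Borm :: "nat \<Rightarrow> (nat \<Rightarrow> nat \<Rightarrow> complex) set" where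
  "Borm n = {mmul n (mmul n (pmat n (w0 n)) b) (pmat n (w0 n)) | b. b \<in> Bor n}"

definition dcell :: "nat \<Rightarrow> (nat \<Rightarrow> nat \<Rightarrow> complex) set \<Rightarrow> (nat \<Rightarrow> nat) \<Rightarrow>
    (nat \<Rightarrow> nat \<Rightarrow> complex) set \<Rightarrow> (nat \<Rightarrow> nat \<Rightarrow> complex) set" where
  "dcell n H u K = {mmul n (mmul n x (pmat n u)) y | x y. x \<in> H \<and> y \<in> K}"

text \<open>G/B as the set of left cosets gB, with the quotient topology of SL(n,C)
  (classical topology).\<close>
definition coset :: "nat \<Rightarrow> (nat \<Rightarrow> nat \<Rightarrow> complex) \<Rightarrow> (nat \<Rightarrow> nat \<Rightarrow> complex) set" where
  "coset n g = {mmul n g b | b. b \<in> Bor n}"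

definition GB :: "nat \<Rightarrow> (nat \<Rightarrow> nat \<Rightarrow> complex) set set" where
  "GB n = coset n ` SLn n"

definition GBtop :: "nat \<Rightarrow> (nat \<Rightarrow> nat \<Rightarrow> complex) set topology" where
  "GBtop n = topology (\<lambda>U. U \<subseteq> GB n \<and> openin (top_of_set (SLn n)) (\<Union>U))"

definition SchubL :: "nat \<Rightarrow> (nat \<Rightarrow> nat) \<Rightarrow> (nat \<Rightarrow> nat \<Rightarrow> complex) set set" where
  "SchubL n u = GBtop n closure_of (coset n ` dcell n (Borm n) u (Bor n))"

definition SchubU :: "nat \<Rightarrow> (nat \<Rightarrow> nat) \<Rightarrow> (nat \<Rightarrow> nat \<Rightarrow> complex) set set" where
  "SchubU n u = GBtop n closure_of (coset n ` dcell n (Bor n) u (Bor n))"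

definition Richardson :: "nat \<Rightarrow> (nat \<Rightarrow> nat) \<Rightarrow> (nat \<Rightarrow> nat) \<Rightarrow> (nat \<Rightarrow> nat \<Rightarrow> complex) set set" where
  "Richardson n v u = SchubL n v \<inter> SchubU n u"

definition rowspan :: "nat \<Rightarrow> nat \<Rightarrow> (nat \<Rightarrow> nat \<Rightarrow> complex) \<Rightarrow> (nat \<Rightarrow> complex) set" where
  "rowspan n m M = {v. \<exists>c. v = (\<lambda>b. if b \<in> {1..n} then (\<Sum>a=1..m. c a * M a b) else 0)}"

definition rowflag :: "nat \<Rightarrow> nat list \<Rightarrow> (nat \<Rightarrow> nat \<Rightarrow> complex) \<Rightarrow> (nat \<Rightarrow> complex) set list" where
  "rowflag n ns M = map (\<lambda>m. rowspan n m M) ns"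

definition fullrank :: "nat \<Rightarrow> nat \<Rightarrow> (nat \<Rightarrow> nat \<Rightarrow> complex) \<Rightarrow> bool" where
  "fullrank n m M \<longleftrightarrow> (\<forall>a b. (a \<notin> {1..m} \<or> b \<notin> {1..n}) \<longrightarrow> M a b = 0) \<and>
     (\<forall>c. (\<forall>b\<in>{1..n}. (\<Sum>a=1..m. c a * M a b) = 0) \<longrightarrow> (\<forall>a\<in>{1..m}. c a = 0))"

definition Fl :: "nat \<Rightarrow> nat list \<Rightarrow> (nat \<Rightarrow> complex) set list set" where
  "Fl n ns = {rowflag n ns M | M. fullrank n (last ns) M}"

text \<open>pi_P : G/B \<rightarrow> Fl(ns), gB \<mapsto> (F_{n_j} = span of the first n_j columns of g);
  the representing matrix is the transpose of the first n_r columns of g.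
  piP n ns Y is the image of Y \<subseteq> G/B.\<close>
definition piP :: "nat \<Rightarrow> nat list \<Rightarrow> (nat \<Rightarrow> nat \<Rightarrow> complex) set set \<Rightarrow> (nat \<Rightarrow> complex) set list set" where
  "piP n ns Y = {rowflag n ns (\<lambda>a b. if a \<in> {1..last ns} then g b a else 0) | g.
                   g \<in> SLn n \<and> coset n g \<in> Y}"

definition plucker :: "(nat \<Rightarrow> nat \<Rightarrow> complex) \<Rightarrow> nat set \<Rightarrow> complex" where
  "plucker M J = detm (card J) (\<lambda>a b. M a (sorted_list_of_set J ! (b - 1)))"

text \<open>Subset of Fl(ns) cut out by an equation E = 0 in the entries of a representing matrix
  (E is multihomogeneous in the Pluecker coordinates, so independent of the representative).\<close>
definition cutout :: "nat \<Rightarrow> nat list \<Rightarrow> ((nat \<Rightarrow> nat \<Rightarrow> complex) \<Rightarrow> complex) \<Rightarrow> (nat \<Rightarrow> complex) set list set" where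
  "cutout n ns E = {rowflag n ns M | M. fullrank n (last ns) M \<and> E M = 0}"

end

theory Submission
  imports Defs "Jordan_Normal_Form.Determinant"
begin

text \<open>Write \<open>F q\<close> for the span of the first \<open>q\<close> columns of \<open>g\<close> and \<open>E p\<close> for the span of the
  first \<open>p\<close> unit vectors. By the Bruhat decomposition and the chain property of the Bruhat order,
  the closure of \<open>B w B\<close> is the set of all \<open>g \<in> B u B\<close> such that
  \<open>#{b \<le> q. u b \<le> p} \<ge> #{b \<le> q. w b \<le> p}\<close> for all \<open>p\<close>, \<open>q\<close>; translating by \<open>w0\<close> shows that
  \<open>X (stra i)\<close> consists of the flags with \<open>F i\<close> meeting \<open>{v. v 1 = \<dots> = v i = 0}\<close>.

  Every partial flag lifts to a point \<open>b u\<close> with \<open>u\<close> increasing on the blocks between consecutive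
  dimensions, and such \<open>u\<close> satisfy the rank conditions of \<open>w0 wP\<close>; this gives parts (1) and (2).
  For \<open>i\<close> strictly between consecutive dimensions \<open>a < c\<close> (with \<open>a = 0\<close> or \<open>c = n\<close> in parts
  (3), (4)), put \<open>k = i - a\<close> and \<open>m = n - c + k\<close>. By Laplace expansion the form in (5) is up to sign
  the determinant of the linear map sending \<open>(\<nu>, x) \<in> F a \<times> F c\<close> to the coordinates \<open>1, \<dots>, i\<close> of
  \<open>\<nu> + x\<close> and the coordinates \<open>m + 1, \<dots>, n\<close> of \<open>x\<close>. Its vanishing yields \<open>x \<in> F c \<inter> E m\<close>, with
  which one chooses \<open>F i\<close> such that \<open>dim (F i \<inter> E m) \<ge> k\<close>, the only rank condition of \<open>w0 wP\<close>
  at \<open>i\<close> that is not automatic, and such that \<open>F i\<close> contains \<open>\<nu> + x\<close>; the converse reads off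
  \<open>(\<nu>, x)\<close> from \<open>F i\<close>.\<close>

section \<open>Determinants of function matrices\<close>

no_notation Finite_Cartesian_Product.vec_nth (infixl "$" 90)
declare One_nat_def [simp del]

text \<open>The number \<open>m = n - c + k\<close> is the value of \<open>w0 wP\<close> at
  \<open>i\<close>: this permutation carries the block \<open>a<..c\<close> increasingly onto
  \<open>n - c<..n - a\<close>, so exactly \<open>k\<close> of its first \<open>i\<close> values are
  at most \<open>m\<close>. The same choice gives \<open>a + c = i + (n - m)\<close>, which is why
  the linear map has a square matrix. The obstacle is that one and the same \<open>F i\<close> must
  satisfy both incidences. If \<open>F a\<close> contains a nonzero \<open>x\<close> in
  \<open>E m\<close>, then \<open>(- x, x)\<close> makes the form vanish, so the form gives no
  information. But then the first \<open>i - 1\<close> columns already supply \<open>k\<close>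
  dimensions of \<open>E m\<close>, and column \<open>i\<close> can be spent on a vector of
  \<open>F (i + 1)\<close> that is zero in the first \<open>i\<close> coordinates; one exists by
  counting equations. If \<open>F a\<close> meets \<open>E m\<close> only in 0, the kernel vector is
  essential: unless \<open>x\<close> lies in \<open>F i\<close> already, it becomes column
  \<open>i\<close>, while \<nu> is in \<open>F a\<close> anyway. The two halves of the closure
  theorem rest on the continuity of minors and on a one-parameter curve from a cell into a larger
  one.\<close>

definition jmat :: "nat \<Rightarrow> (nat \<Rightarrow> nat \<Rightarrow> complex) \<Rightarrow> complex mat" where
  "jmat m A = mat m m (\<lambda>(a,b). A (Suc a) (Suc b))"

lemma jmat_carrier [simp]: "jmat m A \<in> carrier_mat m m"
  and dim_row_jmat [simp]: "dim_row (jmat m A) = m"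
  and dim_col_jmat [simp]: "dim_col (jmat m A) = m"
  and index_jmat [simp]: "a < m \<Longrightarrow> b < m \<Longrightarrow> jmat m A $$ (a, b) = A (Suc a) (Suc b)"
  by (simp_all add: jmat_def)

lemma bij_betw_Suc_1: "bij_betw Suc {0..<m} {1..m}"
  by (rule bij_betwI[where g = "\<lambda>x. x - 1"]) auto

lemma sum_shift_1: "(\<Sum>a = 1..m. f a) = (\<Sum>a = 0..<m. f (Suc a))"
  using sum.reindex_bij_betw[OF bij_betw_Suc_1, of f m] by simp

lemma prod_shift_1: "(\<Prod>a = 1..m. f a) = (\<Prod>a = 0..<m. f (Suc a))"
  using prod.reindex_bij_betw[OF bij_betw_Suc_1, of f m] by simp

lemma detm_cong: "(\<And>a b. a \<in> {1..m} \<Longrightarrow> b \<in> {1..m} \<Longrightarrow> A a b = B a b) \<Longrightarrow> detm m A = detm m B"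
  unfolding detm_def
  by (intro sum.cong refl arg_cong2[of _ _ _ _ "(*)"] prod.cong)
    (metis mem_Collect_eq permutes_in_image)

text \<open>Conjugating with the shift \<open>Suc\<close> turns permutations of
  \<open>{0..<m}\<close> into permutations of \<open>{1..m}\<close> and preserves signs, so the two
  Leibniz sums agree term by term. Library facts on determinants reach \<open>detm\<close> through
  this bridge.\<close>

lemma detm_eq_det: "detm m A = det (jmat m A)"
proof -
  let ?F = "map_permutation {0..<m} Suc"
  have bij: "bij_betw ?F {p. p permutes {0..<m}} {p. p permutes {1..m}}"
  proof (rule bij_betwI[where g = "map_permutation {1..m} (\<lambda>x. x - 1)"])
    show "?F \<in> {p. p permutes {0..<m}} \<rightarrow> {p. p permutes {1..m}}"
      using map_permutation_permutes bij_betw_Suc_1 by blast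
    have b: "bij_betw (\<lambda>x. x - 1) {1..m} {0..<m}"
      by (rule bij_betwI[where g = Suc]) auto
    then show "map_permutation {1..m} (\<lambda>x. x - 1) \<in> {p. p permutes {1..m}} \<rightarrow> {p. p permutes {0..<m}}"
      using map_permutation_permutes by blast
    show "map_permutation {1..m} (\<lambda>x. x - 1) (?F p) = p" if "p \<in> {p. p permutes {0..<m}}" for p
      using that by (intro map_permutation_compose_inv[OF bij_betw_Suc_1]) auto
    show "?F (map_permutation {1..m} (\<lambda>x. x - 1) p) = p" if "p \<in> {p. p permutes {1..m}}" for p
      using that by (intro map_permutation_compose_inv[OF b]) auto
  qed
  have "det (jmat m A) = (\<Sum>p | p permutes {0..<m}. signof p * (\<Prod>a = 0..<m. A (Suc a) (Suc (p a))))"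
    unfolding det_def'[OF jmat_carrier]
    by (intro sum.cong refl arg_cong2[of _ _ _ _ "(*)"] prod.cong)
      (metis atLeast0LessThan index_jmat lessThan_iff mem_Collect_eq permutes_in_image)
  also have "\<dots> = (\<Sum>p | p permutes {0..<m}. of_int (sign (?F p)) * (\<Prod>a\<in>{1..m}. A a (?F p a)))"
    by (intro sum.cong refl arg_cong2[of _ _ _ _ "(*)"])
      (auto simp: sign_map_permutation prod_shift_1 map_permutation_apply intro!: prod.cong)
  also have "\<dots> = detm m A"
    unfolding detm_def by (rule sum.reindex_bij_betw[OF bij])
  finally show ?thesis ..
qed

lemma detm_mmul: "detm m (mmul m A B) = detm m A * detm m B"
proof -
  have "jmat m (mmul m A B) = jmat m A * jmat m B"
    by (rule eq_matI) (auto simp: mmul_def scalar_prod_def sum_shift_1[of _ m])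
  then show ?thesis
    by (simp add: detm_eq_det det_mult[OF jmat_carrier jmat_carrier])
qed

lemma detm_transpose: "detm m (\<lambda>a b. A b a) = detm m A"
proof -
  have "jmat m (\<lambda>a b. A b a) = transpose_mat (jmat m A)"
    by (rule eq_matI) auto
  then show ?thesis
    by (simp add: detm_eq_det det_transpose[OF jmat_carrier])
qed

lemma detm_eq_0_iff:
  "detm m A = 0 \<longleftrightarrow> (\<exists>d. (\<exists>a\<in>{1..m}. d a \<noteq> 0) \<and> (\<forall>b\<in>{1..m}. (\<Sum>a=1..m. d a * A a b) = 0))"
proof -
  have "detm m A = det (jmat m (\<lambda>a b. A b a))"
    using detm_transpose[of m A] by (simp add: detm_eq_det)
  then have "detm m A = 0 \<longleftrightarrow> (\<exists>v. v \<in> carrier_vec m \<and> v \<noteq> 0\<^sub>v m \<and> jmat m (\<lambda>a b. A b a) *\<^sub>v v = 0\<^sub>v m)"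
    by (simp add: det_0_iff_vec_prod_zero[OF jmat_carrier])
  also have "\<dots> \<longleftrightarrow> (\<exists>d. (\<exists>a\<in>{1..m}. d a \<noteq> 0) \<and> (\<forall>b\<in>{1..m}. (\<Sum>a=1..m. d a * A a b) = 0))"
  proof (intro iffI; elim exE conjE)
    fix v :: "complex vec"
    assume v: "v \<in> carrier_vec m" "v \<noteq> 0\<^sub>v m" "jmat m (\<lambda>a b. A b a) *\<^sub>v v = 0\<^sub>v m"
    obtain a where a: "a < m" "v $ a \<noteq> 0"
      using v(1,2) by (metis carrier_vecD eq_vecI index_zero_vec)
    have "(\<Sum>a=1..m. v $ (a - 1) * A a b) = 0" if b: "b \<in> {1..m}" for b
    proof -
      have "(jmat m (\<lambda>a b. A b a) *\<^sub>v v) $ (b - 1) = 0"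
        using v(3) b by auto
      moreover have "(jmat m (\<lambda>a b. A b a) *\<^sub>v v) $ (b - 1) = (\<Sum>a=0..<m. A (Suc a) b * v $ a)"
        using b v(1) by (auto simp: scalar_prod_def intro!: sum.cong)
      ultimately show ?thesis
        by (simp add: sum_shift_1[of _ m] mult.commute)
    qed
    moreover have "v $ (Suc a - 1) \<noteq> 0" "Suc a \<in> {1..m}"
      using a by auto
    ultimately show "\<exists>d. (\<exists>a\<in>{1..m}. d a \<noteq> 0) \<and> (\<forall>b\<in>{1..m}. (\<Sum>a=1..m. d a * A a b) = 0)"
      by (intro exI[of _ "\<lambda>a. v $ (a - 1)"]) blast
  next
    fix d
    assume d: "\<exists>a\<in>{1..m}. d a \<noteq> 0" "\<forall>b\<in>{1..m}. (\<Sum>a=1..m. d a * A a b) = 0"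
    let ?v = "vec m (\<lambda>a. d (Suc a))"
    obtain a where a: "a \<in> {1..m}" "d a \<noteq> 0"
      using d(1) by blast
    then have "?v $ (a - 1) \<noteq> 0\<^sub>v m $ (a - 1)"
      by auto
    then have "?v \<noteq> 0\<^sub>v m"
      by auto
    moreover have "jmat m (\<lambda>a b. A b a) *\<^sub>v ?v = 0\<^sub>v m"
    proof (rule eq_vecI)
      fix b assume "b < dim_vec (0\<^sub>v m :: complex vec)"
      then have b: "b < m" by simp
      have "(jmat m (\<lambda>a b. A b a) *\<^sub>v ?v) $ b = (\<Sum>a=1..m. d a * A a (Suc b))"
        using b by (auto simp: scalar_prod_def sum_shift_1 mult.commute intro!: sum.cong)
      then show "(jmat m (\<lambda>a b. A b a) *\<^sub>v ?v) $ b = 0\<^sub>v m $ b"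
        using d(2) b by auto
    qed auto
    ultimately show "\<exists>v. v \<in> carrier_vec m \<and> v \<noteq> 0\<^sub>v m \<and> jmat m (\<lambda>a b. A b a) *\<^sub>v v = 0\<^sub>v m"
      by (intro exI[of _ ?v]) auto
  qed
  finally show ?thesis .
qed

text \<open>The easy half of the Frobenius-Koenig theorem: \<open>R\<close> is too large to be
  mapped injectively into the complement of \<open>C\<close>, so every Leibniz term has a factor
  from the zero block.\<close>

lemma detm_zero_block:
  assumes R: "R \<subseteq> {1..m}" and C: "C \<subseteq> {1..m}" and card: "card R + card C > m"
    and zero: "\<And>a b. a \<in> R \<Longrightarrow> b \<in> C \<Longrightarrow> A a b = 0"
  shows "detm m A = 0"
  unfolding detm_def
proof (rule sum.neutral, rule ballI)
  fix p assume "p \<in> {p. p permutes {1..m}}"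
  then have p: "p permutes {1..m}" by simp
  have fin: "finite R" "finite C"
    using R C finite_subset by blast+
  have "p ` R \<inter> C \<noteq> {}"
  proof
    assume "p ` R \<inter> C = {}"
    then have "card (p ` R \<union> C) = card R + card C"
      using fin by (simp add: card_Un_disjoint card_image inj_on_subset[OF permutes_inj[OF p]])
    moreover have "p ` R \<union> C \<subseteq> {1..m}"
      using R C permutes_in_image[OF p] by blast
    ultimately show False
      using card card_mono[of "{1..m}" "p ` R \<union> C"] by simp
  qed
  then obtain a where a: "a \<in> R" "p a \<in> C" by blast
  then have "(\<Prod>a\<in>{1..m}. A a (p a)) = 0"
    using R zero by (intro prod_zero) auto
  then show "of_int (sign p) * (\<Prod>a\<in>{1..m}. A a (p a)) = 0" by simp
qed

lemma detm_permute_cols: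
  assumes "\<sigma> permutes {1..m}"
  shows "detm m (\<lambda>a b. A a (\<sigma> b)) = of_int (sign \<sigma>) * detm m A"
proof -
  have perm: "permutation p" if "p permutes {1..m}" for p
    using that permutation_permutes finite_atLeastAtMost by blast
  have "of_int (sign \<sigma>) * detm m A = (\<Sum>p | p permutes {1..m}.
      of_int (sign \<sigma>) * (of_int (sign (\<sigma> \<circ> p)) * (\<Prod>a\<in>{1..m}. A a ((\<sigma> \<circ> p) a))))"
    unfolding detm_def sum_distrib_left
    by (rule setum_permutations_compose_left[OF assms])
  also have "\<dots> = detm m (\<lambda>a b. A a (\<sigma> b))"
    unfolding detm_def
  proof (rule sum.cong[OF refl])
    fix p assume "p \<in> {p. p permutes {1..m}}"
    then have "sign (\<sigma> \<circ> p) = sign \<sigma> * sign p"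
      using assms perm by (intro sign_compose) auto
    then have "of_int (sign \<sigma>) * (of_int (sign (\<sigma> \<circ> p)) :: complex) = of_int (sign p)"
      by (metis of_int_mult mult.assoc sign_left_idempotent)
    then show "of_int (sign \<sigma>) * (of_int (sign (\<sigma> \<circ> p)) * (\<Prod>a = 1..m. A a ((\<sigma> \<circ> p) a))) =
        of_int (sign p) * (\<Prod>a = 1..m. A a (\<sigma> (p a)))"
      by (simp flip: mult.assoc)
  qed
  finally show ?thesis ..
qed

lemma detm_block_diag:
  "detm (s + t) (\<lambda>a b. if a \<le> s \<longleftrightarrow> b \<le> s then A a b else 0)
     = detm s A * detm t (\<lambda>a b. A (s + a) (s + b))"
proof -
  have "jmat (s + t) (\<lambda>a b. if a \<le> s \<longleftrightarrow> b \<le> s then A a b else 0)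
     = four_block_mat (jmat s A) (0\<^sub>m s t) (0\<^sub>m t s) (jmat t (\<lambda>a b. A (s + a) (s + b)))"
    by (rule eq_matI) auto
  then show ?thesis
    by (simp add: detm_eq_det det_four_block_mat_lower_left_zero[OF jmat_carrier _ refl jmat_carrier])
qed

lemma detm_upper_triangular:
  assumes "\<And>a b. b < a \<Longrightarrow> a \<in> {1..m} \<Longrightarrow> b \<in> {1..m} \<Longrightarrow> A a b = 0"
  shows "detm m A = (\<Prod>a=1..m. A a a)"
proof -
  have "upper_triangular (jmat m A)"
    using assms by (auto simp: upper_triangular_def)
  then have "det (jmat m A) = prod_list (diag_mat (jmat m A))"
    by (rule det_upper_triangular[OF _ jmat_carrier])
  then show ?thesis
    by (simp add: detm_eq_det prod_list_diag_prod prod_shift_1)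
qed

lemma detm_repeated_col:
  assumes "b \<in> {1..m}" "b' \<in> {1..m}" "b \<noteq> b'" "\<And>a. a \<in> {1..m} \<Longrightarrow> A a b = A a b'"
  shows "detm m A = 0"
proof -
  have p: "Transposition.transpose b b' permutes {1..m}"
    using assms by (simp add: permutes_swap_id)
  have "detm m A = detm m (\<lambda>a c. A a (Transposition.transpose b b' c))"
    using assms by (intro detm_cong) (auto simp: Transposition.transpose_def)
  also have "\<dots> = - detm m A"
    unfolding detm_permute_cols[OF p] using assms by (simp add: sign_swap_id)
  finally show ?thesis by simp
qed

lemma detm_zero_col:
  assumes "b \<in> {1..m}" "\<And>a. a \<in> {1..m} \<Longrightarrow> A a b = 0"
  shows "detm m A = 0"
  using assms by (intro detm_zero_block[of "{1..m}" m "{b}"]) auto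

lemma detm_scale_row:
  assumes "c \<in> {1..m}"
  shows "detm m (\<lambda>a b. if a = c then x * A a b else A a b) = x * detm m A"
  unfolding detm_def sum_distrib_left
proof (rule sum.cong[OF refl])
  fix p :: "nat \<Rightarrow> nat"
  have "(\<Prod>a = 1..m. if a = c then x * A a (p a) else A a (p a))
     = (\<Prod>a = 1..m. (if a = c then x else 1) * A a (p a))"
    by (intro prod.cong) auto
  also have "\<dots> = x * (\<Prod>a = 1..m. A a (p a))"
    using assms by (simp add: prod.distrib prod.delta)
  finally show "of_int (sign p) * (\<Prod>a = 1..m. if a = c then x * A a (p a) else A a (p a))
     = x * (of_int (sign p) * (\<Prod>a = 1..m. A a (p a)))" by simp
qed

section \<open>Laplace expansion and the quadratic form\<close>

definition enum :: "nat set \<Rightarrow> nat \<Rightarrow> nat" where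
  "enum J b = sorted_list_of_set J ! (b - 1)"

lemma plucker_enum: "plucker M J = detm (card J) (\<lambda>a b. M a (enum J b))"
  by (simp add: plucker_def enum_def)

lemma bij_betw_enum:
  assumes "finite J"
  shows "bij_betw (enum J) {1..card J} J"
proof -
  have "bij_betw ((!) (sorted_list_of_set J)) {0..<card J} J"
    using assms by (intro bij_betw_nth) auto
  moreover have "bij_betw (\<lambda>b. b - 1) {1..card J} {0..<card J}"
    by (rule bij_betwI[where g = Suc]) auto
  ultimately have "bij_betw ((!) (sorted_list_of_set J) \<circ> (\<lambda>b. b - 1)) {1..card J} J"
    by (rule bij_betw_trans[rotated])
  then show ?thesis
    by (simp add: enum_def[abs_def] o_def)
qed

lemma strict_mono_on_enum:
  assumes "finite J"
  shows "strict_mono_on {1..card J} (enum J)"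
proof (rule strict_mono_onI)
  fix r s assume "r \<in> {1..card J}" "s \<in> {1..card J}" "r < s"
  then show "enum J r < enum J s"
    using sorted_wrt_nth_less[OF strict_sorted_list_of_set[of J], of "r - 1" "s - 1"] assms
    by (auto simp: enum_def)
qed

lemma enum_unique:
  assumes e: "strict_mono_on {1..card J} e" "e ` {1..card J} = J" and b: "b \<in> {1..card J}"
  shows "e b = enum J b"
proof -
  have fin: "finite J"
    using e(2) by (metis finite_atLeastAtMost finite_imageI)
  have "sorted_wrt (<) (map e [1..<Suc (card J)])"
    using e(1) by (auto simp: sorted_wrt_map sorted_wrt_iff_nth_less nth_append strict_mono_on_def simp del: upt_Suc)
  moreover have "set (map e [1..<Suc (card J)]) = J"
    using e(2) by (auto simp: atLeastLessThanSuc_atLeastAtMost simp del: upt_Suc)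
  ultimately have "map e [1..<Suc (card J)] = sorted_list_of_set J"
    using fin by (intro strict_sorted_equal) auto
  then show ?thesis
    using b by (auto simp: enum_def simp del: upt_Suc dest!: arg_cong[of _ _ "\<lambda>xs. xs ! (b - 1)"])
qed

text \<open>Frees a Pluecker coordinate from \<open>sorted_list_of_set\<close>: increasing
  enumerations of \<open>J\<close> are unique, so one that comes from a shuffle or an index shift
  may be used.\<close>

lemma plucker_eq_detm:
  assumes "strict_mono_on {1..card J} e" "e ` {1..card J} = J"
  shows "plucker M J = detm (card J) (\<lambda>a b. M a (e b))"
  unfolding plucker_enum by (rule detm_cong) (simp add: enum_unique[OF assms])

lemma plucker_cong:
  assumes "finite J" "\<And>a b. a \<in> {1..card J} \<Longrightarrow> b \<in> J \<Longrightarrow> M a b = N a b"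
  shows "plucker M J = plucker N J"
  unfolding plucker_enum
  using assms bij_betwE[OF bij_betw_enum[OF assms(1)]] by (intro detm_cong) blast

lemma plucker_eq_0_iff:
  assumes "finite J"
  shows "plucker M J = 0 \<longleftrightarrow>
    (\<exists>d. (\<exists>a\<in>{1..card J}. d a \<noteq> 0) \<and> (\<forall>b\<in>J. (\<Sum>a=1..card J. d a * M a b) = 0))"
proof -
  have "(\<forall>b\<in>J. P b) \<longleftrightarrow> (\<forall>b\<in>{1..card J}. P (enum J b))" for P
    using bij_betw_enum[OF assms] by (metis bij_betw_imp_surj_on imageE imageI)
  then show ?thesis
    by (simp add: plucker_enum detm_eq_0_iff)
qed

lemma plucker_image:
  assumes "finite J" "strict_mono_on J \<phi>"
  shows "plucker M (\<phi> ` J) = plucker (\<lambda>a b. M a (\<phi> b)) J"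
proof -
  have card: "card (\<phi> ` J) = card J"
    using assms(2) strict_mono_on_imp_inj_on card_image by blast
  have e: "enum J b \<in> J" if "b \<in> {1..card J}" for b
    using that bij_betwE[OF bij_betw_enum[OF assms(1)]] by blast
  have mono: "strict_mono_on {1..card (\<phi> ` J)} (\<phi> \<circ> enum J)"
    unfolding card using assms(2) e strict_mono_on_enum[OF assms(1)] by (auto simp: strict_mono_on_def)
  have im: "(\<phi> \<circ> enum J) ` {1..card (\<phi> ` J)} = \<phi> ` J"
    unfolding card using bij_betw_enum[OF assms(1)] by (metis bij_betw_def image_comp)
  show ?thesis
    unfolding plucker_eq_detm[OF mono im] unfolding card plucker_enum by simp
qed

lemma plucker_repeated_col:
  assumes "finite J" "b \<in> J" "b' \<in> J" "b \<noteq> b'" "\<And>a. M a b = M a b'"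
  shows "plucker M J = 0"
proof -
  obtain c c' where "c \<in> {1..card J}" "c' \<in> {1..card J}" "enum J c = b" "enum J c' = b'"
    using bij_betw_imp_surj_on[OF bij_betw_enum[OF assms(1)]] assms(2,3) by (metis imageE)
  then show ?thesis
    unfolding plucker_enum using assms(4,5) by (intro detm_repeated_col[of c _ c']) auto
qed

lemma plucker_zero_col:
  assumes "finite J" "b \<in> J" "\<And>a. a \<in> {1..card J} \<Longrightarrow> M a b = 0"
  shows "plucker M J = 0"
proof -
  obtain c where "c \<in> {1..card J}" "enum J c = b"
    using bij_betw_imp_surj_on[OF bij_betw_enum[OF assms(1)]] assms(2) by (metis imageE)
  then show ?thesis
    unfolding plucker_enum using assms(3) by (intro detm_zero_col[of c]) auto
qed

text \<open>Induction on \<open>\<Sum>I\<close>: moving an element \<open>x\<close> of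
  \<open>I\<close> down to a free place \<open>x - 1\<close> costs one adjacent transposition, that
  is one sign and one unit of the sum, until \<open>I = {1..s}\<close>, where the identity serves.
  The summand \<open>\<Sum>{1..s}\<close> makes the exponent even there.\<close>

lemma shuffle_sign:
  assumes "I \<subseteq> {1..s + t}" "card I = s"
  shows "\<exists>\<sigma>. \<sigma> permutes {1..s + t} \<and> strict_mono_on {1..s} \<sigma> \<and> strict_mono_on {s + 1..s + t} \<sigma> \<and>
    \<sigma> ` {1..s} = I \<and> sign \<sigma> = (-1) ^ (\<Sum>I + \<Sum>{1..s})"
  using assms
proof (induction "\<Sum>I" arbitrary: I rule: less_induct)
  case less
  have fin: "finite I"
    using less.prems(1) finite_subset by blast
  show ?case
  proof (cases "I = {1..s}")
    case True
    then show ?thesis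
      by (intro exI[of _ id]) (auto simp: permutes_id strict_mono_on_def simp flip: mult_2)
  next
    case False
    \<comment> \<open>Without such an \<open>x\<close> the set would be closed downwards to 1, hence
      contained in \<open>{1..s}\<close> by its size and equal to it.\<close>
    have "\<exists>x\<in>I. x - 1 \<notin> I \<and> 2 \<le> x"
    proof (rule ccontr)
      assume neg: "\<not> (\<exists>x\<in>I. x - 1 \<notin> I \<and> 2 \<le> x)"
      have down: "{1..x} \<subseteq> I" if "x \<in> I" for x
        using that
      proof (induction x)
        case (Suc x)
        show ?case
        proof (cases "x = 0")
          case True
          then show ?thesis using Suc.prems by (simp add: One_nat_def)
        next
          case False
          then have "x \<in> I" using neg Suc.prems by force
          then have "{1..x} \<subseteq> I" by (rule Suc.IH)
          then show ?thesis using Suc.prems by (auto simp: le_Suc_eq)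
        qed
      qed simp
      have "I \<subseteq> {1..s}"
      proof
        fix x assume x: "x \<in> I"
        then have "card {1..x} \<le> card I"
          using down fin card_mono by blast
        then show "x \<in> {1..s}"
          using less.prems x by auto
      qed
      then show False
        using less.prems(2) False by (metis card_atLeastAtMost card_subset_eq diff_Suc_1 finite_atLeastAtMost One_nat_def)
    qed
    then obtain x where x: "x \<in> I" "x - 1 \<notin> I" "2 \<le> x" by blast
    define I' where "I' = insert (x - 1) (I - {x})"
    have sumI: "\<Sum>I = Suc (\<Sum>I')"
      using x fin by (simp add: I'_def sum.remove[of I x])
    have "card I' = s"
    proof -
      have "card I' = Suc (card (I - {x}))"
        unfolding I'_def using x fin by (intro card_insert_disjoint) auto
      then show ?thesis
        using card_Suc_Diff1[OF fin x(1)] less.prems(2) by simp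
    qed
    moreover have "I' \<subseteq> {1..s + t}"
      using x less.prems(1) by (auto simp: I'_def)
    ultimately obtain \<sigma> where \<sigma>: "\<sigma> permutes {1..s + t}" "strict_mono_on {1..s} \<sigma>"
        "strict_mono_on {s + 1..s + t} \<sigma>" "\<sigma> ` {1..s} = I'" "sign \<sigma> = (-1) ^ (\<Sum>I' + \<Sum>{1..s})"
      using less.hyps[of I'] sumI by auto
    let ?\<tau> = "Transposition.transpose (x - 1) x"
    have \<tau>: "?\<tau> permutes {1..s + t}"
      using x less.prems(1) by (intro permutes_swap_id) auto
    have inI': "\<sigma> b \<in> I' \<longleftrightarrow> b \<in> {1..s}" for b
      unfolding \<sigma>(4)[symmetric] using permutes_inj[OF \<sigma>(1)] by (simp add: inj_image_mem_iff)
    have x_notin: "x \<notin> I'" "x - 1 \<in> I'"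
      using x by (auto simp: I'_def)
    \<comment> \<open>An adjacent transposition reverses the order of \<open>x - 1\<close> and
      \<open>x\<close> only, and \<sigma> takes these two values in different blocks, since
      \<open>x - 1\<close> lies in \<open>I'\<close> and \<open>x\<close> does not.\<close>
    have "strict_mono_on {1..s} (?\<tau> \<circ> \<sigma>)"
    proof (rule strict_mono_onI)
      fix b c assume bc: "b \<in> {1..s}" "c \<in> {1..s}" "b < c"
      then have "\<sigma> b < \<sigma> c" using \<sigma>(2) by (auto simp: strict_mono_on_def)
      moreover have "\<sigma> b \<noteq> x" "\<sigma> c \<noteq> x"
        using inI' x_notin bc by metis+
      ultimately show "(?\<tau> \<circ> \<sigma>) b < (?\<tau> \<circ> \<sigma>) c"
        by (auto simp: Transposition.transpose_def)
    qed
    moreover have "strict_mono_on {s + 1..s + t} (?\<tau> \<circ> \<sigma>)"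
    proof (rule strict_mono_onI)
      fix b c assume bc: "b \<in> {s + 1..s + t}" "c \<in> {s + 1..s + t}" "b < c"
      then have "\<sigma> b < \<sigma> c" using \<sigma>(3) by (auto simp: strict_mono_on_def)
      moreover have "\<sigma> b \<noteq> x - 1" "\<sigma> c \<noteq> x - 1"
        using inI'[of b] inI'[of c] x_notin bc by auto
      ultimately show "(?\<tau> \<circ> \<sigma>) b < (?\<tau> \<circ> \<sigma>) c"
        by (auto simp: Transposition.transpose_def)
    qed
    moreover have "(?\<tau> \<circ> \<sigma>) ` {1..s} = I"
    proof -
      have "(?\<tau> \<circ> \<sigma>) ` {1..s} = ?\<tau> ` I'"
        using \<sigma>(4) by (metis image_comp)
      also have "\<dots> = I"
        using x by (auto simp: I'_def Transposition.transpose_def image_iff)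
      finally show ?thesis .
    qed
    moreover have "sign (?\<tau> \<circ> \<sigma>) = (-1) ^ (\<Sum>I + \<Sum>{1..s})"
    proof -
      have "sign (?\<tau> \<circ> \<sigma>) = sign ?\<tau> * sign \<sigma>"
        using \<tau> \<sigma>(1) permutation_permutes finite_atLeastAtMost by (intro sign_compose) blast+
      then show ?thesis
        using x(3) \<sigma>(5) sumI by (simp add: sign_swap_id)
    qed
    ultimately show ?thesis
      using permutes_compose[OF \<sigma>(1) \<tau>] by blast
  qed
qed

text \<open>Sorts the Leibniz sum by the image \<open>I\<close> of the first \<open>s\<close> rows.
  The mask \<open>DI I\<close> keeps exactly the terms with this image, and after permuting the
  columns by the shuffle of \<open>I\<close> it is block diagonal.\<close>

lemma detm_laplace:
  "detm (s + t) D = (\<Sum>I | I \<subseteq> {1..s + t} \<and> card I = s.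
     (-1) ^ (\<Sum>I + \<Sum>{1..s}) * (plucker D I * plucker (\<lambda>a b. D (s + a) b) ({1..s + t} - I)))"
    (is "_ = (\<Sum>I\<in>?\<I>. _)")
proof -
  define DI where "DI I = (\<lambda>a b. if a \<le> s \<longleftrightarrow> b \<in> I then D a b else 0)" for I
  have fin: "finite ?\<I>"
    by (rule finite_subset[of _ "Pow {1..s + t}"]) auto
  have "detm (s + t) D = (\<Sum>p | p permutes {1..s + t}. \<Sum>I\<in>?\<I>. of_int (sign p) * (\<Prod>a\<in>{1..s + t}. DI I a (p a)))"
    unfolding detm_def
  proof (rule sum.cong[OF refl])
    fix p assume "p \<in> {p. p permutes {1..s + t}}"
    then have p: "p permutes {1..s + t}" by simp
    have prod: "(\<Prod>a\<in>{1..s + t}. DI I a (p a)) = (if I = p ` {1..s} then \<Prod>a\<in>{1..s + t}. D a (p a) else 0)"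
      if I: "I \<in> ?\<I>" for I
    proof (cases "I = p ` {1..s}")
      case True
      have "p a \<in> I \<longleftrightarrow> a \<in> {1..s}" for a
        unfolding True using permutes_inj[OF p] by (simp add: inj_image_mem_iff)
      then show ?thesis
        using True by (auto simp: DI_def intro!: prod.cong)
    next
      case False
      have "\<exists>a\<in>{1..s + t}. \<not> (a \<le> s \<longleftrightarrow> p a \<in> I)"
      proof (rule ccontr)
        assume "\<not> ?thesis"
        then have *: "\<And>a. a \<in> {1..s + t} \<Longrightarrow> a \<le> s \<longleftrightarrow> p a \<in> I" by blast
        have "I = p ` {1..s}"
        proof
          show "p ` {1..s} \<subseteq> I" using * by (metis atLeastAtMost_iff image_subsetI le_add1 order_trans)
          show "I \<subseteq> p ` {1..s}"
          proof
            fix y assume y: "y \<in> I"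
            then have "y \<in> p ` {1..s + t}"
              using I permutes_image[OF p] by blast
            then show "y \<in> p ` {1..s}"
              using * y by auto
          qed
        qed
        then show False using False by simp
      qed
      then show ?thesis
        using False by (auto simp: DI_def intro!: prod_zero)
    qed
    have "p ` {1..s} \<in> ?\<I>"
      using permutes_in_image[OF p] by (auto simp: card_image inj_on_subset[OF permutes_inj[OF p]])
    then have "(\<Sum>I\<in>?\<I>. of_int (sign p) * (if I = p ` {1..s} then \<Prod>a\<in>{1..s + t}. D a (p a) else 0))
        = of_int (sign p) * (\<Prod>a\<in>{1..s + t}. D a (p a))"
      using fin by (simp add: sum_distrib_left[symmetric])
    then show "of_int (sign p) * (\<Prod>a\<in>{1..s + t}. D a (p a))
        = (\<Sum>I\<in>?\<I>. of_int (sign p) * (\<Prod>a\<in>{1..s + t}. DI I a (p a)))"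
      using prod by simp
  qed
  also have "\<dots> = (\<Sum>I\<in>?\<I>. detm (s + t) (DI I))"
    unfolding detm_def by (rule sum.swap)
  also have "\<dots> = (\<Sum>I\<in>?\<I>. (-1) ^ (\<Sum>I + \<Sum>{1..s}) *
      (plucker D I * plucker (\<lambda>a b. D (s + a) b) ({1..s + t} - I)))"
  proof (rule sum.cong[OF refl])
    fix I assume "I \<in> ?\<I>"
    then have I: "I \<subseteq> {1..s + t}" "card I = s" by auto
    obtain \<sigma> where \<sigma>: "\<sigma> permutes {1..s + t}" "strict_mono_on {1..s} \<sigma>"
        "strict_mono_on {s + 1..s + t} \<sigma>" "\<sigma> ` {1..s} = I" "sign \<sigma> = (-1) ^ (\<Sum>I + \<Sum>{1..s})"
      using shuffle_sign[OF I] by blast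
    have inI: "\<sigma> b \<in> I \<longleftrightarrow> b \<in> {1..s}" for b
      unfolding \<sigma>(4)[symmetric] using permutes_inj[OF \<sigma>(1)] by (simp add: inj_image_mem_iff)
    have "of_int (sign \<sigma>) * detm (s + t) (DI I) = detm (s + t) (\<lambda>a b. DI I a (\<sigma> b))"
      by (rule detm_permute_cols[OF \<sigma>(1), symmetric])
    also have "\<dots> = detm (s + t) (\<lambda>a b. if a \<le> s \<longleftrightarrow> b \<le> s then D a (\<sigma> b) else 0)"
      by (rule detm_cong) (auto simp: DI_def inI)
    also have "\<dots> = detm s (\<lambda>a b. D a (\<sigma> b)) * detm t (\<lambda>a b. D (s + a) (\<sigma> (s + b)))"
      by (rule detm_block_diag)
    also have "detm s (\<lambda>a b. D a (\<sigma> b)) = plucker D I"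
      using plucker_eq_detm[of I \<sigma> D] \<sigma> I by simp
    also have "detm t (\<lambda>a b. D (s + a) (\<sigma> (s + b))) = plucker (\<lambda>a b. D (s + a) b) ({1..s + t} - I)"
    proof -
      have card: "card ({1..s + t} - I) = t"
        using I by (simp add: card_Diff_subset finite_subset[OF I(1)])
      have "(\<lambda>b. \<sigma> (s + b)) ` {1..t} = \<sigma> ` ({1..s + t} - {1..s})"
      proof -
        have "(+) s ` {1..t} = {1..s + t} - {1..s}"
          unfolding image_add_atLeastAtMost by auto
        then show ?thesis by (metis image_image)
      qed
      also have "\<dots> = {1..s + t} - I"
        using \<sigma>(4) permutes_image[OF \<sigma>(1)] by (simp add: image_set_diff[OF permutes_inj[OF \<sigma>(1)]])
      finally have im: "(\<lambda>b. \<sigma> (s + b)) ` {1..t} = {1..s + t} - I" .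
      have mono: "strict_mono_on {1..t} (\<lambda>b. \<sigma> (s + b))"
        using \<sigma>(3) by (auto simp: strict_mono_on_def)
      show ?thesis
        using plucker_eq_detm[of "{1..s + t} - I" "\<lambda>b. \<sigma> (s + b)" "\<lambda>a b. D (s + a) b"] card im mono by simp
    qed
    finally have *: "of_int (sign \<sigma>) * detm (s + t) (DI I)
        = plucker D I * plucker (\<lambda>a b. D (s + a) b) ({1..s + t} - I)" .
    have "(of_int (sign \<sigma>) :: complex) * of_int (sign \<sigma>) = 1"
      by (metis of_int_1 of_int_mult sign_idempotent)
    then have "detm (s + t) (DI I) = of_int (sign \<sigma>) * (of_int (sign \<sigma>) * detm (s + t) (DI I))"
      by (simp flip: mult.assoc)
    then show "detm (s + t) (DI I) = (-1) ^ (\<Sum>I + \<Sum>{1..s}) *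
        (plucker D I * plucker (\<lambda>a b. D (s + a) b) ({1..s + t} - I))"
      unfolding * by (simp add: \<sigma>(5))
  qed
  finally show ?thesis .
qed

lemma sum_split_at:
  fixes f :: "nat \<Rightarrow> 'a::comm_monoid_add"
  shows "(\<Sum>r=1..s + t. f r) = (\<Sum>r=1..s. f r) + (\<Sum>r=1..t. f (s + r))"
  by (induction t) (simp_all add: add.assoc)

text \<open>The first \<open>s\<close> rows stand for \<nu>, the others for \<open>x\<close>. Column
  \<open>i + t\<close> repeats column \<open>m + t\<close> of \<open>M\<close>, so a column
  \<open>b\<close> of \<open>M\<close> with \<open>m < b \<le> i\<close> occurs twice in the lower
  rows.\<close>

definition shuffle_mat :: "nat \<Rightarrow> nat \<Rightarrow> nat \<Rightarrow> (nat \<Rightarrow> nat \<Rightarrow> complex) \<Rightarrow> (nat \<Rightarrow> nat \<Rightarrow> complex)" where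
  "shuffle_mat s i m M = (\<lambda>r b. if r \<le> s then (if b \<le> i then M r b else 0)
      else M (r - s) (if b \<le> i then b else m + (b - i)))"

text \<open>The quadratic form is, up to sign, a single determinant: its Laplace expansion along the
  first rows produces the form, the terms with \<open>J\<close> not contained in \<open>{1..m}\<close> vanishing because of
  a repeated column.\<close>

lemma quadric_eq_detm:
  assumes i: "i = s + k" "i \<le> n" and c: "c = n - m + k" and m: "m \<le> n" "l = min i m"
  shows "detm (s + c) (shuffle_mat s i m M) = (-1) ^ (\<Sum>{1..i} + \<Sum>{1..s}) *
    (\<Sum>J | J \<subseteq> {1..l} \<and> card J = k.
      (-1) ^ (\<Sum>J) * plucker M ({1..i} - J) * plucker M (J \<union> {m<..n}))"
proof -
  let ?D = "shuffle_mat s i m M"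
  define T where "T I = (-1) ^ (\<Sum>I + \<Sum>{1..s}) *
     (plucker ?D I * plucker (\<lambda>a b. ?D (s + a) b) ({1..s + c} - I))" for I
  have sc: "s + c = i + (n - m)" using i c by simp
  have "detm (s + c) ?D = (\<Sum>I | I \<subseteq> {1..s + c} \<and> card I = s. T I)"
    unfolding T_def by (rule detm_laplace)
  also have "\<dots> = (\<Sum>I | I \<subseteq> {1..i} \<and> card I = s. T I)"
  proof (rule sum.mono_neutral_right)
    show "finite {I. I \<subseteq> {1..s + c} \<and> card I = s}"
      by (rule finite_subset[of _ "Pow {1..s + c}"]) auto
    show "{I. I \<subseteq> {1..i} \<and> card I = s} \<subseteq> {I. I \<subseteq> {1..s + c} \<and> card I = s}"
      using sc by auto
    show "\<forall>I\<in>{I. I \<subseteq> {1..s + c} \<and> card I = s} - {I. I \<subseteq> {1..i} \<and> card I = s}. T I = 0"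
    proof
      \<comment> \<open>A set \<open>I\<close> reaching beyond \<open>i\<close> selects a column
        whose first \<open>s\<close> entries are zero by construction.\<close>
      fix I assume I: "I \<in> {I. I \<subseteq> {1..s + c} \<and> card I = s} - {I. I \<subseteq> {1..i} \<and> card I = s}"
      then obtain b where "b \<in> I" "b > i" by force
      moreover have "finite I" "card I = s" using I finite_subset by blast+
      ultimately have "plucker ?D I = 0"
        by (intro plucker_zero_col[of I b]) (auto simp: shuffle_mat_def)
      then show "T I = 0" by (simp add: T_def)
    qed
  qed
  also have "\<dots> = (\<Sum>J | J \<subseteq> {1..i} \<and> card J = k. T ({1..i} - J))"
  proof (rule sum.reindex_bij_betw[symmetric], rule bij_betwI[where g = "\<lambda>I. {1..i} - I"])
    have "card ({1..i} - J) = i - card J" if "J \<subseteq> {1..i}" for J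
      using card_Diff_subset[OF finite_subset[OF that] that] by simp
    then show "(\<lambda>J. {1..i} - J) \<in> {J. J \<subseteq> {1..i} \<and> card J = k} \<rightarrow> {I. I \<subseteq> {1..i} \<and> card I = s}"
      "(\<lambda>I. {1..i} - I) \<in> {I. I \<subseteq> {1..i} \<and> card I = s} \<rightarrow> {J. J \<subseteq> {1..i} \<and> card J = k}"
      using i(1) by auto
  qed (auto simp: double_diff)
  also have "\<dots> = (\<Sum>J | J \<subseteq> {1..l} \<and> card J = k. T ({1..i} - J))"
  proof (rule sum.mono_neutral_right)
    show "finite {J. J \<subseteq> {1..i} \<and> card J = k}"
      by (rule finite_subset[of _ "Pow {1..i}"]) auto
    show "{J. J \<subseteq> {1..l} \<and> card J = k} \<subseteq> {J. J \<subseteq> {1..i} \<and> card J = k}"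
      using m by auto
    show "\<forall>J\<in>{J. J \<subseteq> {1..i} \<and> card J = k} - {J. J \<subseteq> {1..l} \<and> card J = k}. T ({1..i} - J) = 0"
    proof
      fix J assume J: "J \<in> {J. J \<subseteq> {1..i} \<and> card J = k} - {J. J \<subseteq> {1..l} \<and> card J = k}"
      then have Ji: "J \<subseteq> {1..i}" by simp
      obtain b where b: "b \<in> J" "m < b" using J m(2) by force
      then have "b \<le> i" using Ji by auto
      \<comment> \<open>The second copy of column \<open>b\<close> of \<open>M\<close>. As
        \<open>b\<close> lies in \<open>J\<close>, both places survive in \<open>?K\<close>.\<close>
      let ?b' = "i + (b - m)"
      let ?K = "{1..s + c} - ({1..i} - J)"
      have "plucker (\<lambda>a b. ?D (s + a) b) ?K = plucker (\<lambda>a b. M a (if b \<le> i then b else m + (b - i))) ?K"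
        by (intro plucker_cong) (auto simp: shuffle_mat_def)
      also have "\<dots> = 0"
        using b \<open>b \<le> i\<close> Ji sc i(2) by (intro plucker_repeated_col[of ?K b ?b']) auto
      finally have "plucker (\<lambda>a b. ?D (s + a) b) ?K = 0" .
      then show "T ({1..i} - J) = 0" by (simp add: T_def)
    qed
  qed
  also have "\<dots> = (\<Sum>J | J \<subseteq> {1..l} \<and> card J = k. (-1) ^ (\<Sum>{1..i} + \<Sum>{1..s}) *
      ((-1) ^ (\<Sum>J) * plucker M ({1..i} - J) * plucker M (J \<union> {m<..n})))"
  proof (rule sum.cong[OF refl])
    fix J assume "J \<in> {J. J \<subseteq> {1..l} \<and> card J = k}"
    then have J: "J \<subseteq> {1..i}" "J \<subseteq> {1..m}" "card J = k" using m by auto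
    have finJ: "finite J" using J(1) finite_subset by blast
    let ?\<phi> = "\<lambda>b. if b \<le> i then b else m + (b - i)"
    let ?J = "J \<union> {i<..s + c}"
    have "card ({1..i} - J) = s"
      using J i by (simp add: card_Diff_subset finJ)
    then have 1: "plucker ?D ({1..i} - J) = plucker M ({1..i} - J)"
      by (intro plucker_cong) (auto simp: shuffle_mat_def)
    have "{1..s + c} - ({1..i} - J) = ?J"
      using J sc by auto
    moreover have "plucker (\<lambda>a b. ?D (s + a) b) ?J = plucker (\<lambda>a b. M a (?\<phi> b)) ?J"
      using finJ by (intro plucker_cong) (auto simp: shuffle_mat_def)
    \<comment> \<open>\<open>J \<subseteq> {1..m}\<close> makes \<open>?\<phi>\<close> increasing on
      \<open>?J\<close>, so the columns come in the order that \<open>plucker\<close>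
      demands.\<close>
    moreover have "\<dots> = plucker M (?\<phi> ` ?J)"
      using finJ J(1,2) by (intro plucker_image[symmetric] strict_mono_onI) (auto dest!: subsetD[of J])
    moreover have "?\<phi> ` ?J = J \<union> {m<..n}"
    proof -
      have "?\<phi> ` J = J" using J(1) by (auto simp: image_iff)
      moreover have "?\<phi> ` {i<..s + c} = {m<..n}"
      proof (intro equalityI subsetI)
        fix y assume "y \<in> {m<..n}"
        then have "i + (y - m) \<in> {i<..s + c}" "?\<phi> (i + (y - m)) = y" using sc by auto
        then show "y \<in> ?\<phi> ` {i<..s + c}" by (rule rev_image_eqI[OF _ sym])
      qed (use sc m(1) in auto)
      ultimately show ?thesis by (simp only: image_Un)
    qed
    ultimately have 2: "plucker (\<lambda>a b. ?D (s + a) b) ({1..s + c} - ({1..i} - J)) = plucker M (J \<union> {m<..n})"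
      by simp
    have "\<Sum>{1..i} = \<Sum>({1..i} - J) + \<Sum>J"
      using J(1) by (simp add: sum.subset_diff)
    then have 3: "(-1 :: complex) ^ (\<Sum>({1..i} - J)) = (-1) ^ (\<Sum>{1..i}) * (-1) ^ (\<Sum>J)"
      by (simp add: power_add)
    show "T ({1..i} - J) = (-1) ^ (\<Sum>{1..i} + \<Sum>{1..s}) *
      ((-1) ^ (\<Sum>J) * plucker M ({1..i} - J) * plucker M (J \<union> {m<..n}))"
      unfolding T_def 1 2 power_add 3 by (simp only: mult_ac)
  qed
  finally show ?thesis by (simp add: sum_distrib_left)
qed

text \<open>A vanishing determinant means a relation between the rows of \<open>shuffle_mat\<close>:
  its first \<open>s\<close> coefficients are \<open>x\<close>, the remaining \<open>c\<close> are
  \<open>y\<close>, and the columns up to \<open>i\<close> and beyond \<open>i\<close> give the two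
  families of equations.\<close>

lemma quadric_eq_0_iff:
  assumes i: "i = s + k" "i \<le> n" and c: "c = n - m + k" and m: "m \<le> n" "l = min i m"
  shows "(\<Sum>J | J \<subseteq> {1..l} \<and> card J = k.
      (-1) ^ (\<Sum>J) * plucker M ({1..i} - J) * plucker M (J \<union> {m<..n})) = 0 \<longleftrightarrow>
    (\<exists>x y. ((\<exists>r\<in>{1..s}. x r \<noteq> 0) \<or> (\<exists>r\<in>{1..c}. y r \<noteq> 0)) \<and>
       (\<forall>b\<in>{1..i}. (\<Sum>r=1..s. x r * M r b) + (\<Sum>r=1..c. y r * M r b) = 0) \<and>
       (\<forall>b\<in>{m<..n}. (\<Sum>r=1..c. y r * M r b) = 0))" (is "?E = 0 \<longleftrightarrow> ?R")
proof -
  let ?D = "shuffle_mat s i m M"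
  have sc: "s + c = i + (n - m)" using i c by simp
  have sumD: "(\<Sum>r=1..s + c. d r * ?D r b) = (\<Sum>r=1..s. d r * ?D r b) +
      (\<Sum>r=1..c. d (s + r) * M r (if b \<le> i then b else m + (b - i)))" for b d
    unfolding sum_split_at by (intro arg_cong2[of _ _ _ _ "(+)"] sum.cong) (auto simp: shuffle_mat_def)
  have low: "(\<Sum>r=1..s + c. d r * ?D r b) = (\<Sum>r=1..s. d r * M r b) + (\<Sum>r=1..c. d (s + r) * M r b)"
    if "b \<in> {1..i}" for b d
    unfolding sumD using that by (intro arg_cong2[of _ _ _ _ "(+)"] sum.cong) (auto simp: shuffle_mat_def)
  have high: "(\<Sum>r=1..s + c. d r * ?D r (i + (b - m))) = (\<Sum>r=1..c. d (s + r) * M r b)"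
    if "b \<in> {m<..n}" for b d
  proof -
    have "\<not> i + (b - m) \<le> i" "m + (i + (b - m) - i) = b" using that by auto
    then show ?thesis unfolding sumD by (simp add: shuffle_mat_def)
  qed
  have "?E = 0 \<longleftrightarrow> detm (s + c) ?D = 0"
    unfolding quadric_eq_detm[OF assms] by simp
  also have "\<dots> \<longleftrightarrow> (\<exists>d. (\<exists>a\<in>{1..s + c}. d a \<noteq> 0) \<and> (\<forall>b\<in>{1..s + c}. (\<Sum>a=1..s + c. d a * ?D a b) = 0))"
    by (rule detm_eq_0_iff)
  also have "\<dots> \<longleftrightarrow> ?R"
  proof
    assume "\<exists>d. (\<exists>a\<in>{1..s + c}. d a \<noteq> 0) \<and> (\<forall>b\<in>{1..s + c}. (\<Sum>a=1..s + c. d a * ?D a b) = 0)"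
    then obtain d where d: "\<exists>a\<in>{1..s + c}. d a \<noteq> 0" "\<forall>b\<in>{1..s + c}. (\<Sum>a=1..s + c. d a * ?D a b) = 0"
      by blast
    obtain a where a: "a \<in> {1..s + c}" "d a \<noteq> 0" using d(1) by blast
    have "(\<exists>r\<in>{1..s}. d r \<noteq> 0) \<or> (\<exists>r\<in>{1..c}. d (s + r) \<noteq> 0)"
    proof (cases "a \<le> s")
      case True
      then show ?thesis using a by auto
    next
      case False
      then have "a - s \<in> {1..c}" "d (s + (a - s)) \<noteq> 0" using a by auto
      then show ?thesis by blast
    qed
    moreover have "\<forall>b\<in>{1..i}. (\<Sum>r=1..s. d r * M r b) + (\<Sum>r=1..c. d (s + r) * M r b) = 0"
    proof
      fix b assume b: "b \<in> {1..i}"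
      then have "b \<in> {1..s + c}" using sc by auto
      then show "(\<Sum>r=1..s. d r * M r b) + (\<Sum>r=1..c. d (s + r) * M r b) = 0"
        using d(2) low[OF b, of d] by metis
    qed
    moreover have "\<forall>b\<in>{m<..n}. (\<Sum>r=1..c. d (s + r) * M r b) = 0"
    proof
      fix b assume b: "b \<in> {m<..n}"
      then have "i + (b - m) \<in> {1..s + c}" using sc by auto
      then show "(\<Sum>r=1..c. d (s + r) * M r b) = 0"
        using d(2) high[OF b] by metis
    qed
    ultimately show ?R by (intro exI[of _ d] exI[of _ "\<lambda>r. d (s + r)"]) blast
  next
    assume ?R
    then obtain x y where xy: "(\<exists>r\<in>{1..s}. x r \<noteq> 0) \<or> (\<exists>r\<in>{1..c}. y r \<noteq> 0)"
       "\<forall>b\<in>{1..i}. (\<Sum>r=1..s. x r * M r b) + (\<Sum>r=1..c. y r * M r b) = 0"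
       "\<forall>b\<in>{m<..n}. (\<Sum>r=1..c. y r * M r b) = 0" by blast
    define d where "d r = (if r \<le> s then x r else y (r - s))" for r
    have dx: "(\<Sum>r=1..s. d r * M r b) = (\<Sum>r=1..s. x r * M r b)" for b
      by (intro sum.cong) (auto simp: d_def)
    have dy: "(\<Sum>r=1..c. d (s + r) * M r b) = (\<Sum>r=1..c. y r * M r b)" for b
      by (intro sum.cong) (auto simp: d_def)
    have "\<exists>a\<in>{1..s + c}. d a \<noteq> 0"
      using xy(1)
    proof
      assume "\<exists>r\<in>{1..s}. x r \<noteq> 0"
      then obtain r where "r \<in> {1..s}" "x r \<noteq> 0" by blast
      then show ?thesis by (intro bexI[of _ r]) (auto simp: d_def)
    next
      assume "\<exists>r\<in>{1..c}. y r \<noteq> 0"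
      then obtain r where "r \<in> {1..c}" "y r \<noteq> 0" by blast
      then show ?thesis by (intro bexI[of _ "s + r"]) (auto simp: d_def)
    qed
    moreover have "(\<Sum>a=1..s + c. d a * ?D a b) = 0" if b: "b \<in> {1..s + c}" for b
    proof (cases "b \<le> i")
      case True
      then show ?thesis using low[of b d] b xy(2) dx dy by simp
    next
      case False
      then have "m + (b - i) \<in> {m<..n}" "i + (m + (b - i) - m) = b" using b sc m(1) by auto
      then show ?thesis using high[of "m + (b - i)" d] xy(3) dy by simp
    qed
    ultimately show "\<exists>d. (\<exists>a\<in>{1..s + c}. d a \<noteq> 0) \<and> (\<forall>b\<in>{1..s + c}. (\<Sum>a=1..s + c. d a * ?D a b) = 0)"
      by blast
  qed
  finally show ?thesis .
qed

section \<open>Longest elements\<close>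

lemma stra_eq_transpose: "stra i = Transposition.transpose i (i + 1)"
  by (auto simp: stra_def Transposition.transpose_def fun_eq_iff)

lemma stra_permutes: "1 \<le> i \<Longrightarrow> i < n \<Longrightarrow> stra i permutes {1..n}"
  unfolding stra_eq_transpose by (rule permutes_swap_id) auto

lemma stra_stra [simp]: "stra i (stra i x) = x"
  by (simp add: stra_def)

lemma stra_comp_stra [simp]: "stra i \<circ> stra i = id"
  by (simp add: fun_eq_iff)

lemma wordperm_Nil: "wordperm [] = id"
  by (simp add: wordperm_def)

lemma wordperm_snoc: "wordperm (ws @ [i]) = wordperm ws \<circ> stra i"
proof -
  have "foldr (\<lambda>i w. stra i \<circ> w) ws (stra i) = foldr (\<lambda>i w. stra i \<circ> w) ws id \<circ> stra i"
    by (induction ws) (auto simp: o_assoc)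
  then show ?thesis
    by (simp add: wordperm_def)
qed

lemma wordperm_permutes: "set ws \<subseteq> {1..<n} \<Longrightarrow> wordperm ws permutes {1..n}"
proof (induction ws rule: rev_induct)
  case (snoc i ws)
  then show ?case
    unfolding wordperm_snoc by (intro permutes_compose stra_permutes) auto
qed (simp add: permutes_id wordperm_Nil)

lemma wordperm_image:
  assumes "set ws \<subseteq> {1..<n} - {j}" "j \<le> n"
  shows "wordperm ws ` {1..j} = {1..j}"
  using assms(1)
proof (induction ws rule: rev_induct)
  case (snoc i ws)
  have "stra i ` {1..j} \<subseteq> {1..j}"
    using snoc.prems by (auto simp: stra_def)
  then have "stra i ` {1..j} = {1..j}"
    by (metis endo_inj_surj finite_atLeastAtMost inj_on_inverseI stra_stra)
  then show ?case
    unfolding wordperm_snoc image_comp[symmetric] using snoc by simp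
qed (simp add: wordperm_Nil)

section \<open>Inversions and lengths\<close>

definition invs :: "nat \<Rightarrow> (nat \<Rightarrow> nat) \<Rightarrow> (nat \<times> nat) set" where
  "invs n w = {(a, b). 1 \<le> a \<and> a < b \<and> b \<le> n \<and> w b < w a}"

lemma finite_invs [simp]: "finite (invs n w)"
  by (rule finite_subset[of _ "{1..n} \<times> {1..n}"]) (auto simp: invs_def)

text \<open>Relabelling positions by \<open>stra i\<close> matches the inversions of
  \<open>w\<close> with those of \<open>w \<circ> stra i\<close>, except for the pair
  \<open>(i, i + 1)\<close>, which is the new one.\<close>

lemma card_invs_stra:
  assumes i: "1 \<le> i" "i < n" and asc: "w i < w (i + 1)"
  shows "card (invs n (w \<circ> stra i)) = Suc (card (invs n w))"
proof -
  let ?\<phi> = "\<lambda>(a, b). (stra i a, stra i b)"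
  have "invs n (w \<circ> stra i) = insert (i, i + 1) (?\<phi> ` invs n w)"
  proof (intro equalityI subsetI)
    fix x assume x: "x \<in> invs n (w \<circ> stra i)"
    obtain a b where ab: "x = (a, b)" by fastforce
    show "x \<in> insert (i, i + 1) (?\<phi> ` invs n w)"
    proof (cases "x = (i, i + 1)")
      case False
      then have "(stra i a, stra i b) \<in> invs n w"
        using x ab i by (auto simp: invs_def stra_def split: if_splits)
      then have "?\<phi> (stra i a, stra i b) \<in> ?\<phi> ` invs n w" by (rule imageI)
      then show ?thesis by (simp add: ab)
    qed simp
  next
    fix x assume "x \<in> insert (i, i + 1) (?\<phi> ` invs n w)"
    then consider "x = (i, i + 1)" | a b where "(a, b) \<in> invs n w" "x = (stra i a, stra i b)" by auto
    then show "x \<in> invs n (w \<circ> stra i)"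
    proof cases
      case 1
      then show ?thesis using i asc by (auto simp: invs_def stra_def)
    next
      case 2
      then have "(a, b) \<noteq> (i, i + 1)" using asc by (auto simp: invs_def)
      then show ?thesis
        using 2 i by (auto simp: invs_def stra_def split: if_splits)
    qed
  qed
  moreover have "(i, i + 1) \<notin> ?\<phi> ` invs n w"
    by (auto simp: invs_def stra_def split: if_splits)
  moreover have "inj_on ?\<phi> (invs n w)"
    by (rule inj_on_inverseI[where g = ?\<phi>]) auto
  ultimately show ?thesis
    by (simp add: card_image)
qed

lemma perm_neq: "u permutes {1..n} \<Longrightarrow> a \<noteq> b \<Longrightarrow> u a \<noteq> u b"
  using permutes_inj by (metis injD)

lemma perm_in: "u permutes {1..n} \<Longrightarrow> u b \<in> {1..n} \<longleftrightarrow> b \<in> {1..n}"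
  by (rule permutes_in_image)

lemma card_invs_stra_desc:
  assumes i: "1 \<le> i" "i < n" and desc: "w (i + 1) < w i"
  shows "card (invs n w) = Suc (card (invs n (w \<circ> stra i)))"
proof -
  have "(w \<circ> stra i) i < (w \<circ> stra i) (i + 1)"
    using desc by (simp add: stra_def)
  then show ?thesis
    using card_invs_stra[OF i, of "w \<circ> stra i"] by (simp add: comp_assoc)
qed

lemma card_invs_wordperm:
  assumes "set ws \<subseteq> {1..<n}"
  shows "card (invs n (wordperm ws)) \<le> length ws"
  using assms
proof (induction ws rule: rev_induct)
  case Nil
  have "invs n (wordperm []) = {}"
    by (auto simp: invs_def wordperm_Nil)
  then show ?case by simp
next
  case (snoc i ws)
  then have i: "1 \<le> i" "i < n" and IH: "card (invs n (wordperm ws)) \<le> length ws"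
    and p: "wordperm ws permutes {1..n}"
    using wordperm_permutes by auto
  have "wordperm ws i \<noteq> wordperm ws (i + 1)"
    using perm_neq[OF p] by simp
  then consider "wordperm ws i < wordperm ws (i + 1)" | "wordperm ws (i + 1) < wordperm ws i"
    by linarith
  then have "card (invs n (wordperm ws \<circ> stra i)) \<le> Suc (card (invs n (wordperm ws)))"
    using card_invs_stra[OF i, of "wordperm ws"] card_invs_stra_desc[OF i, of "wordperm ws"]
    by (metis le_SucI order_refl)
  then show ?case
    unfolding wordperm_snoc length_append_singleton using IH by linarith
qed

lemma perm_mono_id:
  fixes n :: nat
  assumes "w permutes {1..n}" "strict_mono_on {1..n} w"
  shows "w = id"
proof
  fix x
  show "w x = id x"
  proof (cases "x \<in> {1..n}")
    case True
    have "w x = enum {1..n} x"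
      using True assms(2) permutes_image[OF assms(1)] by (intro enum_unique) simp_all
    moreover have "id x = enum {1..n} x"
      using True by (intro enum_unique) (simp_all add: strict_mono_on_def)
    ultimately show ?thesis by simp
  qed (use assms(1) in \<open>simp add: permutes_not_in\<close>)
qed

lemma no_descent_strict_mono:
  assumes "\<And>i. a \<le> i \<Longrightarrow> i < b \<Longrightarrow> w i < w (Suc i)"
  shows "strict_mono_on {a..b} (w :: nat \<Rightarrow> nat)"
proof (rule strict_mono_onI)
  fix r s assume "r \<in> {a..b}" "s \<in> {a..b}" "r < s"
  then have "r < s" "a \<le> r" "s \<le> b" by auto
  then show "w r < w s"
  proof (induction s)
    case (Suc s)
    then show ?case
      using assms[of s] by (cases "r = s") (auto intro: less_trans)
  qed simp
qed

text \<open>Bubble sort, recorded as a word. \<open>K\<close> is the set of admissible letters: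
  \<open>UNIV\<close> yields the length formula, the complement of the breaks yields membership in a
  parabolic subgroup.\<close>

lemma word_exists:
  assumes "w permutes {1..n}" "\<And>j. j \<in> {1..<n} - K \<Longrightarrow> w ` {1..j} = {1..j}"
  shows "\<exists>ws. set ws \<subseteq> {1..<n} \<inter> K \<and> length ws = card (invs n w) \<and> wordperm ws = w"
  using assms
proof (induction "card (invs n w)" arbitrary: w)
  case 0
  then have "invs n w = {}" by simp
  have "strict_mono_on {1..n} w"
  proof (rule strict_mono_onI)
    fix r s assume "r \<in> {1..n}" "s \<in> {1..n}" "r < s"
    moreover have "(r, s) \<notin> invs n w" using \<open>invs n w = {}\<close> by simp
    moreover have "w r \<noteq> w s" using perm_neq[OF 0(2)] \<open>r < s\<close> by simp
    ultimately show "w r < w s" by (auto simp: invs_def)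
  qed
  then have "w = id" using 0 perm_mono_id by blast
  then show ?case using 0 by (intro exI[of _ "[]"]) (simp add: wordperm_Nil)
next
  case (Suc N)
  have "\<exists>i. 1 \<le> i \<and> i < n \<and> w (i + 1) < w i"
  proof (rule ccontr)
    assume neg: "\<not> ?thesis"
    have "w i < w (Suc i)" if "1 \<le> i" "i < n" for i
    proof -
      have "\<not> w (i + 1) < w i" using neg that by blast
      moreover have "w i \<noteq> w (Suc i)" using perm_neq[OF Suc.prems(1)] by simp
      ultimately show ?thesis by (simp add: One_nat_def)
    qed
    then have "strict_mono_on {1..n} w" by (rule no_descent_strict_mono)
    then have "w = id" using Suc.prems perm_mono_id by blast
    then have "invs n w = {}" unfolding invs_def by auto
    then show False using Suc.hyps(2) by simp
  qed
  then obtain i where i: "1 \<le> i" "i < n" "w (i + 1) < w i" by blast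
  \<comment> \<open>A permutation preserving \<open>{1..i}\<close> has a smaller value at
    \<open>i\<close> than at \<open>i + 1\<close>, so descents occur at admissible letters
    only.\<close>
  have iK: "i \<in> K"
  proof (rule ccontr)
    assume "i \<notin> K"
    then have im: "w ` {1..i} = {1..i}" using Suc.prems(2) i by auto
    then have "w i \<le> i" using i(1) by (metis atLeastAtMost_iff imageI order_refl)
    moreover have "w (i + 1) \<notin> {1..i}"
      using inj_image_mem_iff[OF permutes_inj[OF Suc.prems(1)], of "i + 1" "{1..i}"] im by simp
    moreover have "w (i + 1) \<in> {1..n}"
      using perm_in[OF Suc.prems(1), of "i + 1"] i by simp
    ultimately show False using i(3) by auto
  qed
  have "card (invs n (w \<circ> stra i)) = N"
    using card_invs_stra_desc[OF i] Suc.hyps(2) by simp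
  moreover have "w \<circ> stra i permutes {1..n}"
    using permutes_compose[OF stra_permutes[OF i(1,2)] Suc.prems(1)] .
  moreover have "(w \<circ> stra i) ` {1..j} = {1..j}" if j: "j \<in> {1..<n} - K" for j
  proof -
    have "wordperm ([] @ [i]) ` {1..j} = {1..j}"
      using j iK i by (intro wordperm_image) auto
    then show ?thesis
      using Suc.prems(2)[OF j] unfolding wordperm_snoc wordperm_Nil id_comp image_comp[symmetric] by simp
  qed
  ultimately obtain ws where ws: "set ws \<subseteq> {1..<n} \<inter> K" "length ws = N" "wordperm ws = w \<circ> stra i"
    using Suc.hyps(1)[of "w \<circ> stra i"] by blast
  have "wordperm (ws @ [i]) = w"
    by (simp add: wordperm_snoc ws(3) comp_assoc)
  then show ?case
    using ws i iK Suc.hyps(2) by (intro exI[of _ "ws @ [i]"]) auto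
qed

lemma wlen_eq_card_invs:
  assumes "w permutes {1..n}"
  shows "wlen n w = card (invs n w)"
  unfolding wlen_def
proof (rule Least_equality)
  show "\<exists>ws. set ws \<subseteq> {1..<n} \<and> length ws = card (invs n w) \<and> wordperm ws = w"
    using word_exists[OF assms, of UNIV] by auto
qed (use card_invs_wordperm in blast)

text \<open>Equal inversion sets mean equal relative order of all values, so \<open>w\<close>
  composed with the inverse of \<open>v\<close> is increasing and therefore the identity. This
  supplies the uniqueness that the \<open>THE\<close> in \<open>longest\<close> requires.\<close>

lemma invs_inj:
  assumes w: "w permutes {1..n}" and v: "v permutes {1..n}" and eq: "invs n w = invs n v"
  shows "w = v"
proof -
  have cmp: "w b < w a \<longleftrightarrow> v b < v a" if "a \<in> {1..n}" "b \<in> {1..n}" for a b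
  proof -
    have "w b < w a \<longleftrightarrow> v b < v a" if "a \<in> {1..n}" "b \<in> {1..n}" "a < b" for a b
      using eq that by (auto simp: invs_def set_eq_iff)
    from this[of a b] this[of b a] show ?thesis
      using that perm_neq[OF w, of a b] perm_neq[OF v, of a b] by (cases a b rule: linorder_cases) auto
  qed
  have iv: "inv_into UNIV v permutes {1..n}" using v by (rule permutes_inv)
  have "w \<circ> inv_into UNIV v = id"
  proof (rule perm_mono_id)
    show "w \<circ> inv_into UNIV v permutes {1..n}" using iv w by (rule permutes_compose)
    show "strict_mono_on {1..n} (w \<circ> inv_into UNIV v)"
    proof (rule strict_mono_onI)
      fix r s assume rs: "r \<in> {1..n}" "s \<in> {1..n}" "r < s"
      then have "inv_into UNIV v r \<in> {1..n}" "inv_into UNIV v s \<in> {1..n}" using perm_in[OF iv] by blast+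
      then show "(w \<circ> inv_into UNIV v) r < (w \<circ> inv_into UNIV v) s"
        using cmp[of "inv_into UNIV v s" "inv_into UNIV v r"] rs permutes_inverses(1)[OF v] by simp
    qed
  qed
  then show ?thesis
    by (metis comp_assoc comp_id id_comp permutes_inv_o(2)[OF v])
qed

definition consec :: "nat set \<Rightarrow> nat \<Rightarrow> nat \<Rightarrow> bool" where
  "consec S lo hi \<longleftrightarrow> lo \<in> S \<and> hi \<in> S \<and> lo < hi \<and> (\<forall>x\<in>S. x \<le> lo \<or> hi \<le> x)"

text \<open>Counting 0 and \<open>n\<close> as breaks lets the blocks before the first and after the
  last step of the partial flag be treated like all others; the cases \<open>i < ns ! 0\<close> and
  \<open>i > last ns\<close> live there.\<close>

definition breaks :: "nat \<Rightarrow> nat set \<Rightarrow> bool" where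
  "breaks n S \<longleftrightarrow> 0 \<in> S \<and> n \<in> S \<and> S \<subseteq> {0..n}"

lemma consec_unique:
  "consec S lo hi \<Longrightarrow> consec S lo' hi' \<Longrightarrow> lo < b \<Longrightarrow> b \<le> hi \<Longrightarrow> lo' < b \<Longrightarrow> b \<le> hi' \<Longrightarrow> lo' = lo \<and> hi' = hi"
  unfolding consec_def by (metis le_antisym less_le_not_le not_le order_trans)

lemma breaks_finite: "breaks n S \<Longrightarrow> finite S"
  unfolding breaks_def using finite_subset by blast

lemma consec_exists:
  assumes S: "breaks n S" and q: "1 \<le> q" "q \<le> n"
  shows "\<exists>lo hi. consec S lo hi \<and> lo < q \<and> q \<le> hi"
proof -
  have fin: "finite S" using S by (rule breaks_finite)
  let ?L = "{x \<in> S. x < q}" and ?H = "{x \<in> S. q \<le> x}"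
  have "0 \<in> ?L" "n \<in> ?H" using S q by (auto simp: breaks_def)
  then have L: "Max ?L \<in> ?L" and H: "Min ?H \<in> ?H"
    using fin by (intro Max_in Min_in; fastforce)+
  have "x \<le> Max ?L \<or> Min ?H \<le> x" if "x \<in> S" for x
    using that fin by (cases "x < q") (auto intro: Max_ge Min_le)
  then have "consec S (Max ?L) (Min ?H)"
    using L H by (auto simp: consec_def)
  then show ?thesis using L H by blast
qed

lemma consec_le: "breaks n S \<Longrightarrow> consec S lo hi \<Longrightarrow> hi \<le> n"
  by (auto simp: breaks_def consec_def)

text \<open>Block reversal, the closed form of the longest element of the subgroup preserving the
  blocks. The \<open>THE\<close> is unambiguous because the block of \<open>b\<close> is
  unique.\<close>

definition brev :: "nat \<Rightarrow> nat set \<Rightarrow> nat \<Rightarrow> nat" where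
  "brev n S b = (if b \<in> {1..n} then (THE c. \<exists>lo hi. consec S lo hi \<and> lo < b \<and> b \<le> hi \<and> c = lo + hi + 1 - b) else b)"

lemma brev_eq:
  assumes "breaks n S" "consec S lo hi" "lo < b" "b \<le> hi"
  shows "brev n S b = lo + hi + 1 - b"
proof -
  have "(THE c. \<exists>lo hi. consec S lo hi \<and> lo < b \<and> b \<le> hi \<and> c = lo + hi + 1 - b) = lo + hi + 1 - b"
    using assms consec_unique by (intro the_equality) blast+
  moreover have "b \<in> {1..n}"
    using assms(3,4) consec_le[OF assms(1,2)] by auto
  ultimately show ?thesis by (simp add: brev_def)
qed

lemma brev_brev:
  assumes "breaks n S"
  shows "brev n S (brev n S b) = b"
proof (cases "b \<in> {1..n}")
  case True
  then obtain lo hi where b: "consec S lo hi" "lo < b" "b \<le> hi"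
    using consec_exists[OF assms, of b] by auto
  then show ?thesis
    using brev_eq[OF assms b] brev_eq[OF assms b(1), of "lo + hi + 1 - b"] by simp
next
  case False
  then have "brev n S b = b" unfolding brev_def by (rule if_not_P)
  then show ?thesis by simp
qed

lemma brev_permutes:
  assumes "breaks n S"
  shows "brev n S permutes {1..n}"
  unfolding permutes_def using brev_brev[OF assms] by (metis brev_def)

lemma brev_image:
  assumes S: "breaks n S" and j: "j \<in> S"
  shows "brev n S ` {1..j} = {1..j}"
proof (rule endo_inj_surj)
  show "inj_on (brev n S) {1..j}"
    using brev_brev[OF S] by (rule inj_on_inverseI)
  show "brev n S ` {1..j} \<subseteq> {1..j}"
  proof clarify
    fix b assume b: "b \<in> {1..j}"
    then have "1 \<le> b" "b \<le> n" using S j by (auto simp: breaks_def)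
    then obtain lo hi where lh: "consec S lo hi" "lo < b" "b \<le> hi"
      using consec_exists[OF S, of b] by blast
    then have "hi \<le> j" using j b by (auto simp: consec_def)
    then show "brev n S b \<in> {1..j}"
      using brev_eq[OF S lh] lh by auto
  qed
qed simp

text \<open>All inversions of a group element lie inside blocks, and \<open>brev\<close> inverts
  every pair inside a block. It thus has the largest inversion set, and a competitor of the same
  length has the same set.\<close>

lemma longest_eq_brev:
  assumes S: "breaks n S" and G: "G = {wordperm ws | ws. set ws \<subseteq> {1..<n} - S}"
  shows "longest n G = brev n S"
proof -
  let ?P = "{(a, b). 1 \<le> a \<and> a < b \<and> b \<le> n \<and> (\<forall>j\<in>S. j < a \<or> b \<le> j)}"
  have finP: "finite ?P"
    by (rule finite_subset[of _ "{1..n} \<times> {1..n}"]) auto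
  have perm: "v permutes {1..n}" if "v \<in> G" for v
    using that G wordperm_permutes by blast
  have sub: "invs n v \<subseteq> ?P" if v: "v \<in> G" for v
  proof clarify
    fix a b assume ab: "(a, b) \<in> invs n v"
    have "j < a \<or> b \<le> j" if j: "j \<in> S" for j
    proof (rule ccontr)
      assume neg: "\<not> (j < a \<or> b \<le> j)"
      obtain ws where ws: "set ws \<subseteq> {1..<n} - {j}" "v = wordperm ws"
        using v G j by blast
      have im: "v ` {1..j} = {1..j}"
        unfolding ws(2) using ws(1) j S by (intro wordperm_image) (auto simp: breaks_def)
      have "v a \<in> {1..j}" using im ab neg by (auto simp: invs_def)
      moreover have "v b \<notin> {1..j}"
        using inj_image_mem_iff[OF permutes_inj[OF perm[OF v]], of b "{1..j}"] im neg by simp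
      moreover have "v b \<in> {1..n}"
        using perm_in[OF perm[OF v], of b] ab by (auto simp: invs_def)
      ultimately show False using ab by (auto simp: invs_def)
    qed
    then show "1 \<le> a \<and> a < b \<and> b \<le> n \<and> (\<forall>j\<in>S. j < a \<or> b \<le> j)"
      using ab by (auto simp: invs_def)
  qed
  have brevG: "brev n S \<in> G"
  proof -
    obtain ws where ws: "set ws \<subseteq> {1..<n} - S" "wordperm ws = brev n S"
      using word_exists[OF brev_permutes[OF S], of "- S"] brev_image[OF S] by (auto simp: Diff_eq)
    then show ?thesis unfolding G by force
  qed
  have "?P \<subseteq> invs n (brev n S)"
  proof clarify
    fix a b assume ab: "1 \<le> a" "a < b" "b \<le> n" "\<forall>j\<in>S. j < a \<or> b \<le> j"
    obtain lo hi where lh: "consec S lo hi" "lo < a" "a \<le> hi"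
      using consec_exists[OF S, of a] ab by auto
    then have "b \<le> hi" using ab(4) by (auto simp: consec_def)
    then show "(a, b) \<in> invs n (brev n S)"
      using brev_eq[OF S lh] brev_eq[OF S lh(1), of b] lh ab by (auto simp: invs_def)
  qed
  then have brevP: "invs n (brev n S) = ?P"
    using sub[OF brevG] by (rule antisym[rotated])
  show ?thesis
    unfolding longest_def
  proof (rule the_equality)
    show "brev n S \<in> G \<and> (\<forall>v\<in>G. wlen n v \<le> wlen n (brev n S))"
      using brevG sub finP by (auto simp: wlen_eq_card_invs perm brevP intro!: card_mono)
    fix w assume w: "w \<in> G \<and> (\<forall>v\<in>G. wlen n v \<le> wlen n w)"
    then have "card ?P \<le> card (invs n w)"
      using brevG by (auto simp: wlen_eq_card_invs perm brevP[symmetric])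
    then have "invs n w = ?P"
      using card_seteq[OF finP sub] w by blast
    then show "w = brev n S"
      using invs_inj[OF perm brev_permutes[OF S]] w brevP by simp
  qed
qed

lemma w0_eq_brev: "w0 n = brev n {0, n}"
proof -
  have "{1..<n} = {1..<n} - {0, n}" by auto
  then show ?thesis
    unfolding w0_def Weyl_def by (intro longest_eq_brev) (auto simp: breaks_def)
qed

lemma w0_permutes: "w0 n permutes {1..n}"
  unfolding w0_eq_brev by (rule brev_permutes) (simp add: breaks_def)

lemma w0_apply: "b \<in> {1..n} \<Longrightarrow> w0 n b = n + 1 - b"
  unfolding w0_eq_brev by (subst brev_eq[of n _ 0 n]) (auto simp: breaks_def consec_def)

lemma wP_eq_brev: "set ns \<subseteq> {0..n} \<Longrightarrow> wP n ns = brev n ({0, n} \<union> set ns)"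
proof -
  have "{1..<n} - set ns = {1..<n} - ({0, n} \<union> set ns)" by auto
  then show "set ns \<subseteq> {0..n} \<Longrightarrow> ?thesis"
    unfolding wP_def WeylP_def by (intro longest_eq_brev) (auto simp: breaks_def)
qed

section \<open>Rank functions of permutations\<close>

text \<open>On the cell of \<open>u\<close> this number is the dimension of
  \<open>F q \<inter> E p\<close>.\<close>

definition cnt :: "(nat \<Rightarrow> nat) \<Rightarrow> nat \<Rightarrow> nat \<Rightarrow> nat" where
  "cnt u p q = card {b \<in> {1..q}. u b \<le> p}"

text \<open>Larger intersections mean a smaller cell, hence the reversed inequality.\<close>

definition bruhat_le :: "nat \<Rightarrow> (nat \<Rightarrow> nat) \<Rightarrow> (nat \<Rightarrow> nat) \<Rightarrow> bool" where
  "bruhat_le n u w \<longleftrightarrow> (\<forall>p\<le>n. \<forall>q\<le>n. cnt w p q \<le> cnt u p q)"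

lemma card_image_perm: "u permutes {1..n} \<Longrightarrow> card (u ` A) = card A"
  by (rule card_image[OF inj_on_subset[OF permutes_inj]]) auto

lemma cnt_ge:
  assumes "u permutes {1..n}" "q \<le> n" "p \<le> n"
  shows "p + q \<le> cnt u p q + n"
proof -
  have "card {b \<in> {1..q}. \<not> u b \<le> p} = card (u ` {b \<in> {1..q}. \<not> u b \<le> p})"
    by (rule card_image_perm[OF assms(1), symmetric])
  also have "\<dots> \<le> card {p<..n}"
    using perm_in[OF assms(1)] assms(2) by (intro card_mono) force+
  finally have "card {b \<in> {1..q}. \<not> u b \<le> p} \<le> n - p" by simp
  moreover have "{1..q} = {b \<in> {1..q}. u b \<le> p} \<union> {b \<in> {1..q}. \<not> u b \<le> p}" by auto
  then have "q \<le> card {b \<in> {1..q}. u b \<le> p} + card {b \<in> {1..q}. \<not> u b \<le> p}"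
    by (metis (no_types, lifting) card_Un_le card_atLeastAtMost diff_Suc_1 One_nat_def)
  ultimately show ?thesis
    using assms(3) by (simp add: cnt_def)
qed

lemma cnt_row_step:
  assumes "u permutes {1..n}"
  shows "cnt u p q \<le> cnt u p' q + (p - p')"
proof -
  have "{b \<in> {1..q}. u b \<le> p} \<subseteq> {b \<in> {1..q}. u b \<le> p'} \<union> {b \<in> {1..q}. u b \<in> {p'<..p}}" by auto
  then have "cnt u p q \<le> card ({b \<in> {1..q}. u b \<le> p'} \<union> {b \<in> {1..q}. u b \<in> {p'<..p}})"
    unfolding cnt_def by (intro card_mono) auto
  also have "\<dots> \<le> cnt u p' q + card {b \<in> {1..q}. u b \<in> {p'<..p}}"
    unfolding cnt_def by (rule card_Un_le)
  also have "card {b \<in> {1..q}. u b \<in> {p'<..p}} = card (u ` {b \<in> {1..q}. u b \<in> {p'<..p}})"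
    by (rule card_image_perm[OF assms, symmetric])
  also have "\<dots> \<le> card {p'<..p}"
    by (intro card_mono) auto
  finally show ?thesis by simp
qed

lemma cnt_col_split:
  assumes "q0 \<le> q"
  shows "cnt u p q = cnt u p q0 + card {b \<in> {q0<..q}. u b \<le> p}"
proof -
  have "{b \<in> {1..q}. u b \<le> p} = {b \<in> {1..q0}. u b \<le> p} \<union> {b \<in> {q0<..q}. u b \<le> p}"
    using assms by auto
  moreover have "{b \<in> {1..q0}. u b \<le> p} \<inter> {b \<in> {q0<..q}. u b \<le> p} = {}" by auto
  ultimately show ?thesis
    unfolding cnt_def by (simp add: card_Un_disjoint)
qed

lemma cnt_pos_iff: "1 \<le> cnt u p q \<longleftrightarrow> (\<exists>b\<in>{1..q}. u b \<le> p)"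
  unfolding cnt_def by (auto simp: Suc_le_eq card_gt_0_iff One_nat_def)

lemma cnt_image_cong:
  assumes "u permutes {1..n}" "v permutes {1..n}" "u ` {1..q} = v ` {1..q}"
  shows "cnt u p q = cnt v p q"
proof -
  have "cnt w p q = card {x \<in> w ` {1..q}. x \<le> p}" if "w permutes {1..n}" for w
  proof -
    have "{x \<in> w ` {1..q}. x \<le> p} = w ` {b \<in> {1..q}. w b \<le> p}" by auto
    then show ?thesis
      by (simp add: cnt_def card_image_perm[OF that])
  qed
  then show ?thesis using assms by simp
qed

text \<open>In an increasing block the values at most \<open>p\<close> come first: either the whole
  stretch \<open>q0<..q\<close> counts, or nothing after \<open>q\<close> does.\<close>

lemma cnt_increasing:
  assumes mono: "strict_mono_on {q0<..q1} u" and q: "q0 \<le> q" "q \<le> q1"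
  shows "min (cnt u p q0 + (q - q0)) (cnt u p q1) \<le> cnt u p q"
proof (cases "\<exists>b\<in>{q<..q1}. u b \<le> p")
  case True
  then obtain b where b: "b \<in> {q<..q1}" "u b \<le> p" by blast
  have "u c \<le> p" if "c \<in> {q0<..q}" for c
  proof -
    have "u c < u b" using mono that b q by (auto simp: strict_mono_on_def)
    then show ?thesis using b by simp
  qed
  then have "{b \<in> {q0<..q}. u b \<le> p} = {q0<..q}" by auto
  then show ?thesis using cnt_col_split[OF q(1), of u p] by simp
next
  case False
  then have "{b \<in> {q<..q1}. u b \<le> p} = {}" by auto
  then have "card {b \<in> {q<..q1}. u b \<le> p} = 0" by (simp only: card.empty)
  then show ?thesis using cnt_col_split[OF q(2), of u p] by linarith
qed

section \<open>The rank function of \<open>w0 wP\<close>\<close>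

definition incr_on :: "nat set \<Rightarrow> (nat \<Rightarrow> nat) \<Rightarrow> bool" where
  "incr_on S u \<longleftrightarrow> (\<forall>lo hi. consec S lo hi \<longrightarrow> strict_mono_on {lo<..hi} u)"

text \<open>The closed form of \<open>w0 wP\<close>: the block \<open>lo<..hi\<close> goes
  increasingly onto \<open>n - hi<..n - lo\<close>. The additive equation avoids truncated
  subtraction.\<close>

definition top_perm :: "nat \<Rightarrow> nat set \<Rightarrow> (nat \<Rightarrow> nat) \<Rightarrow> bool" where
  "top_perm n S w \<longleftrightarrow> w permutes {1..n} \<and>
     (\<forall>lo hi b. consec S lo hi \<and> lo < b \<and> b \<le> hi \<longrightarrow> w b + lo + hi = n + b)"

lemma top_perm_w0_brev:
  assumes S: "breaks n S"
  shows "top_perm n S (w0 n \<circ> brev n S)"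
  unfolding top_perm_def
proof (intro conjI allI impI; (elim conjE)?)
  show "w0 n \<circ> brev n S permutes {1..n}"
    using permutes_compose[OF brev_permutes[OF S] w0_permutes] .
  fix lo hi b assume b: "consec S lo hi" "lo < b" "b \<le> hi"
  have "hi \<le> n" using S b(1) by (rule consec_le)
  then show "(w0 n \<circ> brev n S) b + lo + hi = n + b"
    using brev_eq[OF S b] b w0_apply[of "lo + hi + 1 - b" n] by (simp, linarith)
qed

lemma top_perm_gt:
  assumes S: "breaks n S" and w: "top_perm n S w" and x: "x \<in> S" and b: "1 \<le> b" "b \<le> x"
  shows "n < w b + x"
proof -
  have "b \<le> n" using S x b by (auto simp: breaks_def)
  then obtain lo hi where lh: "consec S lo hi" "lo < b" "b \<le> hi"
    using consec_exists[OF S b(1)] by blast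
  then have "w b + lo + hi = n + b" using w by (auto simp: top_perm_def)
  moreover have "hi \<le> x" using lh x b by (auto simp: consec_def)
  ultimately show ?thesis using lh by linarith
qed

text \<open>For \<open>p + lo \<le> n\<close> all positions up to \<open>lo\<close> have values
  above \<open>p\<close>, and a position \<open>b\<close> of the block counts just when
  \<open>b \<le> lo + (p + hi - n)\<close>. For \<open>n \<le> p + lo\<close> the first
  \<open>lo\<close> positions take values above \<open>n - lo\<close>, so at most
  \<open>p + lo - n\<close> of them count, and each later position adds at most one.\<close>

lemma cnt_top_perm_le:
  assumes S: "breaks n S" and w: "top_perm n S w" and lh: "consec S lo hi" and q: "lo \<le> q" "q \<le> hi"
  shows "p + lo \<le> n \<Longrightarrow> cnt w p q \<le> min (q - lo) (p + hi - n)"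
    and "n \<le> p + lo \<Longrightarrow> cnt w p q \<le> p + q - n"
proof -
  have perm: "w permutes {1..n}" using w by (simp add: top_perm_def)
  have lo: "lo \<in> S" using lh by (simp add: consec_def)
  have val: "w b + lo + hi = n + b" if "lo < b" "b \<le> hi" for b
    using w lh that by (auto simp: top_perm_def)
  have gt: "n < w b + lo" if "1 \<le> b" "b \<le> lo" for b
    using top_perm_gt[OF S w lo that] .
  {
    assume p: "p + lo \<le> n"
    have "{b \<in> {1..q}. w b \<le> p} \<subseteq> {lo<..min q (lo + (p + hi - n))}"
    proof
      fix b assume b: "b \<in> {b \<in> {1..q}. w b \<le> p}"
      then have "lo < b" using gt[of b] p by fastforce
      moreover have "b \<le> hi" using b q by simp
      ultimately show "b \<in> {lo<..min q (lo + (p + hi - n))}"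
        using val[of b] b by auto
    qed
    then have "cnt w p q \<le> card {lo<..min q (lo + (p + hi - n))}"
      unfolding cnt_def by (intro card_mono) auto
    also have "\<dots> \<le> min (q - lo) (p + hi - n)" unfolding card_greaterThanAtMost by linarith
    finally show "cnt w p q \<le> min (q - lo) (p + hi - n)" .
  }
  {
    assume p: "n \<le> p + lo"
    have "lo \<le> n" using S lo by (auto simp: breaks_def)
    have "cnt w p lo = card (w ` {b \<in> {1..lo}. w b \<le> p})"
      by (simp add: cnt_def card_image_perm[OF perm])
    also have "\<dots> \<le> card {n - lo<..p}"
    proof (intro card_mono subsetI)
      fix y assume "y \<in> w ` {b \<in> {1..lo}. w b \<le> p}"
      then obtain b where "1 \<le> b" "b \<le> lo" "w b \<le> p" "y = w b" by auto
      then show "y \<in> {n - lo<..p}" using gt[of b] \<open>lo \<le> n\<close> by auto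
    qed simp
    finally have "cnt w p lo \<le> p + lo - n" using \<open>lo \<le> n\<close> by simp
    moreover have "card {b \<in> {lo<..q}. w b \<le> p} \<le> q - lo"
      by (rule order_trans[OF card_mono[of "{lo<..q}"]]) auto
    ultimately show "cnt w p q \<le> p + q - n"
      using cnt_col_split[OF q(1), of w p] p q by linarith
  }
qed

text \<open>The bounds for \<open>w\<close> do not exceed what \<open>cnt_ge\<close> forces for
  every permutation at the two ends of the block; monotonicity of \<open>u\<close> carries the
  forced counts to the interior.\<close>

lemma cnt_top_perm_le_increasing:
  assumes S: "breaks n S" and w: "top_perm n S w" and lh: "consec S lo hi"
    and u: "u permutes {1..n}" and mono: "strict_mono_on {lo<..hi} u" and q: "lo \<le> q" "q \<le> hi" "p \<le> n"
  shows "cnt w p q \<le> cnt u p q"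
proof -
  have "hi \<le> n" using S lh by (rule consec_le)
  have *: "min (cnt u p lo + (q - lo)) (cnt u p hi) \<le> cnt u p q"
    using mono q(1,2) by (rule cnt_increasing)
  have "p + lo \<le> cnt u p lo + n" "p + hi \<le> cnt u p hi + n"
    using cnt_ge[OF u] q \<open>hi \<le> n\<close> by auto
  then show ?thesis
    using * cnt_top_perm_le[OF S w lh q(1,2), of p] q by (cases "p + lo \<le> n") linarith+
qed

lemma cnt_0 [simp]: "cnt u p 0 = 0"
  by (simp add: cnt_def)

text \<open>The reason why \<open>w0 wP\<close> imposes nothing on a partial flag: a lift that is
  sorted on the blocks meets all its rank conditions.\<close>

lemma bruhat_le_top_perm:
  assumes S: "breaks n S" and w: "top_perm n S w" and u: "u permutes {1..n}" and inc: "incr_on S u"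
  shows "bruhat_le n u w"
  unfolding bruhat_le_def
proof (intro allI impI)
  fix p q assume "p \<le> n" "q \<le> n"
  show "cnt w p q \<le> cnt u p q"
  proof (cases "q = 0")
    case False
    then obtain lo hi where lh: "consec S lo hi" "lo < q" "q \<le> hi"
      using consec_exists[OF S, of q] \<open>q \<le> n\<close> by (auto simp: One_nat_def)
    then show ?thesis
      using inc \<open>p \<le> n\<close> by (intro cnt_top_perm_le_increasing[OF S w lh(1) u]) (auto simp: incr_on_def)
  qed simp
qed

lemma consec_insert:
  assumes S: "consec S a c" and i: "a < i" "i < c"
  shows "consec (insert i S) a i" "consec (insert i S) i c"
    and "consec S lo hi \<Longrightarrow> lo \<noteq> a \<Longrightarrow> consec (insert i S) lo hi"
proof -
  show "consec (insert i S) a i" "consec (insert i S) i c"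
    using S i by (auto simp: consec_def)
  assume lh: "consec S lo hi" "lo \<noteq> a"
  then have "hi \<le> a \<or> c \<le> lo" using S unfolding consec_def by (metis le_antisym le_less_trans not_le)
  then show "consec (insert i S) lo hi" using lh i unfolding consec_def by auto
qed

text \<open>Breaking the block \<open>a<..c\<close> at \<open>i\<close> gives up monotonicity across
  \<open>i\<close>. What this loses is recovered from the single count in the last hypothesis; on
  either side of \<open>i\<close> the interpolation of \<open>cnt_increasing\<close> still
  works.\<close>

lemma bruhat_le_top_perm_insert:
  assumes S: "breaks n S" and w: "top_perm n S w" and u: "u permutes {1..n}"
    and ac: "consec S a c" and i: "a < i" "i < c" and inc: "incr_on (insert i S) u"
    and k: "i - a \<le> cnt u (n - c + (i - a)) i"
  shows "bruhat_le n u w"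
  unfolding bruhat_le_def
proof (intro allI impI)
  fix p q assume "p \<le> n" "q \<le> n"
  have "c \<le> n" using S ac by (rule consec_le)
  show "cnt w p q \<le> cnt u p q"
  proof (cases "q = 0")
    case False
    then obtain lo hi where lh: "consec S lo hi" "lo < q" "q \<le> hi"
      using consec_exists[OF S, of q] \<open>q \<le> n\<close> by (auto simp: One_nat_def)
    show ?thesis
    proof (cases "lo = a")
      case False
      then show ?thesis
        using inc lh \<open>p \<le> n\<close> consec_insert(3)[OF ac i lh(1)]
        by (intro cnt_top_perm_le_increasing[OF S w lh(1) u]) (auto simp: incr_on_def)
    next
      case True
      then have hi: "hi = c"
        using lh(1) ac unfolding consec_def by (metis le_antisym not_le)
      have q: "a \<le> q" "q \<le> c" using lh True hi by auto
      have ge: "p + a \<le> cnt u p a + n" "p + c \<le> cnt u p c + n" "p + i \<le> cnt u p i + n"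
        using cnt_ge[OF u] i \<open>c \<le> n\<close> \<open>p \<le> n\<close> by auto
      \<comment> \<open>Each unit by which \<open>p\<close> falls short of
        \<open>n - c + (i - a)\<close> costs at most one, and \<open>i - a\<close> minus this
        deficit is \<open>p + c - n\<close>.\<close>
      have i1: "min (i - a) (p + c - n) \<le> cnt u p i"
        using cnt_row_step[OF u, of "n - c + (i - a)" i p] k \<open>c \<le> n\<close> by linarith
      have min_le: "x \<le> z" if "min y y' \<le> z" "x \<le> y" "x \<le> y'" for x y y' z :: nat
        using that by linarith
      have left: "cnt w p q \<le> cnt u p q" if "q \<le> i" "cnt w p q \<le> cnt u p a + (q - a)" "cnt w p q \<le> cnt u p i"
        using inc consec_insert(1)[OF ac i] that q
        by (intro min_le[OF cnt_increasing[of a i u q]]) (auto simp: incr_on_def)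
      have right: "cnt w p q \<le> cnt u p q" if "i \<le> q" "cnt w p q \<le> cnt u p i + (q - i)" "cnt w p q \<le> cnt u p c"
        using inc consec_insert(2)[OF ac i] that q
        by (intro min_le[OF cnt_increasing[of i c u q]]) (auto simp: incr_on_def)
      show ?thesis
      proof (cases "p + a \<le> n")
        case True
        have cw: "cnt w p q \<le> q - a" "cnt w p q \<le> p + c - n"
          using cnt_top_perm_le(1)[OF S w ac q True] by simp_all
        show ?thesis
        proof (cases "q \<le> i")
          case True
          have "cnt w p q \<le> i - a" using cw True by linarith
          then have "cnt w p q \<le> cnt u p i" by (rule min_le[OF i1 _ cw(2)])
          then show ?thesis using cw(1) by (intro left True) linarith
        next
          case False
          have "cnt w p q \<le> cnt u p i + (q - i)"
          proof (cases "i - a \<le> p + c - n")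
            case True
            then have "i - a \<le> cnt u p i" using i1 by simp
            then show ?thesis using cw(1) False i by linarith
          next
            case False
            then have "p + c - n \<le> cnt u p i" using i1 by simp
            then show ?thesis using cw(2) by linarith
          qed
          moreover have "cnt w p q \<le> cnt u p c" using cw(2) ge(2) by linarith
          ultimately show ?thesis using False by (intro right) simp
        qed
      next
        case False
        then have "n \<le> p + a" by simp
        then have cw: "cnt w p q \<le> p + q - n"
          by (rule cnt_top_perm_le(2)[OF S w ac q])
        then show ?thesis
          using ge q by (cases "q \<le> i") (intro left right; linarith)+
      qed
    qed
  qed simp
qed

lemma stra_le_iff: "p \<noteq> r \<Longrightarrow> stra r x \<le> p \<longleftrightarrow> x \<le> p"
  by (auto simp: stra_def)

text \<open>Exchanging the values \<open>n - i\<close> and \<open>n - i + 1\<close> affects only the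
  row \<open>p = n - i\<close>. There the first \<open>i\<close> positions of \<open>w\<close>
  contribute nothing, and the exchange brings in the single position \<open>lo + 1\<close>, the
  start of the block ending at \<open>i\<close>; so \<open>u\<close> has to provide just one
  positive count.\<close>

lemma bruhat_le_stra_top_perm:
  assumes S: "breaks n S" and w: "top_perm n S w" and u: "u permutes {1..n}" and inc: "incr_on S u"
    and i: "i \<in> S" "1 \<le> i" "i < n" and pos: "1 \<le> cnt u (n - i) i"
  shows "bruhat_le n u (stra (n - i) \<circ> w)"
  unfolding bruhat_le_def
proof (intro allI impI)
  fix p q assume "p \<le> n" and qn: "q \<le> n"
  let ?w = "stra (n - i) \<circ> w"
  show "cnt ?w p q \<le> cnt u p q"
  proof (cases "p = n - i")
    case False
    then have "cnt ?w p q = cnt w p q"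
      unfolding cnt_def by (simp add: stra_le_iff)
    then show ?thesis
      using bruhat_le_top_perm[OF S w u inc] \<open>p \<le> n\<close> \<open>q \<le> n\<close> by (simp add: bruhat_le_def)
  next
    case True
    obtain lo hi where lh: "consec S lo hi" "lo < i" "i \<le> hi"
      using consec_exists[OF S, of i] i by auto
    then have [simp]: "hi = i" using i by (auto simp: consec_def)
    obtain lo' hi' where lh': "consec S lo' hi'" "lo' < i + 1" "i + 1 \<le> hi'"
      using consec_exists[OF S, of "i + 1"] i by auto
    then have [simp]: "lo' = i" using i by (auto simp: consec_def)
    have "hi' \<le> n" using S lh'(1) by (rule consec_le)
    have val: "w b + lo + i = n + b" if "lo < b" "b \<le> i" for b
      using w lh that by (auto simp: top_perm_def)
    have gt: "n - i < ?w b" if b: "1 \<le> b" "b \<le> i" "b \<noteq> lo + 1" for b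
    proof -
      have "n - i + 1 < w b"
      proof (cases "b \<le> lo")
        case True
        have "n < w b + lo"
          using lh(1) True b by (intro top_perm_gt[OF S w]) (auto simp: consec_def)
        then show ?thesis using lh i by simp
      next
        case False
        then show ?thesis using val[of b] b i by simp
      qed
      then show ?thesis by (simp add: stra_def)
    qed
    \<comment> \<open>\<open>w\<close> has the value \<open>n - i\<close> at the end
      \<open>hi'\<close> of the block after \<open>i\<close>. The exchange lifts it out of the row,
      which compensates the gain at \<open>lo + 1\<close> once \<open>q \<ge> hi'\<close>.\<close>
    have hi'_out: "\<not> ?w hi' \<le> n - i"
    proof -
      have "w hi' + i + hi' = n + hi'"
        using w lh' by (auto simp: top_perm_def)
      then have "w hi' = n - i" by simp
      then show ?thesis using i by (simp add: stra_def)
    qed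
    have low: "{b \<in> {1..q}. ?w b \<le> n - i} \<subseteq> {lo + 1}" if "q \<le> i" for q
      using gt that by fastforce
    have low_card: "cnt ?w (n - i) q \<le> 1" if "q \<le> i" for q
      unfolding cnt_def using card_mono[OF _ low[OF that]] by simp
    show ?thesis
    proof (cases "q \<le> i")
      case True
      show ?thesis
      proof (cases "q \<le> lo")
        case True
        then have "{b \<in> {1..q}. ?w b \<le> n - i} = {}" using low[OF \<open>q \<le> i\<close>] by auto
        then have "cnt ?w (n - i) q = 0" unfolding cnt_def by simp
        then show ?thesis using \<open>p = n - i\<close> by simp
      next
        case False
        have "min (cnt u p lo + (q - lo)) (cnt u p i) \<le> cnt u p q"
          using inc lh False \<open>q \<le> i\<close> by (intro cnt_increasing) (auto simp: incr_on_def)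
        then show ?thesis
          unfolding \<open>p = n - i\<close> using low_card[OF \<open>q \<le> i\<close>] pos False by linarith
      qed
    next
      case False
      have split: "cnt ?w p q = cnt ?w p i + card {b \<in> {i<..q}. ?w b \<le> p}"
        using False by (intro cnt_col_split) simp
      show ?thesis
      proof (cases "q < hi'")
        case True
        have "card {b \<in> {i<..q}. ?w b \<le> p} \<le> q - i"
          by (rule order_trans[OF card_mono[of "{i<..q}"]]) auto
        moreover have "min (cnt u p i + (q - i)) (cnt u p hi') \<le> cnt u p q"
          using inc lh' False True by (intro cnt_increasing) (auto simp: incr_on_def)
        \<comment> \<open>With \<open>p = n - i\<close> the count at \<open>hi'\<close> is at least
          \<open>hi' - i\<close>, which is at least \<open>1 + (q - i)\<close> because
          \<open>q < hi'\<close>.\<close>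
        moreover have "p + hi' \<le> cnt u p hi' + n"
          using cnt_ge[OF u \<open>hi' \<le> n\<close> \<open>p \<le> n\<close>] .
        ultimately show ?thesis
          using split low_card[OF order_refl] pos True False i unfolding \<open>p = n - i\<close> by linarith
      next
        case qhi: False
        have "card {b \<in> {i<..q}. ?w b \<le> p} \<le> card ({i<..q} - {hi'})"
          using hi'_out \<open>p = n - i\<close> by (intro card_mono) auto
        also have "\<dots> = q - i - 1"
          using qhi lh' by simp
        finally show ?thesis
          using split low_card[OF order_refl] cnt_ge[OF u qn \<open>p \<le> n\<close>] False i unfolding \<open>p = n - i\<close> by linarith
      qed
    qed
  qed
qed

lemma consec_UNIV: "consec {0..n} lo hi \<longleftrightarrow> hi \<le> n \<and> hi = lo + 1"
proof
  assume c: "consec {0..n} lo hi"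
  then have "lo + 1 \<in> {0..n}" by (auto simp: consec_def)
  then have "hi \<le> lo + 1" using c unfolding consec_def by fastforce
  then show "hi \<le> n \<and> hi = lo + 1" using c by (auto simp: consec_def)
qed (auto simp: consec_def)

text \<open>Complete flags are the case of singleton blocks: \<open>incr_on\<close> then holds for
  every permutation, and the results on \<open>w0 wP\<close> specialise to
  \<open>w0\<close>.\<close>

lemma w0_top_perm: "top_perm n {0..n} (w0 n)"
  unfolding top_perm_def consec_UNIV using w0_permutes w0_apply by auto

lemma bruhat_le_w0: "u permutes {1..n} \<Longrightarrow> bruhat_le n u (w0 n)"
  by (rule bruhat_le_top_perm[OF _ w0_top_perm])
    (auto simp: breaks_def incr_on_def consec_UNIV strict_mono_on_def)

lemma w0_comp_stra:
  assumes "1 \<le> i" "i < n"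
  shows "w0 n \<circ> stra i = stra (n - i) \<circ> w0 n"
proof
  fix x
  show "(w0 n \<circ> stra i) x = (stra (n - i) \<circ> w0 n) x"
  proof (cases "x \<in> {1..n}")
    case True
    then have "stra i x \<in> {1..n}" using perm_in[OF stra_permutes[OF assms]] by blast
    then show ?thesis
      using True assms by (auto simp: w0_apply) (auto simp: stra_def)
  next
    case False
    then have "w0 n x = x" "stra i x = x"
      using permutes_not_in[OF w0_permutes] permutes_not_in[OF stra_permutes[OF assms]] by blast+
    moreover have "stra (n - i) x = x"
      using permutes_not_in[OF stra_permutes[of "n - i" n]] False assms by simp
    ultimately show ?thesis by simp
  qed
qed

text \<open>The value of \<open>w0 n \<circ> stra i\<close> at \<open>i\<close> is
  \<open>n - i\<close>, so its own count at \<open>(n - i, i)\<close> is positive. That this one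
  inequality suffices is \<open>bruhat_le_stra_top_perm\<close> for singleton blocks.\<close>

lemma bruhat_le_w0_stra_iff:
  assumes u: "u permutes {1..n}" and i: "1 \<le> i" "i < n"
  shows "bruhat_le n u (w0 n \<circ> stra i) \<longleftrightarrow> 1 \<le> cnt u (n - i) i"
proof
  assume le: "bruhat_le n u (w0 n \<circ> stra i)"
  have "(w0 n \<circ> stra i) i \<le> n - i"
    using i by (simp add: stra_def w0_apply)
  then have "1 \<le> cnt (w0 n \<circ> stra i) (n - i) i"
    unfolding cnt_pos_iff using i by (intro bexI[of _ i]) auto
  moreover have "cnt (w0 n \<circ> stra i) (n - i) i \<le> cnt u (n - i) i"
    using le i unfolding bruhat_le_def by simp
  ultimately show "1 \<le> cnt u (n - i) i" by simp
next
  assume "1 \<le> cnt u (n - i) i"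
  then show "bruhat_le n u (w0 n \<circ> stra i)"
    unfolding w0_comp_stra[OF i] using i
    by (intro bruhat_le_stra_top_perm[OF _ w0_top_perm u])
      (auto simp: breaks_def incr_on_def consec_UNIV strict_mono_on_def)
qed

text \<open>Maximising \<open>\<Sum>b. b * u b\<close> over the rearrangements of \<open>u\<close> within the blocks sorts each block.\<close>

lemma sorted_representative:
  assumes S: "breaks n S" and u: "u permutes {1..n}"
  shows "\<exists>v. v permutes {1..n} \<and> (\<forall>q\<in>S. v ` {1..q} = u ` {1..q}) \<and> incr_on S v"
proof -
  let ?V = "{v. v permutes {1..n} \<and> (\<forall>q\<in>S. v ` {1..q} = u ` {1..q})}"
  let ?f = "\<lambda>v. \<Sum>b = 1..n. b * v b"
  have fin: "finite ?V"
    by (rule finite_subset[OF _ finite_permutations[of "{1..n}"]]) auto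
  have "u \<in> ?V" using u by simp
  then have "Max (?f ` ?V) \<in> ?f ` ?V" using fin by (intro Max_in) auto
  then obtain v where v: "v \<in> ?V" "?f v = Max (?f ` ?V)" by (metis (no_types, lifting) imageE)
  then have vp: "v permutes {1..n}" by simp
  have max: "?f x \<le> ?f v" if "x \<in> ?V" for x
    unfolding v(2) using fin that by (intro Max_ge) auto
  have asc: "v b < v (Suc b)" if b: "1 \<le> b" "b < n" "b \<notin> S" for b
  proof (rule ccontr)
    assume "\<not> v b < v (Suc b)"
    moreover have "v b \<noteq> v (Suc b)" using perm_neq[OF vp] by simp
    ultimately have desc: "v (Suc b) < v b" by simp
    let ?x = "v \<circ> stra b"
    have "?x permutes {1..n}"
      using permutes_compose[OF stra_permutes[OF b(1,2)] vp] .
    moreover have "?x ` {1..q} = u ` {1..q}" if q: "q \<in> S" for q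
    proof -
      have "wordperm ([] @ [b]) ` {1..q} = {1..q}"
        using q b S by (intro wordperm_image) (auto simp: breaks_def)
      then have "?x ` {1..q} = v ` {1..q}"
        unfolding wordperm_snoc wordperm_Nil id_comp image_comp[symmetric] by simp
      then show ?thesis using v(1) q by simp
    qed
    ultimately have "?x \<in> ?V" by blast
    then have "?f ?x \<le> ?f v" by (rule max)
    moreover have "?f v < ?f ?x"
    proof -
      have split: "(\<Sum>c = 1..n. g c) = (\<Sum>c \<in> {1..n} - {b, Suc b}. g c) + (g b + g (Suc b))" for g :: "nat \<Rightarrow> nat"
        using sum.subset_diff[of "{b, Suc b}" "{1..n}" g] b by simp
      have "(\<Sum>c \<in> {1..n} - {b, Suc b}. c * ?x c) = (\<Sum>c \<in> {1..n} - {b, Suc b}. c * v c)"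
        by (intro sum.cong) (auto simp: stra_def)
      moreover have "b * v b + Suc b * v (Suc b) < b * ?x b + Suc b * ?x (Suc b)"
        using desc by (simp add: stra_def flip: Suc_eq_plus1)
      ultimately show ?thesis
        unfolding split[of "\<lambda>c. c * v c"] split[of "\<lambda>c. c * ?x c"] by linarith
    qed
    ultimately show False by simp
  qed
  have "incr_on S v"
    unfolding incr_on_def
  proof (intro allI impI)
    fix lo hi assume lh: "consec S lo hi"
    have "strict_mono_on {Suc lo..hi} v"
    proof (rule no_descent_strict_mono)
      fix i assume "Suc lo \<le> i" "i < hi"
      then show "v i < v (Suc i)"
        using lh consec_le[OF S lh] by (intro asc) (auto simp: consec_def)
    qed
    then show "strict_mono_on {lo<..hi} v" by (simp add: atLeastSucAtMost_greaterThanAtMost)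
  qed
  then show ?thesis using v(1) by auto
qed

text \<open>The witness is \<open>u \<circ> (a b)\<close>, where \<open>a\<close> is the first place where \<open>u\<close> and \<open>w\<close> differ and \<open>b\<close> is the
  first later place with \<open>u a < u b \<le> w a\<close>.\<close>

lemma bruhat_le_step:
  assumes u: "u permutes {1..n}" and w: "w permutes {1..n}" and le: "bruhat_le n u w" and neq: "u \<noteq> w"
  shows "\<exists>a b. 1 \<le> a \<and> a < b \<and> b \<le> n \<and> u a < u b \<and> bruhat_le n (u \<circ> Transposition.transpose a b) w"
proof -
  define a where "a = (LEAST a. u a \<noteq> w a)"
  have ex: "\<exists>a. u a \<noteq> w a" using neq by auto
  have a: "u a \<noteq> w a" unfolding a_def using ex by (rule LeastI_ex)
  have before: "u c = w c" if "c < a" for c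
    using not_less_Least[of c "\<lambda>a. u a \<noteq> w a"] that unfolding a_def by blast
  have a_in: "a \<in> {1..n}"
    using a permutes_not_in[OF u] permutes_not_in[OF w] by metis
  have wa: "w a \<in> {1..n}"
    using a_in perm_in[OF w] by blast
  have cnt_before: "cnt u p q = cnt w p q" if "q < a" for p q
    unfolding cnt_def using before that by (intro arg_cong[of _ _ card]) auto
  \<comment> \<open>Otherwise position \<open>a\<close> counts for \<open>w\<close> but not for
    \<open>u\<close> in row \<open>w a\<close>, against the rank inequality at
    \<open>(w a, a)\<close>.\<close>
  have "u a < w a"
  proof (rule ccontr)
    assume "\<not> u a < w a"
    then have gt: "w a < u a" using a by simp
    have split: "cnt v (w a) a = cnt v (w a) (a - 1) + card {b \<in> {a - 1<..a}. v b \<le> w a}" for v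
      by (rule cnt_col_split) simp
    have "{a - 1<..a} = {a}" using a_in by auto
    then have "{b \<in> {a - 1<..a}. w b \<le> w a} = {a}" "{b \<in> {a - 1<..a}. u b \<le> w a} = {}"
      using gt by auto
    then have "cnt u (w a) a < cnt w (w a) a"
      using split[of u] split[of w] cnt_before[of "a - 1" "w a"] a_in by simp
    then show False using le a_in wa unfolding bruhat_le_def by (meson atLeastAtMost_iff not_le)
  qed
  define b where "b = (LEAST b. a < b \<and> u a < u b \<and> u b \<le> w a)"
  have "\<exists>b. a < b \<and> u a < u b \<and> u b \<le> w a"
  proof -
    obtain b where b: "u b = w a" using permutes_surj[OF u] by (metis surj_def)
    have "\<not> b < a" using before[of b] b perm_neq[OF w, of b a] by auto
    moreover have "b \<noteq> a" using a b by auto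
    ultimately show ?thesis using b \<open>u a < w a\<close> by (intro exI[of _ b]) auto
  qed
  then have b: "a < b" "u a < u b" "u b \<le> w a"
    unfolding b_def by (metis (mono_tags, lifting) LeastI_ex)+
  have between: "\<not> (u a < u c \<and> u c \<le> w a)" if "a < c" "c < b" for c
    using not_less_Least[of c "\<lambda>b. a < b \<and> u a < u b \<and> u b \<le> w a"] that unfolding b_def by blast
  have b_in: "b \<in> {1..n}"
    using b wa perm_in[OF u, of b] by auto
  have "bruhat_le n (u \<circ> Transposition.transpose a b) w"
    unfolding bruhat_le_def
  proof (intro allI impI)
    fix p q assume pq: "p \<le> n" "q \<le> n"
    let ?t = "Transposition.transpose a b" and ?u = "u \<circ> Transposition.transpose a b"
    have lewq: "cnt w p q \<le> cnt u p q" using le pq by (simp add: bruhat_le_def)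
    \<comment> \<open>The exchange changes the count only for \<open>a \<le> q < b\<close> and
      \<open>u a \<le> p < u b\<close>, where it drops by one.\<close>
    consider "q < a" | "b \<le> q" | "a \<le> q" "q < b" "p < u a \<or> u b \<le> p" | "a \<le> q" "q < b" "u a \<le> p" "p < u b"
      by linarith
    then show "cnt w p q \<le> cnt ?u p q"
    proof cases
      case 1
      then have "cnt ?u p q = cnt u p q"
        unfolding cnt_def using b by (intro arg_cong[of _ _ card]) (auto simp: Transposition.transpose_def)
      then show ?thesis using lewq by simp
    next
      case 2
      have tp: "?t permutes {1..q}" using 2 b a_in b_in by (intro permutes_swap_id) auto
      have "?u ` {1..q} = u ` {1..q}"
        unfolding image_comp[symmetric] permutes_image[OF tp] ..
      then have "cnt ?u p q = cnt u p q"
        using a_in b_in by (intro cnt_image_cong[OF permutes_compose[OF permutes_swap_id u] u])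
      then show ?thesis using lewq by simp
    next
      case 3
      have "{c \<in> {1..q}. ?u c \<le> p} = {c \<in> {1..q}. u c \<le> p}"
        using 3 b by (auto simp: Transposition.transpose_def split: if_splits)
      then have "cnt ?u p q = cnt u p q" unfolding cnt_def by simp
      then show ?thesis using lewq by simp
    next
      case 4
      have "{c \<in> {1..q}. u c \<le> p} = insert a {c \<in> {1..q}. ?u c \<le> p}"
        using 4 b a_in by (auto simp: Transposition.transpose_def split: if_splits)
      moreover have "a \<notin> {c \<in> {1..q}. ?u c \<le> p}"
        using 4 by (simp add: Transposition.transpose_def)
      ultimately have drop: "cnt u p q = Suc (cnt ?u p q)" unfolding cnt_def by simp
      \<comment> \<open>To absorb the drop, compare the values in \<open>p<..w a\<close>. By
        minimality of \<open>b\<close>, \<open>u\<close> takes such values only at positions before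
        \<open>a\<close>, where it agrees with \<open>w\<close>, whereas \<open>w\<close> takes one
        more at \<open>a\<close> itself. As the counts up to \<open>w a\<close> are ordered, the
        inequality at \<open>p\<close> is strict.\<close>
      let ?R = "\<lambda>v. {c \<in> {1..q}. p < v c \<and> v c \<le> w a}"
      have row: "cnt v (w a) q = cnt v p q + card (?R v)" for v
      proof -
        have "{c \<in> {1..q}. v c \<le> w a} = {c \<in> {1..q}. v c \<le> p} \<union> ?R v"
          using 4 b by auto
        moreover have "{c \<in> {1..q}. v c \<le> p} \<inter> ?R v = {}" by auto
        ultimately show ?thesis unfolding cnt_def by (simp add: card_Un_disjoint)
      qed
      have "?R u \<subseteq> ?R w - {a}"
      proof
        fix c assume c: "c \<in> ?R u"
        have "c < a"
        proof (rule ccontr)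
          assume "\<not> c < a"
          moreover have "c \<noteq> a" using c 4 by auto
          ultimately show False using c 4 between[of c] by auto
        qed
        then show "c \<in> ?R w - {a}" using c before by auto
      qed
      then have "card (?R u) \<le> card (?R w - {a})" by (intro card_mono) auto
      moreover have "a \<in> ?R w" using 4 b a_in by auto
      then have "card (?R w) = Suc (card (?R w - {a}))" by (intro card.remove) auto
      moreover have "cnt w (w a) q \<le> cnt u (w a) q"
        using le pq wa by (simp add: bruhat_le_def)
      ultimately show ?thesis using row[of u] row[of w] drop by linarith
    qed
  qed
  then show ?thesis using a_in b_in b by (intro exI[of _ a] exI[of _ b]) auto
qed

section \<open>Bruhat decomposition\<close>

definition idm :: "nat \<Rightarrow> nat \<Rightarrow> nat \<Rightarrow> complex" where
  "idm n = (\<lambda>a b. if a \<in> {1..n} \<and> a = b then 1 else 0)"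

lemma supp_matD: "supp_mat n A \<Longrightarrow> a \<notin> {1..n} \<or> b \<notin> {1..n} \<Longrightarrow> A a b = 0"
  unfolding supp_mat_def by blast

lemma mat_eqI:
  assumes "supp_mat n A" "supp_mat n B" "\<And>a b. a \<in> {1..n} \<Longrightarrow> b \<in> {1..n} \<Longrightarrow> A a b = B a b"
  shows "A = B"
proof (intro ext)
  fix a b
  show "A a b = B a b"
    using assms supp_matD[of n A a b] supp_matD[of n B a b] by (cases "a \<in> {1..n} \<and> b \<in> {1..n}") auto
qed

lemma supp_mmul [simp]: "supp_mat n (mmul n A B)"
  and supp_idm [simp]: "supp_mat n (idm n)"
  and supp_pmat [simp]: "supp_mat n (pmat n w)"
  by (auto simp: supp_mat_def mmul_def idm_def pmat_def)

lemma mmul_entry: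
  "a \<in> {1..n} \<Longrightarrow> b \<in> {1..n} \<Longrightarrow> mmul n A B a b = (\<Sum>k=1..n. A a k * B k b)"
  by (simp add: mmul_def)

lemma mmul_assoc: "mmul n (mmul n A B) C = mmul n A (mmul n B C)"
proof (rule mat_eqI[of n])
  fix a b assume ab: "a \<in> {1..n}" "b \<in> {1..n}"
  have "mmul n (mmul n A B) C a b = (\<Sum>k=1..n. \<Sum>j=1..n. A a j * B j k * C k b)"
    using ab by (simp add: mmul_def sum_distrib_right)
  also have "\<dots> = (\<Sum>j=1..n. \<Sum>k=1..n. A a j * B j k * C k b)"
    by (rule sum.swap)
  also have "\<dots> = mmul n A (mmul n B C) a b"
    using ab by (simp add: mmul_def sum_distrib_left mult.assoc)
  finally show "mmul n (mmul n A B) C a b = mmul n A (mmul n B C) a b" .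
qed auto

lemma mmul_idm [simp]:
  assumes "supp_mat n A"
  shows "mmul n (idm n) A = A" "mmul n A (idm n) = A"
proof -
  show "mmul n (idm n) A = A"
  proof (rule mat_eqI[of n])
    fix a b assume ab: "a \<in> {1..n}" "b \<in> {1..n}"
    have "mmul n (idm n) A a b = (\<Sum>k=1..n. if a = k then A k b else 0)"
      using ab by (simp add: mmul_def idm_def if_distrib[of "\<lambda>x. x * _"] cong: if_cong)
    then show "mmul n (idm n) A a b = A a b" using ab by simp
  qed (use assms in auto)
  show "mmul n A (idm n) = A"
  proof (rule mat_eqI[of n])
    fix a b assume ab: "a \<in> {1..n}" "b \<in> {1..n}"
    have "mmul n A (idm n) a b = (\<Sum>k=1..n. if k = b then A a k else 0)"
      unfolding mmul_entry[OF ab] by (intro sum.cong) (auto simp: idm_def)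
    then show "mmul n A (idm n) a b = A a b" using ab by simp
  qed (use assms in auto)
qed

lemma jmat_mmul: "jmat m (mmul m A B) = jmat m A * jmat m B"
  by (rule eq_matI) (auto simp: mmul_def scalar_prod_def sum_shift_1[of _ m])

lemma jmat_inj:
  assumes "supp_mat n A" "supp_mat n B" "jmat n A = jmat n B"
  shows "A = B"
proof (rule mat_eqI[OF assms(1,2)])
  fix a b assume "a \<in> {1..n}" "b \<in> {1..n}"
  then show "A a b = B a b"
    using arg_cong[OF assms(3), of "\<lambda>M. M $$ (a - 1, b - 1)"] by auto
qed

lemma detm_idm: "detm n (idm n) = 1"
  by (subst detm_upper_triangular) (auto simp: idm_def)

lemma idm_Bor [simp]: "idm n \<in> Bor n"
  by (auto simp: Bor_def SLn_def detm_idm) (auto simp: idm_def)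

lemma Bor_SLn: "b \<in> Bor n \<Longrightarrow> b \<in> SLn n"
  by (simp add: Bor_def)

lemma SLn_supp: "g \<in> SLn n \<Longrightarrow> supp_mat n g"
  by (simp add: SLn_def)

lemma SLn_mmul: "g \<in> SLn n \<Longrightarrow> h \<in> SLn n \<Longrightarrow> mmul n g h \<in> SLn n"
  by (simp add: SLn_def detm_mmul)

lemma detm_inverse:
  assumes supp: "supp_mat n g" and g: "detm n g \<noteq> 0"
  shows "\<exists>h. supp_mat n h \<and> mmul n g h = idm n \<and> mmul n h g = idm n"
proof -
  have "det (jmat n g) \<noteq> 0"
    using g by (simp add: detm_eq_det)
  then have "jmat n g \<in> Units (ring_mat TYPE(complex) n ())"
    by (rule det_non_zero_imp_unit[OF jmat_carrier])
  then obtain B where B: "B \<in> carrier_mat n n" "B * jmat n g = 1\<^sub>m n" "jmat n g * B = 1\<^sub>m n"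
    unfolding Units_def ring_mat_def by auto
  define h where "h = (\<lambda>a b. if a \<in> {1..n} \<and> b \<in> {1..n} then B $$ (a - 1, b - 1) else 0)"
  have supp: "supp_mat n h" by (auto simp: h_def supp_mat_def)
  have jh: "jmat n h = B"
    using B(1) by (intro eq_matI) (auto simp: h_def)
  have jid: "jmat n (idm n) = 1\<^sub>m n"
    by (intro eq_matI) (auto simp: idm_def)
  have "mmul n g h = idm n" "mmul n h g = idm n"
    by (rule jmat_inj[of n]; simp add: jmat_mmul jh jid B)+
  then show ?thesis using supp by blast
qed

lemma SLn_inverse:
  assumes g: "g \<in> SLn n"
  shows "\<exists>h\<in>SLn n. mmul n g h = idm n \<and> mmul n h g = idm n"
proof -
  obtain h where h: "supp_mat n h" "mmul n g h = idm n" "mmul n h g = idm n"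
    using detm_inverse[of n g] g by (auto simp: SLn_def)
  have "detm n g * detm n h = 1"
    using detm_mmul[of n g h] h by (simp add: detm_idm)
  then have "h \<in> SLn n" using g h(1) by (simp add: SLn_def)
  then show ?thesis using h by blast
qed

lemma Bor_diag:
  assumes "b \<in> Bor n" "a \<in> {1..n}"
  shows "b a a \<noteq> 0"
proof -
  have "detm n b = (\<Prod>a=1..n. b a a)"
    using assms(1) by (intro detm_upper_triangular) (auto simp: Bor_def)
  then have "(\<Prod>a=1..n. b a a) \<noteq> 0" using assms(1) by (simp add: Bor_def SLn_def)
  then show ?thesis using assms(2) by (simp add: prod_zero_iff)
qed

lemma Bor_upper: "b \<in> Bor n \<Longrightarrow> c < a \<Longrightarrow> b a c = 0"
  by (simp add: Bor_def)

lemma Bor_mmul: "b \<in> Bor n \<Longrightarrow> b' \<in> Bor n \<Longrightarrow> mmul n b b' \<in> Bor n"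
proof -
  assume b: "b \<in> Bor n" "b' \<in> Bor n"
  have "mmul n b b' a c = 0" if "c < a" for a c
  proof -
    have "b a k * b' k c = 0" for k
      using Bor_upper[OF b(1), of k a] Bor_upper[OF b(2), of c k] that by (cases "k < a") auto
    then show ?thesis unfolding mmul_def by (simp only: sum.neutral_const if_cancel)
  qed
  then show ?thesis using b SLn_mmul by (simp add: Bor_def)
qed

text \<open>For the lowest nonzero entry \<open>h s c\<close> of a column, row \<open>s\<close> of
  \<open>b\<close> meets that column only through the diagonal, so the product has a nonzero entry
  at \<open>(s, c)\<close>. For \<open>c < s\<close> this contradicts the identity matrix.\<close>

lemma Bor_inverse:
  assumes b: "b \<in> Bor n"
  shows "\<exists>h\<in>Bor n. mmul n b h = idm n \<and> mmul n h b = idm n"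
proof -
  obtain h where h: "h \<in> SLn n" "mmul n b h = idm n" "mmul n h b = idm n"
    using SLn_inverse[OF Bor_SLn[OF b]] by blast
  have "h r c = 0" if "c < r" for r c
  proof (rule ccontr)
    assume nz: "h r c \<noteq> 0"
    then have rc: "r \<in> {1..n}" "c \<in> {1..n}" using supp_matD[OF SLn_supp[OF h(1)]] by blast+
    let ?R = "{r \<in> {1..n}. h r c \<noteq> 0}"
    define s where "s = Max ?R"
    have "s \<in> ?R" unfolding s_def using rc nz by (intro Max_in) auto
    moreover have "k \<le> s" if "k \<in> ?R" for k unfolding s_def using that by (intro Max_ge) auto
    moreover have "h k c = 0" if "k \<in> {1..n}" "s < k" for k
      using \<open>\<And>k. k \<in> ?R \<Longrightarrow> k \<le> s\<close>[of k] that by fastforce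
    ultimately have s: "s \<in> {1..n}" "h s c \<noteq> 0" "\<And>k. k \<in> {1..n} \<Longrightarrow> s < k \<Longrightarrow> h k c = 0" "r \<le> s"
      using rc nz by auto
    have "mmul n b h s c = (\<Sum>k=1..n. if k = s then b s s * h s c else 0)"
      unfolding mmul_entry[OF s(1) rc(2)]
    proof (intro sum.cong refl)
      fix k assume "k \<in> {1..n}"
      then show "b s k * h k c = (if k = s then b s s * h s c else 0)"
        using s(3)[of k] Bor_upper[OF b, of k s] by (cases k s rule: linorder_cases) auto
    qed
    then have "mmul n b h s c \<noteq> 0" using s Bor_diag[OF b s(1)] by simp
    then show False using h(2) s(4) that by (auto simp: idm_def)
  qed
  then show ?thesis using h by (auto simp: Bor_def)
qed

section \<open>Lifts of permutations, leading positions and Bruhat cells\<close>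

definition pcoef :: "(nat \<Rightarrow> nat) \<Rightarrow> nat \<Rightarrow> complex" where
  "pcoef u c = (if c = 1 then of_int (sign u) else 1)"

lemma pcoef_sq [simp]: "pcoef u c * pcoef u c = 1"
  by (simp add: pcoef_def sign_def)

lemma pcoef_nz [simp]: "pcoef u c \<noteq> 0"
  using pcoef_sq[of u c] by force

lemma mmul_pmat:
  assumes "u permutes {1..n}" "r \<in> {1..n}" "c \<in> {1..n}"
  shows "mmul n b (pmat n u) r c = b r (u c) * pcoef u c"
proof -
  have "mmul n b (pmat n u) r c = (\<Sum>k=1..n. if k = u c then b r k * pcoef u c else 0)"
    unfolding mmul_entry[OF assms(2,3)] using assms(3)
    by (intro sum.cong) (auto simp: pmat_def pcoef_def)
  then show ?thesis using assms perm_in[OF assms(1), of c] by simp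
qed

lemma detm_pmat:
  assumes u: "u permutes {1..n}" and n: "1 \<le> n"
  shows "detm n (pmat n u) = 1"
proof -
  have inv_inv: "inv_into UNIV u permutes {1..n}" using u by (rule permutes_inv)
  have "detm n (\<lambda>a b. pmat n u a (inv_into UNIV u b)) = of_int (sign (inv_into UNIV u)) * detm n (pmat n u)"
    by (rule detm_permute_cols[OF inv_inv])
  also have "sign (inv_into UNIV u) = sign u"
    using u permutation_permutes finite_atLeastAtMost by (intro sign_inverse) blast
  also have "detm n (\<lambda>a b. pmat n u a (inv_into UNIV u b)) = (\<Prod>a=1..n. pmat n u a (inv_into UNIV u a))"
    by (rule detm_upper_triangular) (auto simp: pmat_def permutes_inverses[OF u])
  also have "\<dots> = (\<Prod>a=1..n. if a = u 1 then of_int (sign u) else 1)"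
  proof (intro prod.cong refl)
    fix x assume x: "x \<in> {1..n}"
    have "inv_into UNIV u x = 1 \<longleftrightarrow> x = u 1"
      using permutes_inv_eq[OF u] by metis
    then show "pmat n u x (inv_into UNIV u x) = (if x = u 1 then of_int (sign u) else 1)"
      using x perm_in[OF inv_inv, of x] permutes_inverses(1)[OF u, of x] by (simp add: pmat_def)
  qed
  also have "\<dots> = of_int (sign u)"
    using perm_in[OF u, of 1] n by simp
  finally have "of_int (sign u) * detm n (pmat n u) = (of_int (sign u) :: complex)" by simp
  then show ?thesis by simp
qed

lemma pmat_SLn: "u permutes {1..n} \<Longrightarrow> 1 \<le> n \<Longrightarrow> pmat n u \<in> SLn n"
  by (simp add: SLn_def detm_pmat)

text \<open>The zero pattern of the products of an invertible upper triangular matrix with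
  \<open>pmat n u\<close>. It can be read off column by column, whereas a double coset asks for a
  factorisation.\<close>

definition leads :: "nat \<Rightarrow> (nat \<Rightarrow> nat) \<Rightarrow> (nat \<Rightarrow> nat \<Rightarrow> complex) \<Rightarrow> bool" where
  "leads n u g \<longleftrightarrow> u permutes {1..n} \<and> (\<forall>c\<in>{1..n}. g (u c) c \<noteq> 0 \<and> (\<forall>r>u c. g r c = 0))"

text \<open>Putting the columns back into the order of their leading rows makes the matrix upper
  triangular, with the leading entries, up to sign, on the diagonal.\<close>

lemma leads_decomp:
  assumes supp: "supp_mat n g" and l: "leads n u g"
  shows "\<exists>b. supp_mat n b \<and> (\<forall>a c. c < a \<longrightarrow> b a c = 0) \<and> (\<forall>a\<in>{1..n}. b a a \<noteq> 0) \<and> g = mmul n b (pmat n u)"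
proof -
  have u: "u permutes {1..n}" using l by (simp add: leads_def)
  let ?v = "inv_into UNIV u"
  note uv = permutes_inverses[OF u]
  have v: "?v s \<in> {1..n} \<longleftrightarrow> s \<in> {1..n}" for s
    by (rule perm_in[OF permutes_inv[OF u]])
  define b where "b = (\<lambda>r s. g r (?v s) * pcoef u (?v s))"
  have "supp_mat n b"
    unfolding supp_mat_def
  proof (intro allI impI)
    fix r s assume "r \<notin> {1..n} \<or> s \<notin> {1..n}"
    then have "r \<notin> {1..n} \<or> ?v s \<notin> {1..n}" using v[of s] by blast
    then show "b r s = 0" using supp_matD[OF supp] unfolding b_def by simp
  qed
  moreover have "b a c = 0" if "c < a" for a c
  proof (cases "c \<in> {1..n}")
    case True
    then show ?thesis
      using l v[of c] uv(1)[of c] that by (auto simp: b_def leads_def)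
  next
    case False
    then have "a \<notin> {1..n} \<or> ?v c \<notin> {1..n}" using v[of c] by blast
    then show ?thesis using supp_matD[OF supp] unfolding b_def by simp
  qed
  moreover have "b a a \<noteq> 0" if "a \<in> {1..n}" for a
    using l v[of a] uv(1)[of a] that by (auto simp: b_def leads_def dest: bspec[of _ _ "?v a"])
  moreover have "g = mmul n b (pmat n u)"
    using supp by (intro mat_eqI[of n]) (auto simp: mmul_pmat[OF u] b_def uv(2) mult.assoc)
  ultimately show ?thesis by blast
qed

lemma leads_detm_nz:
  assumes supp: "supp_mat n g" and l: "leads n u g" and n: "1 \<le> n"
  shows "detm n g \<noteq> 0"
proof -
  obtain b where b: "\<forall>a c. c < a \<longrightarrow> b a c = 0" "\<forall>a\<in>{1..n}. b a a \<noteq> 0" "g = mmul n b (pmat n u)"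
    using leads_decomp[OF assms(1,2)] by blast
  have "u permutes {1..n}" using l by (simp add: leads_def)
  then have "detm n g = detm n b" using b(3) n by (simp add: detm_mmul detm_pmat)
  also have "\<dots> = (\<Prod>a=1..n. b a a)" using b(1) by (intro detm_upper_triangular) auto
  also have "\<dots> \<noteq> 0" using b(2) by (simp add: prod_zero_iff)
  finally show ?thesis .
qed

lemma leads_Bor_decomp:
  assumes g: "g \<in> SLn n" and l: "leads n u g" and n: "1 \<le> n"
  shows "\<exists>b\<in>Bor n. g = mmul n b (pmat n u)"
proof -
  obtain b where b: "supp_mat n b" "\<forall>a c. c < a \<longrightarrow> b a c = 0" "g = mmul n b (pmat n u)"
    using leads_decomp[OF SLn_supp[OF g] l] by blast
  have "u permutes {1..n}" using l by (simp add: leads_def)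
  then have "detm n b = 1" using g b(3) n by (simp add: SLn_def detm_mmul detm_pmat)
  then show ?thesis using b by (auto simp: Bor_def SLn_def)
qed

lemma leads_Bor_pmat:
  assumes b: "b \<in> Bor n" and u: "u permutes {1..n}"
  shows "leads n u (mmul n b (pmat n u))"
  unfolding leads_def
proof (intro conjI ballI allI impI u)
  fix c assume c: "c \<in> {1..n}"
  then have uc: "u c \<in> {1..n}" using perm_in[OF u] by blast
  then show "mmul n b (pmat n u) (u c) c \<noteq> 0"
    using Bor_diag[OF b] by (simp add: mmul_pmat[OF u uc c])
  fix r assume r: "u c < r"
  show "mmul n b (pmat n u) r c = 0"
  proof (cases "r \<in> {1..n}")
    case True
    then show ?thesis using Bor_upper[OF b r] by (simp add: mmul_pmat[OF u _ c])
  next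
    case False
    then show ?thesis using supp_matD[OF supp_mmul] by blast
  qed
qed

abbreviation bcell :: "nat \<Rightarrow> (nat \<Rightarrow> nat) \<Rightarrow> (nat \<Rightarrow> nat \<Rightarrow> complex) set" where
  "bcell n u \<equiv> dcell n (Bor n) u (Bor n)"

lemma bcell_iff_leads:
  assumes u: "u permutes {1..n}" and n: "1 \<le> n"
  shows "g \<in> bcell n u \<longleftrightarrow> g \<in> SLn n \<and> (\<exists>y\<in>Bor n. leads n u (mmul n g y))"
proof
  assume "g \<in> bcell n u"
  then obtain b y where b: "b \<in> Bor n" "y \<in> Bor n" "g = mmul n (mmul n b (pmat n u)) y"
    by (auto simp: dcell_def)
  obtain z where z: "z \<in> Bor n" "mmul n y z = idm n" using Bor_inverse[OF b(2)] by blast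
  have "mmul n g z = mmul n b (pmat n u)"
    unfolding b(3) mmul_assoc z(2) by simp
  then have "leads n u (mmul n g z)" using leads_Bor_pmat[OF b(1) u] by simp
  moreover have "g \<in> SLn n"
    unfolding b(3) by (intro SLn_mmul pmat_SLn Bor_SLn[OF b(1)] Bor_SLn[OF b(2)] u n)
  ultimately show "g \<in> SLn n \<and> (\<exists>y\<in>Bor n. leads n u (mmul n g y))" using z by blast
next
  assume "g \<in> SLn n \<and> (\<exists>y\<in>Bor n. leads n u (mmul n g y))"
  then obtain y where g: "g \<in> SLn n" "y \<in> Bor n" "leads n u (mmul n g y)" by blast
  obtain b where b: "b \<in> Bor n" "mmul n g y = mmul n b (pmat n u)"
    using leads_Bor_decomp[OF SLn_mmul[OF g(1) Bor_SLn[OF g(2)]] g(3) n] by blast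
  obtain z where z: "z \<in> Bor n" "mmul n y z = idm n" using Bor_inverse[OF g(2)] by blast
  have "g = mmul n (mmul n g y) z"
    using SLn_supp[OF g(1)] by (simp add: mmul_assoc z(2))
  then show "g \<in> bcell n u"
    unfolding b(2) dcell_def using b z by blast
qed

lemma bcell_mult:
  assumes "g \<in> bcell n u" "x \<in> Bor n" "y \<in> Bor n"
  shows "mmul n (mmul n x g) y \<in> bcell n u"
proof -
  obtain b b' where b: "b \<in> Bor n" "b' \<in> Bor n" "g = mmul n (mmul n b (pmat n u)) b'"
    using assms(1) by (auto simp: dcell_def)
  have "mmul n (mmul n x g) y = mmul n (mmul n (mmul n x b) (pmat n u)) (mmul n b' y)"
    unfolding b(3) by (simp only: mmul_assoc)
  then show ?thesis
    using Bor_mmul[OF assms(2) b(1)] Bor_mmul[OF b(2) assms(3)] unfolding dcell_def by blast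
qed

text \<open>Among the vectors \<open>M c + span (M 1, \<dots>, M (c - 1))\<close> choose one whose last nonzero coordinate
  is as far left as possible; minimality forces these leading positions to be distinct.\<close>

lemma echelon_form:
  fixes M :: "nat \<Rightarrow> nat \<Rightarrow> complex"
  assumes indep: "\<And>d. (\<forall>b\<in>{1..n}. (\<Sum>a=1..m. d a * M a b) = 0) \<Longrightarrow> (\<forall>a\<in>{1..m}. d a = 0)"
  shows "\<exists>T u. (\<forall>c\<in>{1..m}. T c c = 1 \<and> (\<forall>a. a \<notin> {1..c} \<longrightarrow> T c a = 0)) \<and> inj_on u {1..m} \<and>
    (\<forall>c\<in>{1..m}. u c \<in> {1..n} \<and> (\<Sum>a=1..m. T c a * M a (u c)) \<noteq> 0 \<and>
      (\<forall>b\<in>{1..n}. u c < b \<longrightarrow> (\<Sum>a=1..m. T c a * M a b) = (0::complex)))"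
proof -
  define Q where "Q c k t \<longleftrightarrow> t c = 1 \<and> (\<forall>a. a \<notin> {1..c} \<longrightarrow> t a = 0) \<and>
     (\<forall>b\<in>{1..n}. k < b \<longrightarrow> (\<Sum>a=1..m. t a * M a b) = (0::complex))" for c k t
  define u where "u c = (LEAST k. \<exists>t. Q c k t)" for c
  define T where "T c = (SOME t. Q c (u c) t)" for c
  have QT: "Q c (u c) (T c)" if "c \<in> {1..m}" for c
  proof -
    have "Q c n (\<lambda>a. if a = c then 1 else 0)" using that by (auto simp: Q_def)
    then have "\<exists>k. \<exists>t. Q c k t" by blast
    then have "\<exists>t. Q c (u c) t" unfolding u_def by (rule LeastI_ex)
    then show ?thesis unfolding T_def by (rule someI_ex)
  qed
  have least: "\<not> Q c k t" if "k < u c" for c k t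
    using not_less_Least[of k "\<lambda>k. \<exists>t. Q c k t"] that unfolding u_def by blast
  let ?f = "\<lambda>c b. \<Sum>a=1..m. T c a * M a b"
  have u1: "1 \<le> u c" if c: "c \<in> {1..m}" for c
  proof (rule ccontr)
    assume "\<not> 1 \<le> u c"
    then have "\<forall>b\<in>{1..n}. ?f c b = 0" using QT[OF c] by (auto simp: Q_def)
    then have "T c c = 0" using indep c by blast
    then show False using QT[OF c] by (simp add: Q_def)
  qed
  have nz: "?f c (u c) \<noteq> 0 \<and> u c \<le> n" if c: "c \<in> {1..m}" for c
  proof (rule ccontr)
    assume neg: "\<not> (?f c (u c) \<noteq> 0 \<and> u c \<le> n)"
    have "Q c (u c - 1) (T c)"
      unfolding Q_def
    proof (intro conjI ballI impI)
      fix b assume b: "b \<in> {1..n}" "u c - 1 < b"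
      then consider "b = u c" | "u c < b" by linarith
      then show "?f c b = 0"
      proof cases
        case 1
        then show ?thesis using neg b by auto
      next
        case 2
        then show ?thesis using QT[OF c] b by (simp add: Q_def)
      qed
    qed (use QT[OF c] in \<open>auto simp: Q_def\<close>)
    then show False using least[of "u c - 1" c] u1[OF c] by simp
  qed
  have neq: "u c' \<noteq> u c" if c: "c \<in> {1..m}" "c' \<in> {1..m}" "c' < c" for c c'
  proof
    assume eq: "u c' = u c"
    \<comment> \<open>If two vectors lead at the same place, this multiple of the earlier one
      cancels the leading coordinate of the later one and leaves its coefficient 1 at
      \<open>c\<close> alone, against minimality of \<open>u c\<close>.\<close>
    let ?x = "?f c (u c) / ?f c' (u c)"
    let ?t = "\<lambda>a. T c a - ?x * T c' a"
    have sum_t: "(\<Sum>a=1..m. ?t a * M a b) = ?f c b - ?x * ?f c' b" for b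
      by (simp add: left_diff_distrib sum_subtractf sum_distrib_left mult.assoc)
    have "Q c (u c - 1) ?t"
      unfolding Q_def
    proof (intro conjI ballI impI)
      show "?t c = 1" using QT[OF c(1)] QT[OF c(2)] c(3) by (simp add: Q_def)
      show "\<forall>a. a \<notin> {1..c} \<longrightarrow> ?t a = 0" using QT[OF c(1)] QT[OF c(2)] c(3) by (auto simp: Q_def)
      fix b assume b: "b \<in> {1..n}" "u c - 1 < b"
      then consider "b = u c" | "u c < b" by linarith
      then show "(\<Sum>a=1..m. ?t a * M a b) = 0"
      proof cases
        case 1
        then show ?thesis unfolding sum_t using nz[OF c(2)] eq by simp
      next
        case 2
        then have "?f c b = 0" "?f c' b = 0" using QT[OF c(1)] QT[OF c(2)] b eq by (auto simp: Q_def)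
        then show ?thesis unfolding sum_t by simp
      qed
    qed
    then show False using least[of "u c - 1" c] u1[OF c(1)] by simp
  qed
  have "inj_on u {1..m}"
    using neq by (intro linorder_inj_onI') auto
  then show ?thesis
    using QT u1 nz by (intro exI[of _ T] exI[of _ u]) (auto simp: Q_def)
qed

lemma SLn_columns_indep:
  assumes g: "g \<in> SLn n" and z: "\<forall>r\<in>{1..n}. (\<Sum>c=1..n. d c * g r c) = 0"
  shows "\<forall>c\<in>{1..n}. d c = 0"
proof -
  have "detm n (\<lambda>a b. g b a) = 0" if "\<not> (\<forall>c\<in>{1..n}. d c = 0)"
    unfolding detm_eq_0_iff using that z by (intro exI[of _ d] conjI) blast
  moreover have "detm n (\<lambda>a b. g b a) = 1"
    unfolding detm_transpose[of n g] using g by (simp add: SLn_def)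
  ultimately show ?thesis by (metis zero_neq_one)
qed

text \<open>Echelon form applied to the columns of \<open>g\<close>: the coefficients
  \<open>T\<close> fill a unipotent upper triangular \<open>y\<close>, and the leading rows of the
  \<open>n\<close> new columns are distinct, hence a permutation.\<close>

lemma Bruhat_decomposition:
  assumes g: "g \<in> SLn n"
  shows "\<exists>u. \<exists>y\<in>Bor n. leads n u (mmul n g y)"
proof -
  obtain T u where T: "\<forall>c\<in>{1..n}. T c c = 1 \<and> (\<forall>a. a \<notin> {1..c} \<longrightarrow> T c a = 0)"
    and u: "inj_on u {1..n}"
    and Tu: "\<forall>c\<in>{1..n}. u c \<in> {1..n} \<and> (\<Sum>a=1..n. T c a * g (u c) a) \<noteq> 0 \<and>
      (\<forall>b\<in>{1..n}. u c < b \<longrightarrow> (\<Sum>a=1..n. T c a * g b a) = 0)"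
    using echelon_form[where M = "\<lambda>a b. g b a" and m = n and n = n] SLn_columns_indep[OF g] by blast
  define y where "y = (\<lambda>a c. if c \<in> {1..n} then T c a else 0)"
  define v where "v x = (if x \<in> {1..n} then u x else x)" for x
  have up: "y a c = 0" if "c < a" for a c using T that by (auto simp: y_def)
  have "detm n y = (\<Prod>a=1..n. y a a)" by (rule detm_upper_triangular) (use up in auto)
  also have "\<dots> = 1" by (rule prod.neutral) (use T in \<open>auto simp: y_def\<close>)
  finally have "y \<in> Bor n"
    using up T by (auto simp: Bor_def SLn_def supp_mat_def) (auto simp: y_def)
  moreover have v: "v permutes {1..n}"
  proof (rule bij_imp_permutes)
    have "u ` {1..n} = {1..n}" using u Tu by (intro endo_inj_surj) auto
    then have "bij_betw u {1..n} {1..n}" using u by (simp add: bij_betw_def)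
    then show "bij_betw v {1..n} {1..n}" by (rule bij_betw_cong[THEN iffD1, rotated]) (simp add: v_def)
  qed (auto simp: v_def)
  moreover have "mmul n g y r c = (\<Sum>a=1..n. T c a * g r a)" if "r \<in> {1..n}" "c \<in> {1..n}" for r c
    using that by (simp add: mmul_def y_def mult.commute)
  then have "leads n v (mmul n g y)"
    unfolding leads_def
  proof (intro conjI ballI allI impI v)
    assume e: "\<And>r c. r \<in> {1..n} \<Longrightarrow> c \<in> {1..n} \<Longrightarrow> mmul n g y r c = (\<Sum>a=1..n. T c a * g r a)"
    fix c assume c: "c \<in> {1..n}"
    then have vc: "v c = u c" by (simp add: v_def)
    show "mmul n g y (v c) c \<noteq> 0"
      unfolding vc using e[OF _ c] Tu c by simp
    fix r assume "v c < r"
    then show "mmul n g y r c = 0"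
      unfolding vc using e[OF _ c, of r] Tu c supp_matD[OF supp_mmul, of r n c] by (cases "r \<in> {1..n}") auto
  qed
  ultimately show ?thesis by blast
qed

section \<open>Flags\<close>

lemma rowspanI:
  assumes "\<And>b. b \<in> {1..n} \<Longrightarrow> v b = (\<Sum>a=1..m. d a * M a b)" "\<And>b. b \<notin> {1..n} \<Longrightarrow> v b = 0"
  shows "v \<in> rowspan n m M"
  unfolding rowspan_def using assms by (intro CollectI exI[of _ d]) auto

lemma rowspanE:
  assumes "v \<in> rowspan n m M"
  obtains d where "\<And>b. b \<in> {1..n} \<Longrightarrow> v b = (\<Sum>a=1..m. d a * M a b)" "\<And>b. b \<notin> {1..n} \<Longrightarrow> v b = 0"
proof -
  obtain c where "v = (\<lambda>b. if b \<in> {1..n} then \<Sum>a=1..m. c a * M a b else 0)"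
    using assms unfolding rowspan_def by blast
  then show thesis by (intro that[of c]) (simp_all only: if_True if_False)
qed

lemma rowspan_cong:
  assumes "\<And>a b. a \<in> {1..m} \<Longrightarrow> b \<in> {1..n} \<Longrightarrow> M a b = N a b"
  shows "rowspan n m M = rowspan n m N"
proof -
  have "(\<Sum>a=1..m. c a * M a b) = (\<Sum>a=1..m. c a * N a b)" if "b \<in> {1..n}" for c b
    using assms that by (intro sum.cong) auto
  then have "(\<lambda>b. if b \<in> {1..n} then \<Sum>a=1..m. c a * M a b else 0)
      = (\<lambda>b. if b \<in> {1..n} then \<Sum>a=1..m. c a * N a b else 0)" for c
    by (intro ext) simp
  then show ?thesis unfolding rowspan_def by simp
qed

definition indep_rows :: "nat \<Rightarrow> nat \<Rightarrow> (nat \<Rightarrow> nat \<Rightarrow> complex) \<Rightarrow> bool" where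
  "indep_rows n q M \<longleftrightarrow> (\<forall>d. (\<forall>b\<in>{1..n}. (\<Sum>a=1..q. d a * M a b) = 0) \<longrightarrow> (\<forall>a\<in>{1..q}. d a = 0))"

lemma sum_pad:
  fixes f :: "nat \<Rightarrow> complex"
  assumes "q \<le> m"
  shows "(\<Sum>a=1..m. (if a \<le> q then d a else 0) * f a) = (\<Sum>a=1..q. d a * f a)"
proof -
  have "(\<Sum>a=1..m. (if a \<le> q then d a else 0) * f a) = (\<Sum>a\<in>{1..q}. (if a \<le> q then d a else 0) * f a)"
    using assms by (intro sum.mono_neutral_right) auto
  then show ?thesis by simp
qed

lemma indep_rows_mono:
  assumes "indep_rows n m M" "q \<le> m"
  shows "indep_rows n q M"
  unfolding indep_rows_def
proof (intro allI impI)
  fix d assume d: "\<forall>b\<in>{1..n}. (\<Sum>a=1..q. d a * M a b) = 0"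
  have "\<forall>b\<in>{1..n}. (\<Sum>a=1..m. (if a \<le> q then d a else 0) * M a b) = 0"
    unfolding sum_pad[OF assms(2)] by (rule d)
  then have "\<forall>a\<in>{1..m}. (if a \<le> q then d a else 0) = 0"
    by (rule assms(1)[unfolded indep_rows_def, THEN spec, THEN mp])
  then show "\<forall>a\<in>{1..q}. d a = 0" using assms(2) by (auto dest!: bspec)
qed

lemma fullrank_indep: "fullrank n m M \<Longrightarrow> indep_rows n m M"
  by (simp add: fullrank_def indep_rows_def)

lemma SLn_indep: "g \<in> SLn n \<Longrightarrow> q \<le> n \<Longrightarrow> indep_rows n q (\<lambda>a b. g b a)"
proof (rule indep_rows_mono[of n n])
  assume "g \<in> SLn n"
  then show "indep_rows n n (\<lambda>a b. g b a)"
    unfolding indep_rows_def using SLn_columns_indep[of g n] by (intro allI impI)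
qed

text \<open>The coefficient matrix \<open>?K\<close> expressing \<open>F\<close> through
  \<open>M\<close> is invertible, since a relation between its rows would be one between the rows of
  \<open>F\<close>; its inverse expresses \<open>M\<close> through \<open>F\<close>.\<close>

lemma rowspan_eq_of_generators:
  assumes ind: "indep_rows n q F" and sub: "\<And>c. c \<in> {1..q} \<Longrightarrow> \<exists>d. \<forall>b\<in>{1..n}. F c b = (\<Sum>a=1..q. d a * M a b)"
  shows "rowspan n q F = rowspan n q M"
proof -
  obtain K where K: "\<And>c b. c \<in> {1..q} \<Longrightarrow> b \<in> {1..n} \<Longrightarrow> F c b = (\<Sum>a=1..q. K c a * M a b)"
    using sub by metis
  let ?K = "\<lambda>c a. if c \<in> {1..q} \<and> a \<in> {1..q} then K c a else 0"
  have F: "F c b = (\<Sum>a=1..q. ?K c a * M a b)" if "c \<in> {1..q}" "b \<in> {1..n}" for c b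
    unfolding K[OF that] using that by (intro sum.cong) auto
  have sumF: "(\<Sum>c=1..q. d c * F c b) = (\<Sum>a=1..q. (\<Sum>c=1..q. d c * ?K c a) * M a b)" if "b \<in> {1..n}" for d b
  proof -
    have "(\<Sum>c=1..q. d c * F c b) = (\<Sum>c=1..q. \<Sum>a=1..q. d c * ?K c a * M a b)"
      by (intro sum.cong refl) (simp only: F that sum_distrib_left mult.assoc)
    also have "\<dots> = (\<Sum>a=1..q. \<Sum>c=1..q. d c * ?K c a * M a b)" by (rule sum.swap)
    finally show ?thesis by (simp only: sum_distrib_right)
  qed
  have "detm q ?K \<noteq> 0"
  proof
    assume "detm q ?K = 0"
    then obtain d where d: "\<exists>c\<in>{1..q}. d c \<noteq> 0" "\<forall>a\<in>{1..q}. (\<Sum>c=1..q. d c * ?K c a) = 0"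
      unfolding detm_eq_0_iff by blast
    then have "\<forall>b\<in>{1..n}. (\<Sum>c=1..q. d c * F c b) = 0"
      by (intro ballI) (simp only: sumF, rule sum.neutral, simp)
    then show False using ind d(1) unfolding indep_rows_def by blast
  qed
  moreover have "supp_mat q ?K" by (auto simp: supp_mat_def)
  ultimately obtain L where L: "mmul q L ?K = idm q"
    using detm_inverse by blast
  have M: "M a b = (\<Sum>c=1..q. L a c * F c b)" if a: "a \<in> {1..q}" and b: "b \<in> {1..n}" for a b
  proof -
    have "(\<Sum>c=1..q. L a c * F c b) = (\<Sum>a'=1..q. mmul q L ?K a a' * M a' b)"
      unfolding sumF[OF b] using a by (intro sum.cong refl) (simp add: mmul_entry del: mult_cancel_right)
    also have "\<dots> = (\<Sum>a'=1..q. if a' = a then M a b else 0)"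
      unfolding L using a by (intro sum.cong) (auto simp: idm_def)
    finally show ?thesis using a by simp
  qed
  show ?thesis
  proof (intro equalityI subsetI)
    fix v assume "v \<in> rowspan n q F"
    then obtain d where "\<And>b. b \<in> {1..n} \<Longrightarrow> v b = (\<Sum>a=1..q. d a * F a b)" "\<And>b. b \<notin> {1..n} \<Longrightarrow> v b = 0"
      by (rule rowspanE) (rule that)
    then show "v \<in> rowspan n q M" using sumF by (intro rowspanI) auto
  next
    fix v assume "v \<in> rowspan n q M"
    then obtain d where d: "\<And>b. b \<in> {1..n} \<Longrightarrow> v b = (\<Sum>a=1..q. d a * M a b)" "\<And>b. b \<notin> {1..n} \<Longrightarrow> v b = 0"
      by (rule rowspanE) (rule that)
    have "v b = (\<Sum>c=1..q. (\<Sum>a=1..q. d a * L a c) * F c b)" if b: "b \<in> {1..n}" for b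
    proof -
      have "v b = (\<Sum>a=1..q. \<Sum>c=1..q. d a * L a c * F c b)"
        unfolding d(1)[OF b] by (intro sum.cong refl) (simp only: M b sum_distrib_left mult.assoc)
      also have "\<dots> = (\<Sum>c=1..q. \<Sum>a=1..q. d a * L a c * F c b)" by (rule sum.swap)
      finally show ?thesis by (simp only: sum_distrib_right)
    qed
    then show "v \<in> rowspan n q F" using d(2) by (intro rowspanI) auto
  qed
qed

definition Fs :: "nat \<Rightarrow> (nat \<Rightarrow> nat \<Rightarrow> complex) \<Rightarrow> nat \<Rightarrow> (nat \<Rightarrow> complex) set" where
  "Fs n g q = rowspan n q (\<lambda>a b. g b a)"

lemma Fs_mmul_Bor:
  assumes g: "g \<in> SLn n" and y: "y \<in> Bor n" and q: "q \<le> n"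
  shows "Fs n (mmul n g y) q = Fs n g q"
  unfolding Fs_def
proof (rule rowspan_eq_of_generators)
  show "indep_rows n q (\<lambda>a b. mmul n g y b a)"
    using SLn_indep[OF SLn_mmul[OF g Bor_SLn[OF y]] q] .
  fix c assume c: "c \<in> {1..q}"
  have "mmul n g y b c = (\<Sum>a=1..q. y a c * g b a)" if b: "b \<in> {1..n}" for b
  proof -
    have "mmul n g y b c = (\<Sum>a=1..n. g b a * y a c)" using b c q by (simp add: mmul_entry)
    also have "\<dots> = (\<Sum>a=1..q. g b a * y a c)"
      using q c Bor_upper[OF y] by (intro sum.mono_neutral_right) auto
    finally show ?thesis by (simp add: mult.commute)
  qed
  then show "\<exists>d. \<forall>b\<in>{1..n}. mmul n g y b c = (\<Sum>a=1..q. d a * g b a)"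
    by (intro exI[of _ "\<lambda>a. y a c"] ballI)
qed

section \<open>Lifting, sorting and modifying flags\<close>

lemma scale_column_SLn:
  assumes supp: "supp_mat n h" and nz: "detm n h \<noteq> 0" and i: "i \<in> {1..n}"
  shows "(\<lambda>r c. if c = i then h r c / detm n h else h r c) \<in> SLn n"
proof -
  let ?h = "\<lambda>r c. if c = i then h r c / detm n h else h r c"
  have "detm n ?h = detm n (\<lambda>c r. ?h r c)" by (rule detm_transpose[symmetric])
  also have "\<dots> = detm n (\<lambda>c r. if c = i then (1 / detm n h) * h r c else h r c)"
    by (rule detm_cong) simp
  also have "\<dots> = 1 / detm n h * detm n (\<lambda>c r. h r c)" by (rule detm_scale_row[OF i])
  also have "\<dots> = 1" unfolding detm_transpose[of n h] using nz by simp
  finally show ?thesis using supp by (simp add: SLn_def supp_mat_def)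
qed

lemma inj_extends_to_permutation:
  fixes m n :: nat
  assumes inj: "inj_on u {1..m}" and im: "u ` {1..m} \<subseteq> {1..n}" and mn: "m \<le> n"
  shows "\<exists>v. v permutes {1..n} \<and> (\<forall>c\<in>{1..m}. v c = u c)"
proof -
  have "card ({1..n} - u ` {1..m}) = n - m"
    using im inj by (simp add: card_Diff_subset card_image)
  then have "card {m<..n} = card ({1..n} - u ` {1..m})" by simp
  then obtain h where h: "bij_betw h {m<..n} ({1..n} - u ` {1..m})"
    using finite_same_card_bij[of "{m<..n}" "{1..n} - u ` {1..m}"] by auto
  define v where "v x = (if x \<in> {1..m} then u x else if x \<in> {m<..n} then h x else x)" for x
  have "bij_betw v {1..m} (u ` {1..m})"
    using inj by (subst bij_betw_cong[of "{1..m}" v u]) (simp_all add: v_def bij_betw_def)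
  moreover have "bij_betw v {m<..n} ({1..n} - u ` {1..m})"
    by (rule bij_betw_cong[THEN iffD1, OF _ h]) (auto simp: v_def)
  ultimately have "bij_betw v ({1..m} \<union> {m<..n}) (u ` {1..m} \<union> ({1..n} - u ` {1..m}))"
    by (rule bij_betw_combine) auto
  moreover have "{1..m} \<union> {m<..n} = {1..n}" "u ` {1..m} \<union> ({1..n} - u ` {1..m}) = {1..n}"
    using mn im by auto
  ultimately have "v permutes {1..n}"
    using mn by (intro bij_imp_permutes) (auto simp: v_def)
  then show ?thesis by (auto simp: v_def)
qed

text \<open>The unitriangular \<open>T\<close> brings the rows of \<open>M\<close> into echelon form
  and keeps their initial spans. Completing the leading positions to a permutation and adding unit
  vectors there gives a matrix with distinct leading positions, hence an invertible one.\<close>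

lemma extend_to_SLn:
  assumes M: "fullrank n m M" and mn: "m < n"
  shows "\<exists>g\<in>SLn n. \<forall>q\<le>m. Fs n g q = rowspan n q M"
proof -
  obtain T u where T: "\<forall>c\<in>{1..m}. T c c = 1 \<and> (\<forall>a. a \<notin> {1..c} \<longrightarrow> T c a = 0)"
    and u: "inj_on u {1..m}"
    and Tu: "\<forall>c\<in>{1..m}. u c \<in> {1..n} \<and> (\<Sum>a=1..m. T c a * M a (u c)) \<noteq> 0 \<and>
      (\<forall>b\<in>{1..n}. u c < b \<longrightarrow> (\<Sum>a=1..m. T c a * M a b) = 0)"
    using echelon_form[where M = M and m = m and n = n] fullrank_indep[OF M] unfolding indep_rows_def by blast
  have "u ` {1..m} \<subseteq> {1..n}" using Tu by blast
  then obtain v where v: "v permutes {1..n}" "\<And>c. c \<in> {1..m} \<Longrightarrow> v c = u c"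
    using inj_extends_to_permutation[OF u _ less_imp_le[OF mn]] by blast
  define h where "h r c = (if r \<in> {1..n} \<and> c \<in> {1..n} then
      (if c \<le> m then \<Sum>a=1..m. T c a * M a r else if r = v c then 1 else 0) else 0)" for r c
  have supp: "supp_mat n h" by (auto simp: supp_mat_def h_def)
  have "leads n v h"
    unfolding leads_def
  proof (intro conjI ballI allI impI v(1))
    fix c assume c: "c \<in> {1..n}"
    then have vc: "v c \<in> {1..n}" using perm_in[OF v(1)] by blast
    show "h (v c) c \<noteq> 0" using vc c Tu v(2)[of c] by (auto simp: h_def)
    fix r assume "v c < r"
    then show "h r c = 0" using c Tu v(2)[of c] by (auto simp: h_def)
  qed
  then have nz: "detm n h \<noteq> 0" using supp mn by (intro leads_detm_nz) auto
  \<comment> \<open>The column rescaled to reach determinant 1 is the last one; as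
    \<open>m < n\<close>, it does not enter any \<open>Fs n g q\<close> with
    \<open>q \<le> m\<close>.\<close>
  define g where "g = (\<lambda>r c. if c = n then h r c / detm n h else h r c)"
  have g: "g \<in> SLn n" unfolding g_def using scale_column_SLn[OF supp nz, of n] mn by simp
  have "Fs n g q = rowspan n q M" if q: "q \<le> m" for q
    unfolding Fs_def
  proof (rule rowspan_eq_of_generators)
    show "indep_rows n q (\<lambda>a b. g b a)" using g q mn by (intro SLn_indep) auto
    fix c assume c: "c \<in> {1..q}"
    have "g b c = (\<Sum>a=1..q. T c a * M a b)" if "b \<in> {1..n}" for b
    proof -
      have "g b c = (\<Sum>a=1..m. T c a * M a b)" using that c q mn by (simp add: g_def h_def)
      also have "\<dots> = (\<Sum>a=1..q. T c a * M a b)"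
        using T c q by (intro sum.mono_neutral_right) auto
      finally show ?thesis .
    qed
    then show "\<exists>d. \<forall>b\<in>{1..n}. g b c = (\<Sum>a=1..q. d a * M a b)"
      by (intro exI[of _ "T c"] ballI)
  qed
  then show ?thesis using g by blast
qed

text \<open>Among the columns used whose leading row exceeds \<open>p\<close>, the one with the
  largest leading row cannot be cancelled in that row.\<close>

lemma leads_vanish:
  assumes l: "leads n u g" and q: "q \<le> n" and z: "\<And>r. r \<in> {p<..n} \<Longrightarrow> (\<Sum>c=1..q. d c * g r c) = 0"
    and c: "c \<in> {1..q}" "p < u c"
  shows "d c = 0"
proof (rule ccontr)
  assume "d c \<noteq> 0"
  have u: "u permutes {1..n}" using l by (simp add: leads_def)
  let ?C = "{c \<in> {1..q}. d c \<noteq> 0 \<and> p < u c}"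
  have "Max (u ` ?C) \<in> u ` ?C" using c \<open>d c \<noteq> 0\<close> by (intro Max_in) auto
  then obtain c0 where c0: "c0 \<in> ?C" "u c0 = Max (u ` ?C)" by auto
  have max: "u c \<le> u c0" if "c \<in> ?C" for c unfolding c0(2) using that by (intro Max_ge) auto
  have c0n: "c0 \<in> {1..n}" using c0 q by auto
  then have "u c0 \<in> {1..n}" using perm_in[OF u] by blast
  then have "(\<Sum>c=1..q. d c * g (u c0) c) = 0" using z c0 by auto
  also have "(\<Sum>c=1..q. d c * g (u c0) c) = (\<Sum>c=1..q. if c = c0 then d c0 * g (u c0) c0 else 0)"
  proof (intro sum.cong refl)
    fix c assume c: "c \<in> {1..q}"
    show "d c * g (u c0) c = (if c = c0 then d c0 * g (u c0) c0 else 0)"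
    proof (cases "c = c0 \<or> d c = 0")
      case False
      then have "u c \<noteq> u c0" using perm_neq[OF u] by simp
      moreover have "u c \<le> u c0"
        using max[of c] False c c0(1) by (cases "p < u c") auto
      ultimately have "u c < u c0" by simp
      moreover have "c \<in> {1..n}" using c q by simp
      ultimately show ?thesis using l False by (simp add: leads_def)
    qed auto
  qed
  also have "\<dots> = d c0 * g (u c0) c0" using c0 by simp
  finally have "g (u c0) c0 = 0" using c0(1) by simp
  then show False using l c0n by (simp add: leads_def)
qed

lemma leads_Fs_zero_iff:
  assumes g: "g \<in> SLn n" and l: "leads n u g" and q: "q \<le> n"
  shows "(\<exists>v\<in>Fs n g q. v \<noteq> (\<lambda>_. 0) \<and> (\<forall>r\<in>{p<..n}. v r = 0)) \<longleftrightarrow> (\<exists>c\<in>{1..q}. u c \<le> p)"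
proof
  assume "\<exists>v\<in>Fs n g q. v \<noteq> (\<lambda>_. 0) \<and> (\<forall>r\<in>{p<..n}. v r = 0)"
  then obtain v where v: "v \<in> Fs n g q" "v \<noteq> (\<lambda>_. 0)" "\<forall>r\<in>{p<..n}. v r = 0" by blast
  obtain d where d: "\<And>b. b \<in> {1..n} \<Longrightarrow> v b = (\<Sum>a=1..q. d a * g b a)" "\<And>b. b \<notin> {1..n} \<Longrightarrow> v b = 0"
    using v(1) unfolding Fs_def by (rule rowspanE) (rule that)
  show "\<exists>c\<in>{1..q}. u c \<le> p"
  proof (rule ccontr)
    assume neg: "\<not> ?thesis"
    have z: "(\<Sum>c=1..q. d c * g r c) = 0" if "r \<in> {p<..n}" for r
      using d(1)[of r] v(3) that by simp
    have "d c = 0" if "c \<in> {1..q}" for c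
      using neg that by (intro leads_vanish[OF l q z that]) (auto simp: not_le)
    then have "v b = 0" for b using d by (cases "b \<in> {1..n}") auto
    then show False using v(2) by blast
  qed
next
  assume "\<exists>c\<in>{1..q}. u c \<le> p"
  then obtain c where c: "c \<in> {1..q}" "u c \<le> p" by blast
  have cn: "c \<in> {1..n}" using c q by simp
  have "(\<lambda>r. g r c) \<in> Fs n g q"
    unfolding Fs_def
  proof (rule rowspanI[where d = "\<lambda>a. if a = c then 1 else 0"])
    fix b
    have "(\<Sum>a=1..q. (if a = c then 1 else 0) * g b a) = (\<Sum>a=1..q. if a = c then g b c else 0)"
      by (intro sum.cong) auto
    then show "g b c = (\<Sum>a=1..q. (if a = c then 1 else 0) * g b a)" using c by simp
  next
    fix b assume "b \<notin> {1..n}"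
    then show "g b c = 0" using supp_matD[OF SLn_supp[OF g]] by blast
  qed
  moreover have "(\<lambda>r. g r c) \<noteq> (\<lambda>_. 0)" using l cn unfolding leads_def by metis
  moreover have "\<forall>r\<in>{p<..n}. g r c = 0" using l cn c(2) by (auto simp: leads_def)
  ultimately show "\<exists>v\<in>Fs n g q. v \<noteq> (\<lambda>_. 0) \<and> (\<forall>r\<in>{p<..n}. v r = 0)" by blast
qed

text \<open>Up to signs the first \<open>q\<close> columns of the product are the columns of
  \<open>b\<close> with indices in the image of \<open>{1..q}\<close>, so their span depends on this
  set only.\<close>

lemma Fs_image_subset:
  assumes u: "u permutes {1..n}" and v: "v permutes {1..n}" and q: "q \<le> n"
    and im: "u ` {1..q} = v ` {1..q}"
  shows "Fs n (mmul n b (pmat n u)) q \<subseteq> Fs n (mmul n b (pmat n v)) q"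
proof
  fix x assume "x \<in> Fs n (mmul n b (pmat n u)) q"
  then obtain d where d: "\<And>r. r \<in> {1..n} \<Longrightarrow> x r = (\<Sum>a=1..q. d a * mmul n b (pmat n u) r a)" "\<And>r. r \<notin> {1..n} \<Longrightarrow> x r = 0"
    unfolding Fs_def by (rule rowspanE) (rule that)
  let ?iu = "inv_into UNIV u"
  let ?e = "\<lambda>c. d (?iu (v c)) * pcoef u (?iu (v c)) * pcoef v c"
  show "x \<in> Fs n (mmul n b (pmat n v)) q"
    unfolding Fs_def
  proof (rule rowspanI[where d = ?e])
    fix r assume r: "r \<in> {1..n}"
    have "x r = (\<Sum>a=1..q. d a * pcoef u a * b r (u a))"
      unfolding d(1)[OF r] using q r by (intro sum.cong refl) (simp add: mmul_pmat[OF u])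
    also have "\<dots> = (\<Sum>s\<in>u ` {1..q}. d (?iu s) * pcoef u (?iu s) * b r s)"
      using permutes_inj[OF u] by (subst sum.reindex) (auto simp: permutes_inverses[OF u] inj_on_def inj_def)
    also have "\<dots> = (\<Sum>a=1..q. d (?iu (v a)) * pcoef u (?iu (v a)) * b r (v a))"
      unfolding im using permutes_inj[OF v] by (subst sum.reindex) (auto simp: inj_on_def inj_def)
    also have "\<dots> = (\<Sum>a=1..q. ?e a * mmul n b (pmat n v) r a)"
      using q r by (intro sum.cong refl) (simp add: mmul_pmat[OF v])
    finally show "x r = (\<Sum>a=1..q. ?e a * mmul n b (pmat n v) r a)" .
  qed (use d(2) in auto)
qed

text \<open>In a point \<open>b u\<close> the factor \<open>u\<close> may be rearranged inside the
  blocks without moving the steps of the flag that belong to \<open>S\<close>. This makes the lift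
  satisfy the hypotheses on increasing permutations.\<close>

lemma sort_flag:
  assumes n: "1 \<le> n" and S: "breaks n S" and g: "g \<in> SLn n" and y: "y \<in> Bor n" and l: "leads n u (mmul n g y)"
  shows "\<exists>g'\<in>SLn n. \<exists>v. leads n v g' \<and> incr_on S v \<and> (\<forall>q\<in>S. v ` {1..q} = u ` {1..q} \<and> Fs n g' q = Fs n g q)"
proof -
  have u: "u permutes {1..n}" using l by (simp add: leads_def)
  have gy: "mmul n g y \<in> SLn n" using SLn_mmul[OF g Bor_SLn[OF y]] .
  obtain b where b: "b \<in> Bor n" "mmul n g y = mmul n b (pmat n u)"
    using leads_Bor_decomp[OF gy l n] by blast
  obtain v where v: "v permutes {1..n}" "\<forall>q\<in>S. v ` {1..q} = u ` {1..q}" "incr_on S v"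
    using sorted_representative[OF S u] by blast
  let ?g = "mmul n b (pmat n v)"
  have "?g \<in> SLn n" using SLn_mmul[OF Bor_SLn[OF b(1)] pmat_SLn[OF v(1) n]] .
  moreover have "leads n v ?g" using leads_Bor_pmat[OF b(1) v(1)] .
  moreover have "Fs n ?g q = Fs n g q" if q: "q \<in> S" for q
  proof -
    have "q \<le> n" using S q by (auto simp: breaks_def)
    then have "Fs n ?g q = Fs n (mmul n b (pmat n u)) q"
      using v q by (intro equalityI Fs_image_subset u) auto
    then show ?thesis using Fs_mmul_Bor[OF g y \<open>q \<le> n\<close>] b(2) by simp
  qed
  ultimately show ?thesis using v by blast
qed

lemma plucker_eq_0_iff_rowspan:
  assumes M: "indep_rows n q M" and J: "J \<subseteq> {1..n}" "card J = q"
  shows "plucker M J = 0 \<longleftrightarrow> (\<exists>v\<in>rowspan n q M. v \<noteq> (\<lambda>_. 0) \<and> (\<forall>b\<in>J. v b = 0))"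
proof -
  have fin: "finite J" using J(1) finite_subset by blast
  show ?thesis
    unfolding plucker_eq_0_iff[OF fin] J(2)
  proof
    assume "\<exists>d. (\<exists>a\<in>{1..q}. d a \<noteq> 0) \<and> (\<forall>b\<in>J. (\<Sum>a=1..q. d a * M a b) = 0)"
    then obtain d where d: "\<exists>a\<in>{1..q}. d a \<noteq> 0" "\<forall>b\<in>J. (\<Sum>a=1..q. d a * M a b) = 0" by blast
    let ?v = "\<lambda>b. if b \<in> {1..n} then \<Sum>a=1..q. d a * M a b else 0"
    have "?v \<in> rowspan n q M" by (rule rowspanI[where d = d]) auto
    moreover have "?v \<noteq> (\<lambda>_. 0)"
    proof
      assume "?v = (\<lambda>_. 0)"
      then have "\<forall>b\<in>{1..n}. (\<Sum>a=1..q. d a * M a b) = 0" by (metis (mono_tags, lifting))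
      then show False using M d(1) unfolding indep_rows_def by blast
    qed
    moreover have "\<forall>b\<in>J. ?v b = 0" using d(2) by simp
    ultimately show "\<exists>v\<in>rowspan n q M. v \<noteq> (\<lambda>_. 0) \<and> (\<forall>b\<in>J. v b = 0)" by blast
  next
    assume "\<exists>v\<in>rowspan n q M. v \<noteq> (\<lambda>_. 0) \<and> (\<forall>b\<in>J. v b = 0)"
    then obtain v where v: "v \<in> rowspan n q M" "v \<noteq> (\<lambda>_. 0)" "\<forall>b\<in>J. v b = 0" by blast
    obtain d where d: "\<And>b. b \<in> {1..n} \<Longrightarrow> v b = (\<Sum>a=1..q. d a * M a b)" "\<And>b. b \<notin> {1..n} \<Longrightarrow> v b = 0"
      using v(1) by (rule rowspanE) (rule that)
    have "\<exists>a\<in>{1..q}. d a \<noteq> 0"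
    proof (rule ccontr)
      assume "\<not> ?thesis"
      then have "v b = 0" for b using d by (cases "b \<in> {1..n}") auto
      then show False using v(2) by blast
    qed
    moreover have "\<forall>b\<in>J. (\<Sum>a=1..q. d a * M a b) = 0" using d(1) v(3) J(1) by (metis subsetD)
    ultimately show "\<exists>d. (\<exists>a\<in>{1..q}. d a \<noteq> 0) \<and> (\<forall>b\<in>J. (\<Sum>a=1..q. d a * M a b) = 0)" by blast
  qed
qed

text \<open>Steinitz exchange: the new vector goes to place \<open>i\<close> and the old column
  \<open>i\<close> to place \<open>e\<close>, where the vector has a nonzero coefficient. Everything
  happens among the columns \<open>i\<close> to \<open>c\<close>, so only the steps from
  \<open>i\<close> to \<open>c - 1\<close> can change. The factor \<kappa> is the correction to
  determinant 1.\<close>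

lemma exchange_column:
  assumes g: "g \<in> SLn n" and i: "1 \<le> i" "i \<le> e" "e \<le> c" "c \<le> n" and \<beta>: "\<beta> e \<noteq> 0"
  shows "\<exists>h\<in>SLn n. \<exists>\<kappa>. \<kappa> \<noteq> 0 \<and> (\<forall>b<i. \<forall>r. h r b = g r b) \<and>
     (\<forall>r\<in>{1..n}. h r i = \<kappa> * (\<Sum>b=1..c. \<beta> b * g r b)) \<and>
     (\<forall>q. q < i \<or> c \<le> q \<and> q \<le> n \<longrightarrow> Fs n h q = Fs n g q)"
proof -
  define x where "x r = (\<Sum>b=1..c. \<beta> b * g r b)" for r
  define h where "h r b = (if r \<in> {1..n} then (if b = i then x r else if b = e then g r i else g r b) else 0)" for r b
  have h_out: "h r b = 0" if "r \<notin> {1..n}" for r b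
    unfolding h_def using that by (rule if_not_P)
  have gs: "supp_mat n g" using g by (rule SLn_supp)
  have supp: "supp_mat n h"
    unfolding supp_mat_def
  proof (intro allI impI)
    fix r b assume rb: "r \<notin> {1..n} \<or> b \<notin> {1..n}"
    show "h r b = 0"
    proof (cases "r \<in> {1..n}")
      case True
      then have "b \<notin> {1..n}" using rb by simp
      then have "b \<noteq> i" "b \<noteq> e" "g r b = 0" using i supp_matD[OF gs, of r b] by auto
      then show ?thesis by (simp add: h_def)
    qed (rule h_out)
  qed
  have "detm n (\<lambda>b r. h r b) \<noteq> 0"
  proof
    assume "detm n (\<lambda>b r. h r b) = 0"
    then obtain d where d: "\<exists>b\<in>{1..n}. d b \<noteq> 0" "\<forall>r\<in>{1..n}. (\<Sum>b=1..n. d b * h r b) = 0"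
      unfolding detm_eq_0_iff by blast
    \<comment> \<open>The relation \<open>d\<close> between the columns of \<open>h\<close>,
      rewritten in the columns of \<open>g\<close>.\<close>
    define \<eta> where "\<eta> b = (if b = i then (if e = i then 0 else d e) else if b = e then 0 else d b)
        + d i * (if b \<le> c then \<beta> b else 0)" for b
    have "(\<Sum>b=1..n. \<eta> b * g r b) = 0" if r: "r \<in> {1..n}" for r
    proof -
      have in_n: "i \<in> {1..n}" "e \<in> {1..n}" using i by auto
      have "(\<Sum>b=1..n. \<eta> b * g r b) = (\<Sum>b=1..n. (if b = i then (if e = i then 0 else d e) else if b = e then 0 else d b) * g r b)
          + d i * (\<Sum>b=1..n. (if b \<le> c then \<beta> b else 0) * g r b)"
        by (simp add: \<eta>_def distrib_right sum.distrib sum_distrib_left mult.assoc)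
      also have "(\<Sum>b=1..n. (if b \<le> c then \<beta> b else 0) * g r b) = h r i"
        unfolding sum_pad[OF i(4)] using r by (simp add: h_def x_def)
      also have "(\<Sum>b=1..n. (if b = i then (if e = i then 0 else d e) else if b = e then 0 else d b) * g r b)
          = (\<Sum>b\<in>{1..n} - {i}. d b * h r b)"
      proof (cases "e = i")
        case True
        have "(\<Sum>b=1..n. (if b = i then (if e = i then 0 else d e) else if b = e then 0 else d b) * g r b)
          = (\<Sum>b\<in>{1..n} - {i}. (if b = i then (if e = i then 0 else d e) else if b = e then 0 else d b) * g r b)"
          using True by (intro sum.mono_neutral_right) auto
        also have "\<dots> = (\<Sum>b\<in>{1..n} - {i}. d b * h r b)"
          using True r by (intro sum.cong) (auto simp: h_def)
        finally show ?thesis .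
      next
        case False
        have "(\<Sum>b=1..n. (if b = i then (if e = i then 0 else d e) else if b = e then 0 else d b) * g r b)
          = d e * g r i + (\<Sum>b\<in>{1..n} - {i} - {e}. d b * g r b)"
          using in_n False by (simp add: sum.remove[of "{1..n}" i] sum.remove[of "{1..n} - {i}" e])
        also have "(\<Sum>b\<in>{1..n} - {i} - {e}. d b * g r b) = (\<Sum>b\<in>{1..n} - {i} - {e}. d b * h r b)"
          using r by (intro sum.cong) (auto simp: h_def)
        also have "d e * g r i = d e * h r e" using False r by (simp add: h_def)
        also have "d e * h r e + (\<Sum>b\<in>{1..n} - {i} - {e}. d b * h r b) = (\<Sum>b\<in>{1..n} - {i}. d b * h r b)"
          using in_n False by (simp add: sum.remove[of "{1..n} - {i}" e])
        finally show ?thesis .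
      qed
      also have "(\<Sum>b\<in>{1..n} - {i}. d b * h r b) + d i * h r i = (\<Sum>b=1..n. d b * h r b)"
        using in_n by (simp add: sum.remove[of "{1..n}" i])
      finally show ?thesis using d(2) r by simp
    qed
    then have \<eta>: "\<eta> b = 0" if "b \<in> {1..n}" for b using SLn_columns_indep[OF g] that by blast
    \<comment> \<open>The old column \<open>e\<close> enters \<open>h\<close> only through the new
      vector, so \<open>\<beta> e \<noteq> 0\<close> forces \<open>d i = 0\<close>.\<close>
    have "\<eta> e = d i * \<beta> e" using i by (auto simp: \<eta>_def)
    then have di: "d i = 0" using \<eta>[of e] \<beta> i by auto
    have "d b = 0" if b: "b \<in> {1..n}" for b
    proof (cases "b = i \<or> b = e")
      case True
      then show ?thesis using di \<eta>[of i] i by (auto simp: \<eta>_def split: if_splits)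
    next
      case False
      then show ?thesis using \<eta>[OF b] di by (simp add: \<eta>_def)
    qed
    then show False using d(1) by blast
  qed
  then have nz: "detm n h \<noteq> 0" unfolding detm_transpose[of n h] .
  define h' where "h' = (\<lambda>r b. if b = i then h r b / detm n h else h r b)"
  have h': "h' \<in> SLn n"
    unfolding h'_def using i by (intro scale_column_SLn supp nz) auto
  have low: "h' r b = g r b" if "b < i" for r b
    using that i supp_matD[OF gs, of r b] by (auto simp: h'_def h_def)
  have col: "h' r i = 1 / detm n h * (\<Sum>b=1..c. \<beta> b * g r b)" if "r \<in> {1..n}" for r
    using that by (simp add: h'_def h_def x_def)
  have unit: "(\<Sum>a=1..q. (if a = b then 1 else 0) * g r a) = g r b" if "b \<in> {1..q}" for r b q
  proof -
    have "(\<Sum>a=1..q. (if a = b then 1 else 0) * g r a) = (\<Sum>a=1..q. if a = b then g r b else 0)"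
      by (intro sum.cong) auto
    then show ?thesis using that by simp
  qed
  have "Fs n h' q = Fs n g q" if q: "q < i \<or> c \<le> q \<and> q \<le> n" for q
    unfolding Fs_def
  proof (rule rowspan_eq_of_generators)
    show "indep_rows n q (\<lambda>a b. h' b a)" using h' q i by (intro SLn_indep) auto
    fix b assume b: "b \<in> {1..q}"
    consider "b \<noteq> i" "b \<noteq> e \<or> b < i" | "b = e" "b \<noteq> i" "i \<le> b" | "b = i" by linarith
    then show "\<exists>d. \<forall>r\<in>{1..n}. h' r b = (\<Sum>a=1..q. d a * g r a)"
    proof cases
      case 1
      then have "\<forall>r\<in>{1..n}. h' r b = g r b" using i by (auto simp: h'_def h_def)
      then show ?thesis using unit[OF b] by (intro exI[of _ "\<lambda>a. if a = b then 1 else 0"]) simp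
    next
      case 2
      then have "\<forall>r\<in>{1..n}. h' r b = g r i" by (auto simp: h'_def h_def)
      moreover have "i \<in> {1..q}" using 2 b i by auto
      ultimately show ?thesis using unit[of i q] by (intro exI[of _ "\<lambda>a. if a = i then 1 else 0"]) simp
    next
      case 3
      then have cq: "c \<le> q" using b q by auto
      have "h' r b = (\<Sum>a=1..q. (if a \<le> c then 1 / detm n h * \<beta> a else 0) * g r a)" if "r \<in> {1..n}" for r
        unfolding sum_pad[OF cq] using col[OF that] 3 by (simp add: sum_distrib_left mult.assoc)
      then show ?thesis by (intro exI[of _ "\<lambda>a. if a \<le> c then 1 / detm n h * \<beta> a else 0"] ballI)
    qed
  qed
  then show ?thesis
    using h' low col nz by (intro bexI[of _ h'] exI[of _ "1 / detm n h"]) auto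
qed

section \<open>Schubert varieties\<close>

lemma continuous_on_entry:
  fixes f :: "'a::topological_space \<Rightarrow> nat \<Rightarrow> nat \<Rightarrow> complex"
  assumes "continuous_on S f"
  shows "continuous_on S (\<lambda>x. f x a b)"
  by (rule continuous_on_product_then_coordinatewise[OF continuous_on_product_then_coordinatewise[OF assms]])

lemma continuous_on_matI:
  fixes f :: "'a::topological_space \<Rightarrow> nat \<Rightarrow> nat \<Rightarrow> complex"
  assumes "\<And>a b. continuous_on S (\<lambda>x. f x a b)"
  shows "continuous_on S f"
  by (rule continuous_on_coordinatewise_then_product, rule continuous_on_coordinatewise_then_product, rule assms)

lemma continuous_on_mmul:
  assumes "continuous_on S f" "continuous_on S g"
  shows "continuous_on S (\<lambda>x. mmul n (f x) (g x))"
proof (rule continuous_on_matI)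
  fix a b
  show "continuous_on S (\<lambda>x. mmul n (f x) (g x) a b)"
  proof (cases "a \<in> {1..n} \<and> b \<in> {1..n}")
    case True
    have "continuous_on S (\<lambda>x. \<Sum>k=1..n. f x a k * g x k b)"
      by (intro continuous_on_sum continuous_on_mult continuous_on_entry[OF assms(1)] continuous_on_entry[OF assms(2)])
    then show ?thesis using True by (simp add: mmul_def)
  next
    case False
    then have "mmul n (f x) (g x) a b = 0" for x unfolding mmul_def by (rule if_not_P)
    then show ?thesis by simp
  qed
qed

lemma continuous_on_detm:
  assumes "\<And>a b. continuous_on S (\<lambda>x. f x a b)"
  shows "continuous_on S (\<lambda>x. detm m (f x))"
  unfolding detm_def
  by (intro continuous_on_sum continuous_on_mult continuous_on_prod continuous_on_const assms)

lemma closure_mult_closed: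
  assumes "\<And>s. s \<in> S \<Longrightarrow> mmul n (mmul n x s) y \<in> T" "g \<in> closure S"
  shows "mmul n (mmul n x g) y \<in> closure T"
proof -
  have "(\<lambda>g. mmul n (mmul n x g) y) ` closure S \<subseteq> closure T"
    using assms(1) closure_subset
    by (intro image_closure_subset continuous_on_mmul continuous_on_const continuous_on_id) auto
  then show ?thesis using assms(2) by auto
qed

text \<open>The minor of \<open>b\<^sup>-\<^sup>1 g\<close> with rows \<open>u 1, \<dots>, u q\<close> does not vanish at \<open>g \<in> B u B\<close>, but
  vanishes on \<open>B w B\<close> as soon as the rank inequality at \<open>(p, q)\<close> fails.\<close>

lemma closure_bcell_imp_bruhat_le:
  assumes n: "1 \<le> n" and w: "w permutes {1..n}" and g: "g \<in> SLn n" "g \<in> closure (bcell n w)"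
    and y: "y \<in> Bor n" and l: "leads n u (mmul n g y)"
  shows "bruhat_le n u w"
  unfolding bruhat_le_def
proof (intro allI impI)
  fix p q assume pq: "p \<le> n" "q \<le> n"
  show "cnt w p q \<le> cnt u p q"
  proof (rule ccontr)
    assume neg: "\<not> cnt w p q \<le> cnt u p q"
    have u: "u permutes {1..n}" using l by (simp add: leads_def)
    obtain b where b: "b \<in> Bor n" "mmul n g y = mmul n b (pmat n u)"
      using leads_Bor_decomp[OF SLn_mmul[OF g(1) Bor_SLn[OF y]] l n] by blast
    obtain z where z: "z \<in> Bor n" "mmul n z b = idm n" using Bor_inverse[OF b(1)] by blast
    define \<phi> where "\<phi> x = detm q (\<lambda>a c. mmul n (mmul n z x) y (u a) c)" for x
    have "\<phi> x = 0" if x: "x \<in> bcell n w" for x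
    proof -
      have "mmul n (mmul n z x) y \<in> bcell n w" (is "?x \<in> _") by (rule bcell_mult[OF x z(1) y])
      then obtain y2 where y2: "y2 \<in> Bor n" "leads n w (mmul n ?x y2)" and xS: "?x \<in> SLn n"
        using bcell_iff_leads[OF w n] by blast
      obtain y3 where y3: "y3 \<in> Bor n" "mmul n y2 y3 = idm n" using Bor_inverse[OF y2(1)] by blast
      let ?f = "mmul n ?x y2"
      have xf: "?x = mmul n ?f y3" using SLn_supp[OF xS] y3(2) by (simp add: mmul_assoc[of n _ y2])
      have "\<phi> x = detm q (mmul q (\<lambda>a k. ?f (u a) k) y3)"
        unfolding \<phi>_def
      proof (rule detm_cong)
        fix a c assume ac: "a \<in> {1..q}" "c \<in> {1..q}"
        then have "u a \<in> {1..n}" "c \<in> {1..n}" using perm_in[OF u, of a] pq by auto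
        then have "?x (u a) c = (\<Sum>k=1..n. ?f (u a) k * y3 k c)"
          by (subst xf) (rule mmul_entry)
        also have "\<dots> = (\<Sum>k=1..q. ?f (u a) k * y3 k c)"
          using ac pq Bor_upper[OF y3(1)] by (intro sum.mono_neutral_right) auto
        finally show "?x (u a) c = mmul q (\<lambda>a k. ?f (u a) k) y3 a c"
          using ac by (simp add: mmul_entry)
      qed
      also have "\<dots> = detm q (\<lambda>a k. ?f (u a) k) * detm q y3" by (rule detm_mmul)
      \<comment> \<open>Rows with \<open>u a > p\<close> vanish in columns with
        \<open>w c \<le> p\<close>; this block is too large precisely because the rank inequality
        fails.\<close>
      also have "detm q (\<lambda>a k. ?f (u a) k) = 0"
      proof (rule detm_zero_block)
        let ?R = "{a \<in> {1..q}. \<not> u a \<le> p}" and ?C = "{c \<in> {1..q}. w c \<le> p}"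
        show "?R \<subseteq> {1..q}" "?C \<subseteq> {1..q}" by auto
        have "{1..q} = ?R \<union> {a \<in> {1..q}. u a \<le> p}" by auto
        then have "q \<le> card ?R + cnt u p q"
          unfolding cnt_def by (metis (no_types, lifting) card_Un_le card_atLeastAtMost diff_Suc_1 One_nat_def)
        then show "q < card ?R + card ?C" using neg unfolding cnt_def by linarith
        fix a c assume "a \<in> ?R" "c \<in> ?C"
        then show "?f (u a) c = 0" using y2(2) pq by (auto simp: leads_def)
      qed
      finally show ?thesis by simp
    qed
    then have sub: "bcell n w \<subseteq> {x. \<phi> x = 0}" by blast
    have "continuous_on UNIV \<phi>"
      unfolding \<phi>_def
      by (rule continuous_on_detm, rule continuous_on_entry)
        (intro continuous_on_mmul continuous_on_const continuous_on_id)
    then have "closed {x. \<phi> x = 0}" by (intro closed_Collect_eq continuous_on_const)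
    then have "\<phi> g = 0" using closure_minimal[OF sub] g(2) by blast
    moreover have "mmul n (mmul n z g) y = pmat n u"
    proof -
      have "mmul n (mmul n z g) y = mmul n (mmul n z b) (pmat n u)"
        by (simp only: mmul_assoc b(2))
      then show ?thesis by (simp add: z(2))
    qed
    then have "\<phi> g = detm q (\<lambda>a c. pmat n u (u a) c)" by (simp only: \<phi>_def)
    also have "\<dots> = (\<Prod>a=1..q. pmat n u (u a) a)"
    proof (rule detm_upper_triangular)
      fix a c :: nat assume "c < a"
      then have "u a \<noteq> u c" using perm_neq[OF u] by simp
      then show "pmat n u (u a) c = 0" by (simp add: pmat_def)
    qed
    also have "\<dots> = (\<Prod>a=1..q. pcoef u a)"
      using perm_in[OF u] pq by (intro prod.cong) (auto simp: pmat_def pcoef_def)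
    finally show False by (simp add: prod_zero_iff)
  qed
qed

text \<open>The lower elementary matrices \<open>E \<epsilon>\<close> move \<open>pmat n u\<close>
  along a curve that lies in the larger cell for \<open>\<epsilon> \<noteq> 0\<close> and returns to
  \<open>pmat n u\<close> at 0. Multiplication by \<open>B\<close> on both sides spreads this over
  the whole cell.\<close>

lemma bcell_subset_closure_step:
  fixes a b :: nat
  assumes n: "1 \<le> n" and u: "u permutes {1..n}" and ab: "1 \<le> a" "a < b" "b \<le> n" "u a < u b"
  shows "bcell n u \<subseteq> closure (bcell n (u \<circ> Transposition.transpose a b))"
proof -
  let ?u = "u \<circ> Transposition.transpose a b"
  have u': "?u permutes {1..n}"
    using ab by (intro permutes_compose[OF permutes_swap_id u]) auto
  have abn: "a \<in> {1..n}" "b \<in> {1..n}" using ab by auto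
  then have uabn: "u a \<in> {1..n}" "u b \<in> {1..n}" using perm_in[OF u] by blast+
  define E where "E \<epsilon> r s = (idm n r s + (if r = u b \<and> s = u a then \<epsilon> else 0))" for \<epsilon> :: complex and r s
  define G where "G \<epsilon> = mmul n (E \<epsilon>) (pmat n u)" for \<epsilon>
  have E_SLn: "E \<epsilon> \<in> SLn n" for \<epsilon>
  proof -
    have "detm n (E \<epsilon>) = detm n (\<lambda>s r. E \<epsilon> r s)" by (rule detm_transpose[symmetric])
    also have "\<dots> = (\<Prod>a=1..n. E \<epsilon> a a)"
      using ab(4) by (intro detm_upper_triangular) (auto simp: E_def idm_def)
    also have "\<dots> = 1" using ab(4) by (intro prod.neutral) (auto simp: E_def idm_def)
    finally show ?thesis using uabn by (auto simp: SLn_def supp_mat_def E_def idm_def)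
  qed
  have G_entry: "G \<epsilon> r c = (if r = u c then pcoef u c else if r = u b \<and> c = a then \<epsilon> * pcoef u a else 0)"
    if "r \<in> {1..n}" "c \<in> {1..n}" for \<epsilon> r c
    unfolding G_def mmul_pmat[OF u that] E_def idm_def
    using that perm_in[OF u, of c] perm_neq[OF u, of c a] perm_neq[OF u, of a b] ab by (cases "c = a") auto
  have G_SLn: "G \<epsilon> \<in> SLn n" for \<epsilon>
    unfolding G_def by (intro SLn_mmul E_SLn pmat_SLn u n)
  have G_cell: "G \<epsilon> \<in> bcell n ?u" if \<epsilon>: "\<epsilon> \<noteq> 0" for \<epsilon>
  proof -
    \<comment> \<open>Chosen so that adding \<open>t\<close> times column \<open>a\<close> to column
      \<open>b\<close> cancels the entry in row \<open>u b\<close>; the leading rows of the two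
      columns are then exchanged.\<close>
    define t where "t = - pcoef u b / (\<epsilon> * pcoef u a)"
    define y where "y k c = idm n k c + (if k = a \<and> c = b then t else 0)" for k c
    have y: "y \<in> Bor n"
    proof -
      have up: "y k c = 0" if "c < k" for k c using that ab by (auto simp: y_def idm_def)
      have "detm n y = (\<Prod>a=1..n. y a a)" using up by (intro detm_upper_triangular) auto
      also have "\<dots> = 1" using ab by (intro prod.neutral) (auto simp: y_def idm_def)
      finally show ?thesis using up abn by (auto simp: Bor_def SLn_def supp_mat_def) (auto simp: y_def idm_def)
    qed
    have Gy: "mmul n (G \<epsilon>) y r c = G \<epsilon> r c + (if c = b then t * G \<epsilon> r a else 0)"
      if rc: "r \<in> {1..n}" "c \<in> {1..n}" for r c
    proof -
      have "mmul n (G \<epsilon>) y r c = (\<Sum>k=1..n. (if k = c then G \<epsilon> r c else 0) + (if k = a then (if c = b then t * G \<epsilon> r a else 0) else 0))"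
        unfolding mmul_entry[OF rc] by (intro sum.cong refl) (auto simp: y_def idm_def algebra_simps)
      then show ?thesis using rc abn by (simp add: sum.distrib)
    qed
    have "leads n ?u (mmul n (G \<epsilon>) y)"
      unfolding leads_def
    proof (intro conjI ballI allI impI u')
      have ne: "u a \<noteq> u b" "a \<noteq> b" using ab by auto
      fix c assume c: "c \<in> {1..n}"
      then have uc: "u c \<in> {1..n}" using perm_in[OF u] by blast
      consider "c = a" | "c = b" | "c \<noteq> a" "c \<noteq> b" by blast
      note cases_c = this
      show "mmul n (G \<epsilon>) y (?u c) c \<noteq> 0"
        using cases_c
      proof cases
        case 1
        then show ?thesis using Gy[OF uabn(2) abn(1)] G_entry[OF uabn(2) abn(1)] ne \<epsilon> by simp
      next
        case 2
        then show ?thesis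
          using Gy[OF uabn(1) abn(2)] G_entry[OF uabn(1) abn(2)] G_entry[OF uabn(1) abn(1)] ne \<epsilon>
          by (simp add: t_def)
      next
        case 3
        then show ?thesis using Gy[OF uc c] G_entry[OF uc c] by simp
      qed
      fix r assume r: "?u c < r"
      show "mmul n (G \<epsilon>) y r c = 0"
      proof (cases "r \<in> {1..n}")
        case rn: True
        show ?thesis using cases_c
        proof cases
          case 1
          then show ?thesis using Gy[OF rn abn(1)] G_entry[OF rn abn(1)] r ne ab(4) by simp
        next
          case 2
          then have "u a < r" using r by simp
          moreover have "pcoef u b + t * (\<epsilon> * pcoef u a) = 0" using \<epsilon> by (simp add: t_def)
          ultimately show ?thesis
            using 2 Gy[OF rn abn(2)] G_entry[OF rn abn(2)] G_entry[OF rn abn(1)] ne by auto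
        next
          case 3
          then show ?thesis using Gy[OF rn c] G_entry[OF rn c] r by simp
        qed
      next
        case False
        then show ?thesis using supp_matD[OF supp_mmul] by blast
      qed
    qed
    then show ?thesis using bcell_iff_leads[OF u' n] G_SLn y by blast
  qed
  have "continuous_on UNIV G"
    unfolding G_def E_def
  proof (intro continuous_on_mmul continuous_on_const)
    show "continuous_on UNIV (\<lambda>\<epsilon> r s. idm n r s + (if r = u b \<and> s = u a then \<epsilon> else 0))"
    proof (rule continuous_on_matI)
      fix r s
      show "continuous_on UNIV (\<lambda>\<epsilon>. idm n r s + (if r = u b \<and> s = u a then \<epsilon> else 0))"
        by (cases "r = u b \<and> s = u a") (auto intro!: continuous_intros)
    qed
  qed
  then have "continuous_on (closure (- {0})) G" by (rule continuous_on_subset) simp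
  then have "G ` closure (- {0}) \<subseteq> closure (bcell n ?u)"
  proof (rule image_closure_subset)
    show "G ` (- {0}) \<subseteq> closure (bcell n ?u)"
      using G_cell closure_subset[of "bcell n ?u"] by blast
  qed simp
  moreover have "(0::complex) \<in> closure (- {0})"
    unfolding closure_approachable
  proof (intro allI impI)
    fix e :: real assume "0 < e"
    then show "\<exists>y\<in>- {0}. dist y (0::complex) < e"
      by (intro bexI[of _ "of_real (e / 2)"]) (auto simp: norm_mult)
  qed
  moreover have "G 0 = pmat n u"
  proof -
    have "E 0 = idm n" by (intro ext) (simp add: E_def)
    then show ?thesis by (simp add: G_def)
  qed
  ultimately have in_cl: "pmat n u \<in> closure (bcell n ?u)" by (metis imageI subsetD)
  show ?thesis
  proof
    fix x assume "x \<in> bcell n u"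
    then obtain b y where b: "b \<in> Bor n" "y \<in> Bor n" "x = mmul n (mmul n b (pmat n u)) y"
      by (auto simp: dcell_def)
    show "x \<in> closure (bcell n ?u)"
      unfolding b(3) using bcell_mult b(1,2) in_cl by (intro closure_mult_closed) auto
  qed
qed

text \<open>Climbs the Bruhat order by the exchanges of \<open>bruhat_le_step\<close>. Each puts the
  larger value first and so lowers the sum of \<open>c * u c\<close>, whence the climb ends, and it
  can end only at \<open>w\<close>.\<close>

lemma bcell_subset_closure:
  assumes n: "1 \<le> n" and w: "w permutes {1..n}" and u: "u permutes {1..n}" and le: "bruhat_le n u w"
  shows "bcell n u \<subseteq> closure (bcell n w)"
  using u le
proof (induction "\<Sum>c=1..n. c * u c" arbitrary: u rule: less_induct)
  case less
  show ?case
  proof (cases "u = w")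
    case True
    then show ?thesis using closure_subset by blast
  next
    case False
    obtain a b where ab: "1 \<le> a" "a < b" "b \<le> n" "u a < u b"
      and le': "bruhat_le n (u \<circ> Transposition.transpose a b) w"
      using bruhat_le_step[OF less.prems(1) w less.prems(2) False] by blast
    let ?u = "u \<circ> Transposition.transpose a b"
    have u': "?u permutes {1..n}"
      using ab by (intro permutes_compose[OF permutes_swap_id less.prems(1)]) auto
    have split: "(\<Sum>c = 1..n. g c) = (\<Sum>c \<in> {1..n} - {a, b}. g c) + (g a + g b)" for g :: "nat \<Rightarrow> nat"
      using sum.subset_diff[of "{a, b}" "{1..n}" g] ab by simp
    have "(\<Sum>c \<in> {1..n} - {a, b}. c * ?u c) = (\<Sum>c \<in> {1..n} - {a, b}. c * u c)"
      by (intro sum.cong) (auto simp: Transposition.transpose_def)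
    moreover have "a * ?u a + b * ?u b < a * u a + b * u b"
    proof -
      obtain k where k: "b = a + k" "0 < k" using ab(2) less_imp_add_positive by blast
      then show ?thesis using ab(4) by (simp add: algebra_simps)
    qed
    ultimately have "(\<Sum>c = 1..n. c * ?u c) < (\<Sum>c = 1..n. c * u c)"
      unfolding split[of "\<lambda>c. c * u c"] split[of "\<lambda>c. c * ?u c"] by linarith
    then have "bcell n ?u \<subseteq> closure (bcell n w)" using less.hyps u' le' by blast
    then have "closure (bcell n ?u) \<subseteq> closure (bcell n w)" by (rule closure_minimal) simp
    then show ?thesis using bcell_subset_closure_step[OF n less.prems(1) ab] by blast
  qed
qed

lemma closure_bcell_iff:
  assumes n: "1 \<le> n" and w: "w permutes {1..n}" and g: "g \<in> SLn n"
    and y: "y \<in> Bor n" and l: "leads n u (mmul n g y)"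
  shows "g \<in> closure (bcell n w) \<longleftrightarrow> bruhat_le n u w"
proof
  assume le: "bruhat_le n u w"
  have u: "u permutes {1..n}" using l by (simp add: leads_def)
  then have "g \<in> bcell n u" using bcell_iff_leads[OF u n] g y l by blast
  then show "g \<in> closure (bcell n w)" using bcell_subset_closure[OF n w u le] by blast
qed (rule closure_bcell_imp_bruhat_le[OF n w g _ y l])

section \<open>Cosets, the quotient topology and Schubert varieties in G/B\<close>

lemma coset_self: "g \<in> SLn n \<Longrightarrow> g \<in> coset n g"
  unfolding coset_def using idm_Bor SLn_supp mmul_idm(2) by (metis (mono_tags, lifting) mem_Collect_eq)

lemma coset_SLn: "g \<in> SLn n \<Longrightarrow> h \<in> coset n g \<Longrightarrow> h \<in> SLn n"
  unfolding coset_def using SLn_mmul Bor_SLn by blast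

lemma coset_eq:
  assumes g: "g \<in> SLn n" and h: "h \<in> coset n g"
  shows "coset n h = coset n g"
proof -
  obtain b where b: "b \<in> Bor n" "h = mmul n g b" using h by (auto simp: coset_def)
  obtain z where z: "z \<in> Bor n" "mmul n b z = idm n" using Bor_inverse[OF b(1)] by blast
  have hz: "g = mmul n h z" unfolding b(2) mmul_assoc z(2) using SLn_supp[OF g] by simp
  show ?thesis
  proof (intro equalityI subsetI)
    fix x assume "x \<in> coset n h"
    then obtain y where "y \<in> Bor n" "x = mmul n h y" by (auto simp: coset_def)
    then show "x \<in> coset n g" unfolding coset_def b(2) mmul_assoc using Bor_mmul[OF b(1)] by blast
  next
    fix x assume "x \<in> coset n g"
    then obtain y where y: "y \<in> Bor n" "x = mmul n g y" by (auto simp: coset_def)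
    then have "x = mmul n h (mmul n z y)" by (simp only: mmul_assoc[symmetric] hz[symmetric])
    then show "x \<in> coset n h" unfolding coset_def using Bor_mmul[OF z(1) y(1)] by blast
  qed
qed

lemma coset_disjoint:
  assumes "C \<in> GB n" "x \<in> C"
  shows "x \<in> SLn n" "C = coset n x"
  using assms coset_SLn coset_eq unfolding GB_def by blast+

text \<open>\<open>GBtop\<close> can be unfolded only once its predicate is known to be a topology;
  closure under intersection rests on the disjointness of distinct cosets.\<close>

lemma openin_GBtop:
  "openin (GBtop n) U \<longleftrightarrow> U \<subseteq> GB n \<and> openin (top_of_set (SLn n)) (\<Union>U)"
proof -
  have "istopology (\<lambda>U. U \<subseteq> GB n \<and> openin (top_of_set (SLn n)) (\<Union>U))"
    unfolding istopology_def
  proof (intro conjI allI impI)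
    fix S T assume S: "S \<subseteq> GB n \<and> openin (top_of_set (SLn n)) (\<Union>S)"
      and T: "T \<subseteq> GB n \<and> openin (top_of_set (SLn n)) (\<Union>T)"
    have "\<Union>(S \<inter> T) = \<Union>S \<inter> \<Union>T"
    proof (intro equalityI subsetI)
      fix x assume "x \<in> \<Union>S \<inter> \<Union>T"
      then obtain C D where CD: "C \<in> S" "x \<in> C" "D \<in> T" "x \<in> D" by blast
      then have "C = D" using coset_disjoint(2)[of C n x] coset_disjoint(2)[of D n x] S T by blast
      then show "x \<in> \<Union>(S \<inter> T)" using CD by blast
    qed auto
    then show "S \<inter> T \<subseteq> GB n" "openin (top_of_set (SLn n)) (\<Union>(S \<inter> T))"
      using S T by (auto intro: openin_Int)
  next
    fix K assume K: "\<forall>k\<in>K. k \<subseteq> GB n \<and> openin (top_of_set (SLn n)) (\<Union>k)"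
    show "\<Union>K \<subseteq> GB n" using K by blast
    have "openin (top_of_set (SLn n)) (\<Union>(Union ` K))" using K by (intro openin_Union) auto
    moreover have "\<Union>(Union ` K) = \<Union>(\<Union>K)" by auto
    ultimately show "openin (top_of_set (SLn n)) (\<Union>(\<Union>K))" by simp
  qed
  then show ?thesis unfolding GBtop_def by (simp add: topology_inverse')
qed

text \<open>The closure of a right \<open>B\<close>-stable set is right \<open>B\<close>-stable
  within \<open>SLn n\<close>, so its complement there is an open union of cosets. Closures in G/B
  can therefore be computed in the group.\<close>

lemma coset_in_closure_of_iff:
  assumes S: "S \<subseteq> SLn n" and sat: "\<And>s y. s \<in> S \<Longrightarrow> y \<in> Bor n \<Longrightarrow> mmul n s y \<in> S" and g: "g \<in> SLn n"
  shows "coset n g \<in> GBtop n closure_of (coset n ` S) \<longleftrightarrow> g \<in> closure S"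
proof
  assume cl: "coset n g \<in> GBtop n closure_of (coset n ` S)"
  show "g \<in> closure S"
  proof (rule ccontr)
    assume ng: "g \<notin> closure S"
    define V where "V = SLn n - closure S"
    \<comment> \<open>Right multiplication by the inverse \<open>z\<close> is continuous and maps
      \<open>S\<close> into itself, so it carries the closure point \<open>h\<close> back to
      \<open>v\<close>.\<close>
    have sat_cl: "v \<in> closure S" if v: "v \<in> SLn n" and h: "h \<in> coset n v" "h \<in> closure S" for v h
    proof -
      obtain y where y: "y \<in> Bor n" "h = mmul n v y" using h(1) by (auto simp: coset_def)
      obtain z where z: "z \<in> Bor n" "mmul n y z = idm n" using Bor_inverse[OF y(1)] by blast
      have "mmul n (mmul n (idm n) s) z \<in> S" if "s \<in> S" for s
        using that sat z(1) S SLn_supp by (metis mmul_idm(1) subsetD)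
      then have "mmul n (mmul n (idm n) h) z \<in> closure S" using h(2) by (rule closure_mult_closed)
      moreover have "mmul n (mmul n (idm n) h) z = v"
        unfolding y(2) using SLn_supp[OF v] by (simp add: mmul_assoc z(2))
      ultimately show ?thesis by simp
    qed
    have UV: "\<Union>(coset n ` V) = V"
    proof (intro equalityI subsetI)
      fix x assume "x \<in> \<Union>(coset n ` V)"
      then obtain v where v: "v \<in> V" "x \<in> coset n v" by blast
      then have "x \<notin> closure S" using sat_cl unfolding V_def by blast
      then show "x \<in> V" using v coset_SLn unfolding V_def by blast
    next
      fix x assume "x \<in> V"
      then show "x \<in> \<Union>(coset n ` V)" using coset_self unfolding V_def by blast
    qed
    have "openin (top_of_set (SLn n)) V"
      unfolding V_def Diff_eq by (intro openin_open_Int open_Compl closed_closure)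
    then have "openin (GBtop n) (coset n ` V)"
      unfolding openin_GBtop UV by (auto simp: V_def GB_def)
    moreover have "coset n g \<in> coset n ` V" using g ng by (auto simp: V_def)
    ultimately have "\<exists>C\<in>coset n ` S. C \<in> coset n ` V"
      using cl[unfolded in_closure_of, THEN conjunct2, rule_format, OF conjI] by simp
    then obtain s where s: "s \<in> S" "coset n s \<in> coset n ` V" by auto
    then have "s \<in> \<Union>(coset n ` V)" using coset_self S by blast
    then show False unfolding UV using s(1) closure_subset by (auto simp: V_def)
  qed
next
  assume cl: "g \<in> closure S"
  show "coset n g \<in> GBtop n closure_of (coset n ` S)"
    unfolding in_closure_of
  proof (intro conjI allI impI; (elim conjE)?)
    have "\<Union>(GB n) = SLn n"
      using coset_self coset_SLn unfolding GB_def by blast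
    then have "openin (GBtop n) (GB n)" unfolding openin_GBtop by simp
    then show "coset n g \<in> topspace (GBtop n)"
      using openin_subset g unfolding GB_def by blast
    fix U assume U: "coset n g \<in> U" "openin (GBtop n) U"
    then obtain T where T: "open T" "\<Union>U = SLn n \<inter> T"
      unfolding openin_GBtop openin_open by blast
    have "g \<in> T" using U(1) coset_self[OF g] T(2) by blast
    then have "T \<inter> S \<noteq> {}" using cl open_Int_closure_eq_empty[OF T(1), of S] by blast
    then obtain s where s: "s \<in> S" "s \<in> T" by blast
    then obtain C where C: "C \<in> U" "s \<in> C" using T(2) S by blast
    then have "C = coset n s" using U(2) coset_disjoint(2) unfolding openin_GBtop by blast
    then show "\<exists>y. y \<in> coset n ` S \<and> y \<in> U" using C s by blast
  qed
qed

lemma bcell_SLn: "1 \<le> n \<Longrightarrow> u permutes {1..n} \<Longrightarrow> bcell n u \<subseteq> SLn n"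
  using bcell_iff_leads by blast

lemma bcell_mult_right: "1 \<le> n \<Longrightarrow> u permutes {1..n} \<Longrightarrow> s \<in> bcell n u \<Longrightarrow> y \<in> Bor n \<Longrightarrow> mmul n s y \<in> bcell n u"
  using bcell_mult[of s n u "idm n" y] bcell_SLn SLn_supp by (metis idm_Bor mmul_idm(1) subsetD)

lemma SchubU_iff:
  assumes n: "1 \<le> n" and w: "w permutes {1..n}" and g: "g \<in> SLn n"
    and y: "y \<in> Bor n" and l: "leads n u (mmul n g y)"
  shows "coset n g \<in> SchubU n w \<longleftrightarrow> bruhat_le n u w"
  unfolding SchubU_def
  using coset_in_closure_of_iff[OF bcell_SLn[OF n w] bcell_mult_right[OF n w] g]
    closure_bcell_iff[OF n w g y l] by simp

text \<open>As the opposite Borel subgroup is \<open>w0 B w0\<close>, the opposite cell of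
  \<open>u\<close> is the translate by \<open>w0\<close> of the ordinary cell of
  \<open>w0 u\<close>, and translations commute with closures.\<close>

lemma SchubL_iff:
  assumes n: "1 \<le> n" and u: "u permutes {1..n}" and g: "g \<in> SLn n"
    and gh: "g = mmul n (pmat n (w0 n)) h" and h: "h \<in> SLn n"
  shows "coset n g \<in> SchubL n u \<longleftrightarrow> h \<in> closure (bcell n (w0 n \<circ> u))"
proof -
  let ?P = "pmat n (w0 n)" and ?L = "dcell n (Borm n) u (Bor n)" and ?C = "bcell n (w0 n \<circ> u)"
  have P: "?P \<in> SLn n" using pmat_SLn[OF w0_permutes n] .
  have wu: "w0 n \<circ> u permutes {1..n}" using permutes_compose[OF u w0_permutes] .
  obtain Q where Q: "Q \<in> SLn n" "mmul n Q ?P = idm n" using SLn_inverse[OF P] by blast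
  have "leads n (w0 n \<circ> u) (mmul n ?P (pmat n u))"
    unfolding leads_def
  proof (intro conjI ballI allI impI wu)
    fix c assume c: "c \<in> {1..n}"
    then have uc: "u c \<in> {1..n}" "w0 n (u c) \<in> {1..n}" using perm_in[OF u] perm_in[OF w0_permutes] by blast+
    have "?P (w0 n (u c)) (u c) = pcoef (w0 n) (u c)" using uc by (simp add: pmat_def pcoef_def)
    then show "mmul n ?P (pmat n u) ((w0 n \<circ> u) c) c \<noteq> 0"
      using mmul_pmat[OF u uc(2) c, of ?P] by simp
    fix r assume r: "(w0 n \<circ> u) c < r"
    show "mmul n ?P (pmat n u) r c = 0"
    proof (cases "r \<in> {1..n}")
      case True
      have "?P r (u c) = 0" using r by (simp add: pmat_def)
      then show ?thesis using mmul_pmat[OF u True c, of ?P] by simp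
    next
      case False
      then show ?thesis using supp_matD[OF supp_mmul] by blast
    qed
  qed
  \<comment> \<open>The product of the lifts of \<open>w0\<close> and \<open>u\<close> agrees with
    the lift of \<open>w0 u\<close> only up to signs; \<open>b0\<close> absorbs the
    discrepancy.\<close>
  then obtain b0 where b0: "b0 \<in> Bor n" "mmul n ?P (pmat n u) = mmul n b0 (pmat n (w0 n \<circ> u))"
    using leads_Bor_decomp[OF SLn_mmul[OF P pmat_SLn[OF u n]] _ n] by blast
  obtain z0 where z0: "z0 \<in> Bor n" "mmul n z0 b0 = idm n" using Bor_inverse[OF b0(1)] by blast
  have pwu: "pmat n (w0 n \<circ> u) = mmul n z0 (mmul n ?P (pmat n u))"
    unfolding b0(2) mmul_assoc[symmetric] z0(2) by simp
  have LC: "?L = mmul n ?P ` ?C"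
  proof (intro equalityI subsetI)
    fix x assume "x \<in> ?L"
    then obtain b y where b: "b \<in> Bor n" "y \<in> Bor n" "x = mmul n (mmul n (mmul n (mmul n ?P b) ?P) (pmat n u)) y"
      unfolding dcell_def Borm_def by blast
    have "x = mmul n ?P (mmul n (mmul n b (mmul n ?P (pmat n u))) y)"
      unfolding b(3) by (simp only: mmul_assoc)
    also have "\<dots> = mmul n ?P (mmul n (mmul n (mmul n b b0) (pmat n (w0 n \<circ> u))) y)"
      unfolding b0(2) by (simp only: mmul_assoc)
    finally show "x \<in> mmul n ?P ` ?C"
      unfolding dcell_def using Bor_mmul[OF b(1) b0(1)] b(2) by blast
  next
    fix x assume "x \<in> mmul n ?P ` ?C"
    then obtain b y where b: "b \<in> Bor n" "y \<in> Bor n" "x = mmul n ?P (mmul n (mmul n b (pmat n (w0 n \<circ> u))) y)"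
      unfolding dcell_def by blast
    have "x = mmul n (mmul n (mmul n (mmul n ?P (mmul n b z0)) ?P) (pmat n u)) y"
      unfolding b(3) pwu by (simp only: mmul_assoc)
    then show "x \<in> ?L"
      unfolding dcell_def Borm_def using Bor_mmul[OF b(1) z0(1)] b(2) by blast
  qed
  have "?L \<subseteq> SLn n" unfolding LC using SLn_mmul[OF P] bcell_SLn[OF n wu] by blast
  moreover have "mmul n s y \<in> ?L" if "s \<in> ?L" "y \<in> Bor n" for s y
    using that bcell_mult_right[OF n wu] unfolding LC by (auto simp: mmul_assoc)
  ultimately have "coset n g \<in> SchubL n u \<longleftrightarrow> g \<in> closure ?L"
    unfolding SchubL_def using g by (rule coset_in_closure_of_iff)
  also have "\<dots> \<longleftrightarrow> h \<in> closure ?C"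
  proof
    assume cl: "g \<in> closure ?L"
    have "mmul n (mmul n Q s) (idm n) \<in> ?C" if "s \<in> ?L" for s
    proof -
      obtain c where c: "c \<in> ?C" "s = mmul n ?P c" using \<open>s \<in> ?L\<close>[unfolded LC] by (rule imageE)
      then have "supp_mat n c" using bcell_SLn[OF n wu] SLn_supp by blast
      then show ?thesis using c by (simp add: mmul_assoc[symmetric] Q(2))
    qed
    then have "mmul n (mmul n Q g) (idm n) \<in> closure ?C" using cl by (rule closure_mult_closed)
    then show "h \<in> closure ?C"
      unfolding gh using SLn_supp[OF h] by (simp add: mmul_assoc[symmetric] Q(2))
  next
    assume cl: "h \<in> closure ?C"
    have "mmul n (mmul n ?P s) (idm n) \<in> ?L" if "s \<in> ?C" for s
      using that unfolding LC by simp
    then have "mmul n (mmul n ?P h) (idm n) \<in> closure ?L" using cl by (rule closure_mult_closed)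
    then show "g \<in> closure ?L" unfolding gh by simp
  qed
  finally show ?thesis .
qed

lemma pmat_w0_factor:
  assumes n: "1 \<le> n" and g: "g \<in> SLn n"
  shows "\<exists>h\<in>SLn n. g = mmul n (pmat n (w0 n)) h"
proof -
  obtain Q where Q: "Q \<in> SLn n" "mmul n (pmat n (w0 n)) Q = idm n"
    using SLn_inverse[OF pmat_SLn[OF w0_permutes n]] by blast
  have "g = mmul n (pmat n (w0 n)) (mmul n Q g)"
    using SLn_supp[OF g] by (simp add: mmul_assoc[symmetric] Q(2))
  then show ?thesis using SLn_mmul[OF Q(1) g] by blast
qed

lemma SchubL_id:
  assumes n: "1 \<le> n" and g: "g \<in> SLn n"
  shows "coset n g \<in> SchubL n id"
proof -
  obtain h where h: "h \<in> SLn n" "g = mmul n (pmat n (w0 n)) h" using pmat_w0_factor[OF n g] by blast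
  obtain v y where y: "y \<in> Bor n" "leads n v (mmul n h y)" using Bruhat_decomposition[OF h(1)] by blast
  have v: "v permutes {1..n}" using y(2) by (simp add: leads_def)
  have "h \<in> closure (bcell n (w0 n))"
    using closure_bcell_iff[OF n w0_permutes h(1) y] bruhat_le_w0[OF v] by blast
  then show ?thesis using SchubL_iff[OF n permutes_id g h(2,1)] by simp
qed

definition meets :: "nat \<Rightarrow> nat \<Rightarrow> (nat \<Rightarrow> complex) set \<Rightarrow> bool" where
  "meets n i F \<longleftrightarrow> (\<exists>v\<in>F. v \<noteq> (\<lambda>_. 0) \<and> (\<forall>r\<in>{1..i}. v r = 0))"

text \<open>Translation by \<open>w0\<close> reverses the rows, so a rank condition on the last
  \<open>i\<close> coordinates of \<open>h\<close> becomes one on the first \<open>i\<close> of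
  \<open>g\<close>. The detour through Pluecker coordinates turns both into relations between the
  first \<open>i\<close> columns, where the row signs are harmless.\<close>

lemma SchubL_stra_iff:
  assumes n: "1 \<le> n" and g: "g \<in> SLn n" and i: "1 \<le> i" "i < n"
  shows "coset n g \<in> SchubL n (stra i) \<longleftrightarrow> meets n i (Fs n g i)"
proof -
  obtain h where h: "h \<in> SLn n" "g = mmul n (pmat n (w0 n)) h" using pmat_w0_factor[OF n g] by blast
  obtain v y where y: "y \<in> Bor n" "leads n v (mmul n h y)" using Bruhat_decomposition[OF h(1)] by blast
  have v: "v permutes {1..n}" using y(2) by (simp add: leads_def)
  have s: "stra i permutes {1..n}" using stra_permutes i by blast
  have in_n: "i \<le> n" using i by simp
  have "coset n g \<in> SchubL n (stra i) \<longleftrightarrow> bruhat_le n v (w0 n \<circ> stra i)"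
    unfolding SchubL_iff[OF n s g h(2,1)]
    by (rule closure_bcell_iff[OF n permutes_compose[OF s w0_permutes] h(1) y])
  also have "\<dots> \<longleftrightarrow> (\<exists>c\<in>{1..i}. v c \<le> n - i)"
    unfolding bruhat_le_w0_stra_iff[OF v i] by (rule cnt_pos_iff)
  also have "\<dots> \<longleftrightarrow> (\<exists>x\<in>Fs n h i. x \<noteq> (\<lambda>_. 0) \<and> (\<forall>r\<in>{n - i<..n}. x r = 0))"
    unfolding leads_Fs_zero_iff[OF SLn_mmul[OF h(1) Bor_SLn[OF y(1)]] y(2) in_n, symmetric]
      Fs_mmul_Bor[OF h(1) y(1) in_n] ..
  also have "\<dots> \<longleftrightarrow> plucker (\<lambda>a b. h b a) {n - i<..n} = 0"
    unfolding Fs_def using i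
    by (intro plucker_eq_0_iff_rowspan[symmetric] SLn_indep[OF h(1) in_n]) auto
  also have "\<dots> \<longleftrightarrow> (\<exists>d. (\<exists>a\<in>{1..i}. d a \<noteq> 0) \<and> (\<forall>b\<in>{n - i<..n}. (\<Sum>a=1..i. d a * h b a) = 0))"
    using plucker_eq_0_iff[of "{n - i<..n}" "\<lambda>a b. h b a"] i by simp
  also have "\<dots> \<longleftrightarrow> (\<exists>d. (\<exists>a\<in>{1..i}. d a \<noteq> 0) \<and> (\<forall>b\<in>{1..i}. (\<Sum>a=1..i. d a * g b a) = 0))"
  proof -
    have row: "(\<Sum>a=1..i. d a * g b a) = pcoef (w0 n) (w0 n b) * (\<Sum>a=1..i. d a * h (n + 1 - b) a)"
      if b: "b \<in> {1..n}" for d b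
    proof -
      have wb: "w0 n b = n + 1 - b" "n + 1 - b \<in> {1..n}" "w0 n (n + 1 - b) = b"
        using b w0_apply[of b n] w0_apply[of "n + 1 - b" n] by force+
      have "g b a = pcoef (w0 n) (w0 n b) * h (n + 1 - b) a" if a: "a \<in> {1..i}" for a
      proof -
        have an: "a \<in> {1..n}" using a i by simp
        have "g b a = (\<Sum>k=1..n. if k = n + 1 - b then pcoef (w0 n) (w0 n b) * h (n + 1 - b) a else 0)"
          unfolding h(2) mmul_entry[OF b an]
        proof (intro sum.cong refl)
          fix k assume k: "k \<in> {1..n}"
          show "pmat n (w0 n) b k * h k a = (if k = n + 1 - b then pcoef (w0 n) (w0 n b) * h (n + 1 - b) a else 0)"
            using k b wb w0_apply[OF k] by (auto simp: pmat_def pcoef_def)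
        qed
        then show ?thesis using wb(2) by simp
      qed
      then show ?thesis
        by (simp add: sum_distrib_left mult.left_commute)
    qed
    have "(\<forall>b\<in>{n - i<..n}. (\<Sum>a=1..i. d a * h b a) = 0) \<longleftrightarrow> (\<forall>b\<in>{1..i}. (\<Sum>a=1..i. d a * g b a) = 0)" for d
    proof
      assume *: "\<forall>b\<in>{n - i<..n}. (\<Sum>a=1..i. d a * h b a) = 0"
      show "\<forall>b\<in>{1..i}. (\<Sum>a=1..i. d a * g b a) = 0"
      proof
        fix b assume "b \<in> {1..i}"
        then have "b \<in> {1..n}" "n + 1 - b \<in> {n - i<..n}" using i by auto
        then show "(\<Sum>a=1..i. d a * g b a) = 0" using row * by simp
      qed
    next
      assume *: "\<forall>b\<in>{1..i}. (\<Sum>a=1..i. d a * g b a) = 0"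
      show "\<forall>b\<in>{n - i<..n}. (\<Sum>a=1..i. d a * h b a) = 0"
      proof
        fix b assume "b \<in> {n - i<..n}"
        then have b: "n + 1 - b \<in> {1..i}" "n + 1 - b \<in> {1..n}" "n + 1 - (n + 1 - b) = b" using i by auto
        have "pcoef (w0 n) (w0 n (n + 1 - b)) * (\<Sum>a=1..i. d a * h b a) = 0"
          using row[OF b(2), of d] b(3) * b(1) by metis
        then show "(\<Sum>a=1..i. d a * h b a) = 0" by simp
      qed
    qed
    then show ?thesis by simp
  qed
  also have "\<dots> \<longleftrightarrow> plucker (\<lambda>a b. g b a) {1..i} = 0"
    using plucker_eq_0_iff[of "{1..i}" "\<lambda>a b. g b a"] by simp
  also have "\<dots> \<longleftrightarrow> meets n i (Fs n g i)"
    unfolding Fs_def meets_def using i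
    by (intro plucker_eq_0_iff_rowspan SLn_indep[OF g in_n]) auto
  finally show ?thesis .
qed

section \<open>The incidence condition\<close>

text \<open>Coefficients run over all \<open>n\<close> columns, and membership in \<open>F q\<close>
  becomes a condition on their support; vectors from different steps of the flag can then be added
  coefficientwise.\<close>

definition comb :: "nat \<Rightarrow> (nat \<Rightarrow> nat \<Rightarrow> complex) \<Rightarrow> (nat \<Rightarrow> complex) \<Rightarrow> nat \<Rightarrow> complex" where
  "comb n g d = (\<lambda>r. if r \<in> {1..n} then \<Sum>c=1..n. d c * g r c else 0)"

lemma comb_in: "r \<in> {1..n} \<Longrightarrow> comb n g d r = (\<Sum>c=1..n. d c * g r c)"
  and comb_out: "r \<notin> {1..n} \<Longrightarrow> comb n g d r = 0"
  unfolding comb_def by (rule if_P, assumption, rule if_not_P, assumption)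

lemma comb_add: "comb n g (\<lambda>c. d c + e c) r = comb n g d r + comb n g e r"
  by (simp add: comb_def sum.distrib distrib_right)

lemma comb_uminus: "comb n g (\<lambda>c. - d c) r = - comb n g d r"
  by (simp add: comb_def sum_negf)

lemma comb_scale: "comb n g (\<lambda>c. x * d c) r = x * comb n g d r"
  by (simp add: comb_def sum_distrib_left mult.assoc)

lemma comb_truncate:
  assumes "r \<in> {1..n}" "q \<le> n" "\<And>c. d c \<noteq> 0 \<Longrightarrow> c \<in> {1..q}"
  shows "comb n g d r = (\<Sum>c=1..q. d c * g r c)"
proof -
  have "(\<Sum>c=1..n. d c * g r c) = (\<Sum>c=1..q. d c * g r c)"
  proof (rule sum.mono_neutral_right)
    show "\<forall>c\<in>{1..n} - {1..q}. d c * g r c = 0"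
    proof
      fix c assume "c \<in> {1..n} - {1..q}"
      then have "d c = 0" using assms(3)[of c] by (metis DiffD2)
      then show "d c * g r c = 0" by simp
    qed
  qed (use assms(2) in auto)
  then show ?thesis using comb_in[OF assms(1)] by simp
qed

lemma comb_unit:
  assumes "r \<in> {1..n}" "c0 \<in> {1..n}"
  shows "comb n g (\<lambda>c. if c = c0 then 1 else 0) r = g r c0"
proof -
  have "comb n g (\<lambda>c. if c = c0 then 1 else 0) r = (\<Sum>c=1..n. if c = c0 then g r c0 else 0)"
    unfolding comb_in[OF assms(1)] by (intro sum.cong) auto
  then show ?thesis using assms(2) by simp
qed

lemma Fs_iff_comb:
  assumes "q \<le> n"
  shows "v \<in> Fs n g q \<longleftrightarrow> (\<exists>d. (\<forall>c. d c \<noteq> 0 \<longrightarrow> c \<in> {1..q}) \<and> v = comb n g d)"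
proof
  assume "v \<in> Fs n g q"
  then obtain d where d: "\<And>r. r \<in> {1..n} \<Longrightarrow> v r = (\<Sum>a=1..q. d a * g r a)" "\<And>r. r \<notin> {1..n} \<Longrightarrow> v r = 0"
    unfolding Fs_def by (rule rowspanE) (rule that)
  let ?d = "\<lambda>c. if c \<in> {1..q} then d c else 0"
  have "v r = comb n g ?d r" for r
  proof (cases "r \<in> {1..n}")
    case True
    have "comb n g ?d r = (\<Sum>a=1..q. ?d a * g r a)"
      using True assms by (rule comb_truncate) (metis (mono_tags, lifting))
    then show ?thesis using d(1)[OF True] by simp
  next
    case False
    then show ?thesis using d(2) comb_out by metis
  qed
  then show "\<exists>d. (\<forall>c. d c \<noteq> 0 \<longrightarrow> c \<in> {1..q}) \<and> v = comb n g d"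
    by (intro exI[of _ ?d]) auto
next
  assume "\<exists>d. (\<forall>c. d c \<noteq> 0 \<longrightarrow> c \<in> {1..q}) \<and> v = comb n g d"
  then obtain d where d: "\<And>c. d c \<noteq> 0 \<Longrightarrow> c \<in> {1..q}" "v = comb n g d" by blast
  show "v \<in> Fs n g q"
    unfolding Fs_def d(2) using comb_truncate[OF _ assms d(1)] comb_out by (intro rowspanI[where d = d]) auto
qed

lemma FsE:
  assumes "v \<in> Fs n g q" "q \<le> n"
  obtains d where "\<And>c. d c \<noteq> 0 \<Longrightarrow> c \<in> {1..q}" "v = comb n g d"
  using assms Fs_iff_comb by blast

lemma comb_eq_0:
  assumes "g \<in> SLn n" "comb n g d = (\<lambda>_. 0)" "c \<in> {1..n}"
  shows "d c = 0"
proof -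
  have "\<forall>r\<in>{1..n}. (\<Sum>c=1..n. d c * g r c) = 0"
    using assms(2) comb_in[of _ n g d] by metis
  then show ?thesis using SLn_columns_indep[OF assms(1)] assms(3) by blast
qed

lemma comb_leads_vanish:
  assumes l: "leads n u g" and z: "\<forall>r\<in>{p<..n}. comb n g d r = 0" and c: "c \<in> {1..n}" "d c \<noteq> 0"
  shows "u c \<le> p"
proof (rule ccontr)
  assume neg: "\<not> u c \<le> p"
  have sum0: "(\<Sum>c=1..n. d c * g r c) = 0" if "r \<in> {p<..n}" for r
    using z that comb_in[of r n g d] by auto
  have "d c = 0"
    using neg by (intro leads_vanish[OF l order_refl sum0 c(1)]) (simp_all add: not_le)
  then show False using c(2) by simp
qed

lemma comb_vanishes:
  assumes "\<And>c. c \<in> {1..n} \<Longrightarrow> d c \<noteq> 0 \<Longrightarrow> g r c = 0"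
  shows "comb n g d r = 0"
proof -
  have "d c * g r c = 0" if "c \<in> {1..n}" for c using assms[OF that] by (cases "d c = 0") auto
  then show ?thesis unfolding comb_def by (simp add: sum.neutral)
qed

text \<open>For \<open>m = n - c + (i - a)\<close> this says that the quadratic form of part (5) vanishes on the flag.\<close>

definition wedge_dep :: "nat \<Rightarrow> nat \<Rightarrow> nat \<Rightarrow> (nat \<Rightarrow> complex) set \<Rightarrow> (nat \<Rightarrow> complex) set \<Rightarrow> bool" where
  "wedge_dep n i m N A \<longleftrightarrow> (\<exists>\<nu>\<in>N. \<exists>x\<in>A. (\<nu> \<noteq> (\<lambda>_. 0) \<or> x \<noteq> (\<lambda>_. 0)) \<and>
     (\<forall>r\<in>{1..i}. \<nu> r + x r = 0) \<and> (\<forall>r\<in>{m<..n}. x r = 0))"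

text \<open>The rank condition of \<open>w\<close> gives \<open>i - a\<close> of the first
  \<open>i\<close> echelon columns in \<open>E m\<close>, \<open>m = n - c + (i - a)\<close>. If one
  of them belongs to \<open>F a\<close>, it and its negative are a solution. Otherwise they are the
  columns \<open>a<..i\<close>, and splitting the vector provided by \<open>meets\<close> at index
  \<open>a\<close> produces \<nu> and \<open>x\<close>.\<close>

lemma wedge_dep_of_Richardson:
  assumes n: "1 \<le> n" and S: "breaks n S" and w: "top_perm n S w" and ac: "consec S a c"
    and i: "a < i" "i < c" and g: "g \<in> SLn n" and U: "coset n g \<in> SchubU n w" and meet: "meets n i (Fs n g i)"
  shows "wedge_dep n i (n - c + (i - a)) (Fs n g a) (Fs n g c)"
proof -
  let ?m = "n - c + (i - a)"
  have cn: "c \<le> n" using S ac by (rule consec_le)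
  then have le_n: "a \<le> n" "i \<le> n" using i by auto
  have wp: "w permutes {1..n}" using w by (simp add: top_perm_def)
  obtain u y where y: "y \<in> Bor n" "leads n u (mmul n g y)" using Bruhat_decomposition[OF g] by blast
  define f where "f = mmul n g y"
  have f: "f \<in> SLn n" "leads n u f" unfolding f_def using SLn_mmul[OF g Bor_SLn[OF y(1)]] y(2) by auto
  have Ff: "Fs n g q = Fs n f q" if "q \<le> n" for q
    unfolding f_def using Fs_mmul_Bor[OF g y(1) that] by simp
  have "bruhat_le n u w" using SchubU_iff[OF n wp g y] U by simp
  then have "cnt w ?m i \<le> cnt u ?m i" using le_n i cn unfolding bruhat_le_def by auto
  moreover have "i - a \<le> cnt w ?m i"
  proof -
    have "w b \<le> ?m" if "a < b" "b \<le> i" for b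
    proof -
      have "w b + a + c = n + b" using w ac i that by (auto simp: top_perm_def)
      then show ?thesis using that by simp
    qed
    then have "{a<..i} \<subseteq> {b \<in> {1..i}. w b \<le> ?m}" by auto
    then have "card {a<..i} \<le> cnt w ?m i" unfolding cnt_def by (intro card_mono) auto
    then show ?thesis by simp
  qed
  ultimately have k: "i - a \<le> cnt u ?m i" by simp
  show ?thesis
  proof (cases "\<exists>c0\<in>{1..a}. u c0 \<le> ?m")
    case True
    then obtain c0 where c0: "c0 \<in> {1..a}" "u c0 \<le> ?m" by blast
    then have c0n: "c0 \<in> {1..n}" using le_n by auto
    let ?d = "\<lambda>c. if c = c0 then 1 else (0::complex)"
    have "comb n f ?d \<in> Fs n g c" "comb n f (\<lambda>c. - ?d c) \<in> Fs n g a"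
      unfolding Ff[OF cn] Ff[OF le_n(1)] Fs_iff_comb[OF cn] Fs_iff_comb[OF le_n(1)] using c0 i
      by (intro exI[of _ ?d] exI[of _ "\<lambda>c. - ?d c"]; auto)+
    moreover have "comb n f ?d \<noteq> (\<lambda>_. 0)" using comb_eq_0[OF f(1) _ c0n, of ?d] by auto
    moreover have "comb n f ?d r = 0" if "r \<in> {?m<..n}" for r
      using f(2) c0 c0n that by (intro comb_vanishes) (auto simp: leads_def split: if_splits)
    ultimately show ?thesis
      unfolding wedge_dep_def by (intro bexI[of _ "comb n f (\<lambda>c. - ?d c)"] bexI[of _ "comb n f ?d"]) (auto simp: comb_uminus)
  next
    case False
    \<comment> \<open>No index up to \<open>a\<close> qualifies, so the \<open>i - a\<close>
      required indices must fill \<open>a<..i\<close>.\<close>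
    have all: "u b \<le> ?m" if b: "b \<in> {a<..i}" for b
    proof (rule ccontr)
      assume "\<not> u b \<le> ?m"
      then have "{b \<in> {1..i}. u b \<le> ?m} \<subseteq> {a<..i} - {b}" using False by force
      then have "cnt u ?m i \<le> card ({a<..i} - {b})" unfolding cnt_def by (intro card_mono) auto
      also have "\<dots> < card {a<..i}" using b by (intro card_Diff1_less) auto
      finally show False using k by simp
    qed
    obtain v where v: "v \<in> Fs n f i" "v \<noteq> (\<lambda>_. 0)" "\<forall>r\<in>{1..i}. v r = 0"
      using meet unfolding meets_def Ff[OF le_n(2)] by blast
    obtain d where d: "\<And>c. d c \<noteq> 0 \<Longrightarrow> c \<in> {1..i}" "v = comb n f d" using v(1) le_n(2) by (rule FsE) (rule that)
    let ?d1 = "\<lambda>c. if c \<le> a then d c else 0" and ?d2 = "\<lambda>c. if c \<le> a then 0 else d c"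
    have sum: "v r = comb n f ?d1 r + comb n f ?d2 r" for r
    proof -
      have "(\<lambda>c. ?d1 c + ?d2 c) = d" by auto
      then show ?thesis unfolding d(2) comb_add[symmetric] by simp
    qed
    have "comb n f ?d1 \<in> Fs n g a"
      unfolding Ff[OF le_n(1)] Fs_iff_comb[OF le_n(1)] using d(1) by (intro exI[of _ ?d1]) auto
    moreover have "comb n f ?d2 \<in> Fs n g c"
      unfolding Ff[OF cn] Fs_iff_comb[OF cn] using d(1) i by (intro exI[of _ ?d2]) fastforce
    moreover have "comb n f ?d1 \<noteq> (\<lambda>_. 0) \<or> comb n f ?d2 \<noteq> (\<lambda>_. 0)"
    proof (rule ccontr)
      assume "\<not> ?thesis"
      then have "v r = 0" for r unfolding sum by simp
      then show False using v(2) by blast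
    qed
    moreover have "comb n f ?d2 r = 0" if r: "r \<in> {?m<..n}" for r
    proof (rule comb_vanishes)
      fix c assume c: "c \<in> {1..n}" "?d2 c \<noteq> 0"
      then have "c \<in> {a<..i}" using d(1)[of c] by (auto split: if_splits)
      then show "f r c = 0" using f(2) c(1) r all by (force simp: leads_def)
    qed
    ultimately show ?thesis
      unfolding wedge_dep_def using v(3) sum
      by (intro bexI[of _ "comb n f ?d1"] bexI[of _ "comb n f ?d2"]) auto
  qed
qed

lemma underdetermined_system:
  "\<exists>\<gamma> :: nat \<Rightarrow> complex. (\<exists>c. \<gamma> c \<noteq> 0) \<and> (\<forall>c. \<gamma> c \<noteq> 0 \<longrightarrow> c \<in> {1..i + 1}) \<and>
     (\<forall>r\<in>{1..i}. (\<Sum>c=1..i + 1. \<gamma> c * g r c) = 0)"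
proof -
  have "detm (i + 1) (\<lambda>c r. if r \<le> i then g r c else 0) = 0"
    by (rule detm_zero_col[of "i + 1"]) auto
  then obtain d where d: "\<exists>c\<in>{1..i + 1}. d c \<noteq> 0"
      "\<forall>r\<in>{1..i + 1}. (\<Sum>c=1..i + 1. d c * (if r \<le> i then g r c else 0)) = 0"
    unfolding detm_eq_0_iff by blast
  let ?\<gamma> = "\<lambda>c. if c \<in> {1..i + 1} then d c else 0"
  have "(\<Sum>c=1..i + 1. ?\<gamma> c * g r c) = 0" if r: "r \<in> {1..i}" for r
  proof -
    have "(\<Sum>c=1..i + 1. ?\<gamma> c * g r c) = (\<Sum>c=1..i + 1. d c * (if r \<le> i then g r c else 0))"
      using r by (intro sum.cong) auto
    moreover have "r \<in> {1..i + 1}" using r by simp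
    ultimately show ?thesis using d(2) by metis
  qed
  then show ?thesis using d(1) by (intro exI[of _ ?\<gamma>]) auto
qed

text \<open>The new \<open>i\<close>-th column is chosen inside the block \<open>a<..c\<close>, so that the partial flag does not
  change while the \<open>i\<close>-th step acquires the two required incidences.\<close>

lemma wedge_dep_adjust:
  assumes n: "1 \<le> n" and S: "breaks n S" and ac: "consec S a c" and i: "a < i" "i < c"
    and g: "g \<in> SLn n" and l: "leads n u g" and inc: "incr_on S u"
    and dep: "wedge_dep n i (n - c + (i - a)) (Fs n g a) (Fs n g c)"
  shows "\<exists>h\<in>SLn n. (\<forall>q\<in>S. Fs n h q = Fs n g q) \<and> meets n i (Fs n h i) \<and>
    (\<exists>D\<subseteq>{1..i}. i - a \<le> card D \<and> (\<forall>b\<in>D. \<forall>r\<in>{n - c + (i - a)<..n}. h r b = 0))"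
proof -
  let ?m = "n - c + (i - a)"
  have cn: "c \<le> n" using S ac by (rule consec_le)
  then have le_n: "a \<le> n" "i \<le> n" using i by auto
  have u: "u permutes {1..n}" using l by (simp add: leads_def)
  have mono: "strict_mono_on {a<..c} u" using inc ac by (simp add: incr_on_def)
  have S_ac: "q < i \<or> c \<le> q" "q \<le> n" if "q \<in> S" for q
    using that ac i S by (auto simp: consec_def breaks_def)
  have col0: "g r b = 0" if "b \<in> {1..n}" "u b \<le> ?m" "r \<in> {?m<..n}" for r b
    using l that by (auto simp: leads_def)
  let ?Q = "{b \<in> {1..c}. u b \<le> ?m}"
  have Q: "i - a \<le> card ?Q"
  proof -
    have "?m \<le> n" using i cn by simp
    then have "?m + c \<le> card ?Q + n" using cnt_ge[OF u cn] unfolding cnt_def by blast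
    then show ?thesis using cn by linarith
  qed
  have Q_le: "b < c1" if b: "b \<in> ?Q" and c1: "c1 \<in> {a<..c}" "\<not> u c1 \<le> ?m" for b c1
  proof (rule ccontr)
    assume "\<not> b < c1"
    then have "u c1 \<le> u b"
      using mono b c1(1) by (cases "b = c1") (auto simp: strict_mono_on_def intro!: less_imp_le)
    then show False using b c1(2) by simp
  qed
  show ?thesis
  \<comment> \<open>If \<open>F a\<close> meets \<open>E m\<close>, the first \<open>i - 1\<close>
    columns already contain \<open>i - a\<close> vectors of \<open>E m\<close>, and column
    \<open>i\<close> is free for the incidence with the first \<open>i\<close> coordinates.\<close>
  proof (cases "\<exists>c0\<in>{1..a}. u c0 \<le> ?m")
    case True
    then obtain c0 where c0: "c0 \<in> {1..a}" "u c0 \<le> ?m" by blast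
    let ?D = "{b \<in> {1..<i}. u b \<le> ?m}"
    have card: "i - a \<le> card ?D"
    \<comment> \<open>Either \<open>c0\<close> makes up for the missing index \<open>i\<close>, or a
      failure before \<open>i\<close> forces, by monotonicity in the block, all of \<open>?Q\<close>
      to lie before \<open>i\<close>.\<close>
    proof (cases "\<forall>b\<in>{a<..<i}. u b \<le> ?m")
      case True
      then have "insert c0 {a<..<i} \<subseteq> ?D" using c0 i by auto
      then have "card (insert c0 {a<..<i}) \<le> card ?D" by (intro card_mono) auto
      then show ?thesis using c0 i by simp
    next
      case False
      then obtain c1 where c1: "c1 \<in> {a<..<i}" "\<not> u c1 \<le> ?m" by blast
      then have "?Q \<subseteq> ?D" using Q_le[of _ c1] i by fastforce
      then have "card ?Q \<le> card ?D" by (intro card_mono) auto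
      then show ?thesis using Q by simp
    qed
    obtain \<gamma> where \<gamma>: "\<exists>c. \<gamma> c \<noteq> 0" "\<And>c. \<gamma> c \<noteq> 0 \<Longrightarrow> c \<in> {1..i + 1}"
        "\<forall>r\<in>{1..i}. (\<Sum>c=1..i + 1. \<gamma> c * g r c) = 0"
      using underdetermined_system[of i g] by blast
    have i1: "i + 1 \<le> n" using i cn by simp
    let ?v = "comb n g \<gamma>"
    have v0: "?v \<noteq> (\<lambda>_. 0)"
    proof
      assume "?v = (\<lambda>_. 0)"
      then have "\<gamma> c = 0" if "c \<in> {1..n}" for c using comb_eq_0[OF g _ that] by blast
      then show False using \<gamma>(1,2) i1 by fastforce
    qed
    have vi: "\<forall>r\<in>{1..i}. ?v r = 0"
    proof
      fix r assume r: "r \<in> {1..i}"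
      then have "r \<in> {1..n}" using le_n by simp
      then show "?v r = 0" using comb_truncate[OF _ i1 \<gamma>(2), where r = r and g = g] \<gamma>(3) r by metis
    qed
    show ?thesis
    \<comment> \<open>The vector lies in \<open>F (i + 1)\<close>. If it involves column
      \<open>i + 1\<close>, it is exchanged into place \<open>i\<close>, and no other step of the
      flag changes.\<close>
    proof (cases "\<gamma> (i + 1) = 0")
      case True
      then have "c \<in> {1..i}" if "\<gamma> c \<noteq> 0" for c
        using \<gamma>(2)[OF that] that by (cases "c = i + 1") auto
      then have "?v \<in> Fs n g i" unfolding Fs_iff_comb[OF le_n(2)] by blast
      then have "meets n i (Fs n g i)" unfolding meets_def using v0 vi by blast
      moreover have "?D \<subseteq> {1..i}" by auto
      moreover have "\<forall>b\<in>?D. \<forall>r\<in>{?m<..n}. g r b = 0" using col0 le_n by auto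
      ultimately show ?thesis using g card by blast
    next
      case False
      obtain h \<kappa> where h: "h \<in> SLn n" "\<kappa> \<noteq> 0" "\<forall>b<i. \<forall>r. h r b = g r b"
          "\<forall>r\<in>{1..n}. h r i = \<kappa> * (\<Sum>b=1..i + 1. \<gamma> b * g r b)"
          "\<forall>q. q < i \<or> i + 1 \<le> q \<and> q \<le> n \<longrightarrow> Fs n h q = Fs n g q"
        using exchange_column[OF g _ _ order_refl i1, of i \<gamma>] False i by auto
      have hi: "h r i = \<kappa> * ?v r" if "r \<in> {1..n}" for r
        using h(4) comb_truncate[OF that i1 \<gamma>(2), where g = g] that by simp
      have "?v = comb n h (\<lambda>c. 1 / \<kappa> * (if c = i then 1 else 0))"
      proof
        fix r
        show "?v r = comb n h (\<lambda>c. 1 / \<kappa> * (if c = i then 1 else 0)) r"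
          unfolding comb_scale using comb_unit[of r n i h] hi[of r] comb_out[of r n] h(2) i le_n
          by (cases "r \<in> {1..n}") auto
      qed
      then have "?v \<in> Fs n h i"
        unfolding Fs_iff_comb[OF le_n(2)] using i
        by (intro exI[of _ "\<lambda>c. 1 / \<kappa> * (if c = i then 1 else 0)"]) (auto split: if_splits)
      then have "meets n i (Fs n h i)" unfolding meets_def using v0 vi by blast
      moreover have "?D \<subseteq> {1..i}" by auto
      moreover have "\<forall>b\<in>?D. \<forall>r\<in>{?m<..n}. h r b = 0" using col0 le_n h(3) by auto
      moreover have "\<forall>q\<in>S. Fs n h q = Fs n g q"
      proof
        fix q assume q: "q \<in> S"
        then have "q < i \<or> i + 1 \<le> q \<and> q \<le> n" using S_ac[OF q] i by auto
        then show "Fs n h q = Fs n g q" using h(5) by blast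
      qed
      ultimately show ?thesis using h(1) card by blast
    qed
  next
    case False
    \<comment> \<open>\<open>?Q\<close> has at least \<open>i - a\<close> indices, none of them up
      to \<open>a\<close>; by monotonicity they begin directly after \<open>a\<close>.\<close>
    have all: "u b \<le> ?m" if b: "b \<in> {a<..i}" for b
    proof (rule ccontr)
      assume nb: "\<not> u b \<le> ?m"
      have "?Q \<subseteq> {a<..<b}"
      proof
        fix x assume x: "x \<in> ?Q"
        then have "\<not> x \<le> a" using False by auto
        then show "x \<in> {a<..<b}" using Q_le[OF x _ nb] b i by auto
      qed
      then have "card ?Q \<le> card {a<..<b}" by (intro card_mono) auto
      then show False using Q b by auto
    qed
    let ?D = "{a<..i}"
    obtain \<nu> x where \<nu>x: "\<nu> \<in> Fs n g a" "x \<in> Fs n g c" "\<nu> \<noteq> (\<lambda>_. 0) \<or> x \<noteq> (\<lambda>_. 0)"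
        "\<forall>r\<in>{1..i}. \<nu> r + x r = 0" "\<forall>r\<in>{?m<..n}. x r = 0"
      using dep unfolding wedge_dep_def by blast
    obtain \<alpha> where \<alpha>: "\<And>c. \<alpha> c \<noteq> 0 \<Longrightarrow> c \<in> {1..a}" "\<nu> = comb n g \<alpha>" using \<nu>x(1) le_n(1) by (rule FsE) (rule that)
    obtain \<beta> where \<beta>: "\<And>b. \<beta> b \<noteq> 0 \<Longrightarrow> b \<in> {1..c}" "x = comb n g \<beta>" using \<nu>x(2) cn by (rule FsE) (rule that)
    have \<beta>u: "u b \<le> ?m" if "\<beta> b \<noteq> 0" for b
      using \<nu>x(5) \<beta>(1)[OF that] cn that unfolding \<beta>(2) by (intro comb_leads_vanish[OF l]) auto
    \<comment> \<open>Hence \<nu> uses columns up to \<open>a\<close> and \<open>x\<close> only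
      later ones, so the two cannot cancel.\<close>
    have \<beta>a: "\<beta> b = 0" if "b \<le> a" for b
      using \<beta>u[of b] \<beta>(1)[of b] False that by auto
    let ?v = "\<lambda>r. \<nu> r + x r"
    have v: "?v = comb n g (\<lambda>b. \<alpha> b + \<beta> b)" unfolding \<alpha>(2) \<beta>(2) by (rule ext) (rule comb_add[symmetric])
    have v0: "?v \<noteq> (\<lambda>_. 0)"
    proof
      assume "?v = (\<lambda>_. 0)"
      then have sum0: "\<alpha> b + \<beta> b = 0" if "b \<in> {1..n}" for b
        using comb_eq_0[OF g _ that, of "\<lambda>b. \<alpha> b + \<beta> b"] v by simp
      have "\<alpha> b = 0 \<and> \<beta> b = 0" for b
      proof (cases "b \<le> a")
        case True
        then have "\<beta> b = 0" by (rule \<beta>a)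
        moreover have "\<alpha> b = 0"
        proof (rule ccontr)
          assume nz: "\<alpha> b \<noteq> 0"
          then have "b \<in> {1..n}" using \<alpha>(1) le_n by fastforce
          then show False using sum0[of b] \<open>\<beta> b = 0\<close> nz by simp
        qed
        ultimately show ?thesis by simp
      next
        case False
        then have "\<alpha> b = 0" using \<alpha>(1)[of b] by auto
        moreover have "\<beta> b = 0"
        proof (rule ccontr)
          assume nz: "\<beta> b \<noteq> 0"
          then have "b \<in> {1..n}" using \<beta>(1) cn by fastforce
          then show False using sum0[of b] \<open>\<alpha> b = 0\<close> nz by simp
        qed
        ultimately show ?thesis by simp
      qed
      then have "comb n g \<alpha> r = 0" "comb n g \<beta> r = 0" for r by (auto intro!: comb_vanishes)
      then show False using \<nu>x(3) unfolding \<alpha>(2) \<beta>(2) by blast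
    qed
    show ?thesis
    proof (cases "\<forall>b>i. \<beta> b = 0")
      case True
      have supp: "b \<in> {1..i}" if "\<alpha> b + \<beta> b \<noteq> 0" for b
      proof -
        have "\<alpha> b \<noteq> 0 \<or> \<beta> b \<noteq> 0" using that by auto
        then show ?thesis
        proof
          assume "\<alpha> b \<noteq> 0"
          then show ?thesis using \<alpha>(1)[of b] i by auto
        next
          assume "\<beta> b \<noteq> 0"
          then show ?thesis using \<beta>(1)[of b] True by (auto simp: not_less[symmetric])
        qed
      qed
      have "?v \<in> Fs n g i"
        unfolding Fs_iff_comb[OF le_n(2)]
        by (rule exI[of _ "\<lambda>b. \<alpha> b + \<beta> b"], intro conjI allI impI) (rule supp, assumption, rule v)
      then have "meets n i (Fs n g i)" unfolding meets_def using v0 \<nu>x(4) by blast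
      moreover have "?D \<subseteq> {1..i}" by auto
      moreover have "\<forall>b\<in>?D. \<forall>r\<in>{?m<..n}. g r b = 0" using col0 le_n all by auto
      moreover have "i - a \<le> card ?D" by simp
      ultimately show ?thesis using g by blast
    next
      case False
      \<comment> \<open>A column beyond \<open>i\<close> occurs in \<open>x\<close>. Exchanging it
        puts \<open>x\<close> into place \<open>i\<close>: the new \<open>F i\<close> contains
        \<open>F a\<close> and \<open>x\<close>, and the count is kept because \<open>x\<close> lies
        in \<open>E m\<close>.\<close>
      then obtain e where e: "i < e" "\<beta> e \<noteq> 0" by blast
      have ec: "e \<le> c" using \<beta>(1)[OF e(2)] by simp
      obtain h \<kappa> where h: "h \<in> SLn n" "\<kappa> \<noteq> 0" "\<forall>b<i. \<forall>r. h r b = g r b"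
          "\<forall>r\<in>{1..n}. h r i = \<kappa> * (\<Sum>b=1..c. \<beta> b * g r b)"
          "\<forall>q. q < i \<or> c \<le> q \<and> q \<le> n \<longrightarrow> Fs n h q = Fs n g q"
        using exchange_column[where \<beta> = \<beta>, OF g _ less_imp_le[OF e(1)] ec cn e(2)] i by auto
      have hi: "h r i = \<kappa> * x r" if "r \<in> {1..n}" for r
        using h(4) comb_truncate[OF that cn \<beta>(1), where g = g] that unfolding \<beta>(2) by simp
      have xh: "x r = comb n h (\<lambda>c. 1 / \<kappa> * (if c = i then 1 else 0)) r" for r
        unfolding comb_scale using comb_unit[of r n i h] hi[of r] comb_out[of r n] h(2) i le_n \<beta>(2)
        by (cases "r \<in> {1..n}") auto
      have "\<nu> \<in> Fs n h a" using \<nu>x(1) h(5) i by simp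
      then obtain \<alpha>' where \<alpha>': "\<And>c. \<alpha>' c \<noteq> 0 \<Longrightarrow> c \<in> {1..a}" "\<nu> = comb n h \<alpha>'"
        using le_n(1) by (rule FsE) (rule that)
      let ?e = "\<lambda>c. \<alpha>' c + 1 / \<kappa> * (if c = i then 1 else 0)"
      have "?v = comb n h ?e"
        unfolding \<alpha>'(2) xh by (rule ext) (rule comb_add[symmetric])
      moreover have "b \<in> {1..i}" if "?e b \<noteq> 0" for b
        using \<alpha>'(1)[of b] i that by (cases "b = i") auto
      ultimately have "?v \<in> Fs n h i"
        unfolding Fs_iff_comb[OF le_n(2)] by (intro exI[of _ ?e]) blast
      then have "meets n i (Fs n h i)" unfolding meets_def using v0 \<nu>x(4) by blast
      moreover have "?D \<subseteq> {1..i}" by auto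
      moreover have "h r b = 0" if b: "b \<in> ?D" and r: "r \<in> {?m<..n}" for b r
      proof (cases "b = i")
        case True
        then show ?thesis using hi[of r] \<nu>x(5) r by auto
      next
        case False
        then have "b < i" "b \<in> {1..n}" using b le_n by auto
        then show ?thesis using h(3) col0[OF _ all[OF b] r] by simp
      qed
      moreover have "\<forall>q\<in>S. Fs n h q = Fs n g q"
      proof
        fix q assume q: "q \<in> S"
        then show "Fs n h q = Fs n g q" using h(5) S_ac[OF q] by blast
      qed
      moreover have "i - a \<le> card ?D" by simp
      ultimately show ?thesis using h(1) by blast
    qed
  qed
qed

text \<open>Two sortings frame the modification: the first provides the increasing blocks for
  \<open>wedge_dep_adjust\<close>, the second treats \<open>i\<close> as a further break and so
  preserves the \<open>F i\<close> just built while restoring the hypotheses of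
  \<open>bruhat_le_top_perm_insert\<close>.\<close>

lemma wedge_dep_lift:
  assumes n: "1 \<le> n" and S: "breaks n S" and w: "top_perm n S w" and ac: "consec S a c"
    and i: "a < i" "i < c" and g: "g \<in> SLn n"
    and dep: "wedge_dep n i (n - c + (i - a)) (Fs n g a) (Fs n g c)"
  shows "\<exists>g'\<in>SLn n. coset n g' \<in> SchubU n w \<and> meets n i (Fs n g' i) \<and> (\<forall>q\<in>S. Fs n g' q = Fs n g q)"
proof -
  let ?m = "n - c + (i - a)"
  have cn: "c \<le> n" using S ac by (rule consec_le)
  have wp: "w permutes {1..n}" using w by (simp add: top_perm_def)
  have acS: "a \<in> S" "c \<in> S" using ac by (auto simp: consec_def)
  obtain u y where y: "y \<in> Bor n" "leads n u (mmul n g y)" using Bruhat_decomposition[OF g] by blast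
  obtain g1 u1 where g1: "g1 \<in> SLn n" "leads n u1 g1" "incr_on S u1"
      and same: "\<forall>q\<in>S. u1 ` {1..q} = u ` {1..q} \<and> Fs n g1 q = Fs n g q"
    using sort_flag[OF n S g y] by (elim bexE exE conjE) (rule that)
  then have g1S: "\<forall>q\<in>S. Fs n g1 q = Fs n g q" by simp
  have "wedge_dep n i ?m (Fs n g1 a) (Fs n g1 c)" using dep g1S acS by simp
  then obtain h D where h: "h \<in> SLn n" "\<forall>q\<in>S. Fs n h q = Fs n g1 q" "meets n i (Fs n h i)"
      and D: "D \<subseteq> {1..i}" "i - a \<le> card D" "\<forall>b\<in>D. \<forall>r\<in>{?m<..n}. h r b = 0"
    using wedge_dep_adjust[OF n S ac i g1(1-3)] by blast
  obtain u2 y2 where y2: "y2 \<in> Bor n" "leads n u2 (mmul n h y2)" using Bruhat_decomposition[OF h(1)] by blast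
  have u2: "u2 permutes {1..n}" using y2(2) by (simp add: leads_def)
  obtain z where z: "z \<in> Bor n" "mmul n y2 z = idm n" using Bor_inverse[OF y2(1)] by blast
  have hz: "h = mmul n (mmul n h y2) z" using SLn_supp[OF h(1)] by (simp add: mmul_assoc z(2))
  \<comment> \<open>Column \<open>b\<close> of \<open>h\<close> is a combination of the echelon
    columns with coefficient \<open>z b b \<noteq> 0\<close> at \<open>b\<close>; since it lies in
    \<open>E m\<close>, that echelon column must lead in a row at most \<open>m\<close>.\<close>
  have uD: "u2 b \<le> ?m" if b: "b \<in> D" for b
  proof -
    have bn: "b \<in> {1..n}" using b D(1) i cn by fastforce
    have "comb n (mmul n h y2) (\<lambda>k. z k b) r = h r b" if r: "r \<in> {1..n}" for r
    proof -
      have "h r b = mmul n (mmul n h y2) z r b" using hz by simp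
      also have "\<dots> = (\<Sum>k=1..n. mmul n h y2 r k * z k b)" by (rule mmul_entry[OF r bn])
      finally show ?thesis unfolding comb_in[OF r] by (simp add: mult.commute)
    qed
    then have "\<forall>r\<in>{?m<..n}. comb n (mmul n h y2) (\<lambda>k. z k b) r = 0" using D(3) b by auto
    then show ?thesis using bn Bor_diag[OF z(1) bn] by (intro comb_leads_vanish[OF y2(2)])
  qed
  have S': "breaks n (insert i S)" using S i cn by (auto simp: breaks_def)
  obtain g' v where g': "g' \<in> SLn n" "leads n v g'" "incr_on (insert i S) v"
      "\<forall>q\<in>insert i S. v ` {1..q} = u2 ` {1..q} \<and> Fs n g' q = Fs n h q"
    using sort_flag[OF n S' h(1) y2] by (elim bexE exE conjE) (rule that)
  have v: "v permutes {1..n}" using g'(2) by (simp add: leads_def)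
  have "card D \<le> cnt u2 ?m i"
    unfolding cnt_def using D(1) uD by (intro card_mono) auto
  also have "cnt u2 ?m i = cnt v ?m i" using g'(4) by (intro cnt_image_cong[OF u2 v]) simp
  finally have "i - a \<le> cnt v ?m i" using D(2) by simp
  then have "bruhat_le n v w"
    using bruhat_le_top_perm_insert[OF S w v ac i g'(3)] by simp
  moreover have "mmul n g' (idm n) = g'" using SLn_supp[OF g'(1)] by simp
  ultimately have "coset n g' \<in> SchubU n w"
    using SchubU_iff[OF n wp g'(1) idm_Bor, of v] g'(2) by simp
  moreover have "meets n i (Fs n g' i)" using h(3) g'(4) by simp
  moreover have "\<forall>q\<in>S. Fs n g' q = Fs n g q" using g'(4) h(2) g1S by simp
  ultimately show ?thesis using g'(1) by blast
qed

section \<open>Passage to partial flags and Pluecker equations\<close>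

lemma indep_rowsD:
  assumes "indep_rows n q M" "\<forall>b\<in>{1..n}. (\<Sum>a=1..q. d a * M a b) = 0"
  shows "\<forall>a\<in>{1..q}. d a = 0"
  using assms(2) by (rule assms(1)[unfolded indep_rows_def, THEN spec, THEN mp])

text \<open>Common frame of all cases. \<open>C\<close> is a criterion on a complete lift, tied by
  \<open>crit\<close> to the equation on the partial flag; \<open>bwd\<close> may replace the lift
  by another one over the same partial flag, which is how points of the projection are
  found.\<close>

lemma piP_eq_cutout:
  assumes bound: "\<And>q. q \<in> set ns \<Longrightarrow> q \<le> last ns" and ns: "last ns < n"
    and crit: "\<And>M g. fullrank n (last ns) M \<Longrightarrow> g \<in> SLn n \<Longrightarrow>
      \<forall>q\<in>set ns. Fs n g q = rowspan n q M \<Longrightarrow> E M = 0 \<longleftrightarrow> C g"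
    and fwd: "\<And>g. g \<in> SLn n \<Longrightarrow> coset n g \<in> Y \<Longrightarrow> C g"
    and bwd: "\<And>g. g \<in> SLn n \<Longrightarrow> C g \<Longrightarrow> \<exists>g'\<in>SLn n. coset n g' \<in> Y \<and> (\<forall>q\<in>set ns. Fs n g' q = Fs n g q)"
  shows "piP n ns Y = cutout n ns E"
proof (intro equalityI subsetI)
  let ?t = "\<lambda>(g :: nat \<Rightarrow> nat \<Rightarrow> complex) a b. if a \<in> {1..last ns} then g b a else 0"
  have trunc: "rowspan n q (?t g) = Fs n g q" if "q \<in> set ns" for g q
    unfolding Fs_def using bound[OF that] by (intro rowspan_cong) auto
  have full: "fullrank n (last ns) (?t g)" if g: "g \<in> SLn n" for g
    unfolding fullrank_def
  proof (intro conjI allI impI)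
    fix a b assume ab: "a \<notin> {1..last ns} \<or> b \<notin> {1..n}"
    show "?t g a b = 0"
    proof (cases "b \<in> {1..n}")
      case True
      then have "a \<notin> {1..last ns}" using ab by simp
      then show ?thesis by (rule if_not_P)
    next
      case False
      then have "g b a = 0" using supp_matD[OF SLn_supp[OF g]] by blast
      then show ?thesis by simp
    qed
  next
    fix d assume d: "\<forall>b\<in>{1..n}. (\<Sum>a=1..last ns. d a * ?t g a b) = 0"
    have "(\<Sum>a=1..last ns. d a * ?t g a b) = (\<Sum>a=1..last ns. d a * g b a)" for b
      by (intro sum.cong) auto
    then have "\<forall>b\<in>{1..n}. (\<Sum>a=1..last ns. d a * g b a) = 0" using d by simp
    then show "\<forall>a\<in>{1..last ns}. d a = 0"
      by (rule indep_rowsD[OF SLn_indep[OF g less_imp_le[OF ns]]])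
  qed
  {
    fix F assume "F \<in> piP n ns Y"
    then obtain g where g: "g \<in> SLn n" "coset n g \<in> Y" "F = rowflag n ns (?t g)"
      unfolding piP_def by blast
    have "E (?t g) = 0"
      using crit[OF full[OF g(1)] g(1)] trunc fwd[OF g(1,2)] by simp
    then show "F \<in> cutout n ns E"
      unfolding cutout_def g(3) using full[OF g(1)] by blast
  }
  {
    fix F assume "F \<in> cutout n ns E"
    then obtain M where M: "fullrank n (last ns) M" "E M = 0" "F = rowflag n ns M"
      unfolding cutout_def by blast
    obtain g where g: "g \<in> SLn n" "\<forall>q\<le>last ns. Fs n g q = rowspan n q M"
      using extend_to_SLn[OF M(1) ns] by blast
    then have same: "\<forall>q\<in>set ns. Fs n g q = rowspan n q M" using bound by blast
    then have "C g" using crit[OF M(1) g(1)] M(2) by blast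
    then obtain g' where g': "g' \<in> SLn n" "coset n g' \<in> Y" "\<forall>q\<in>set ns. Fs n g' q = Fs n g q"
      using bwd[OF g(1)] by blast
    have "rowflag n ns M = rowflag n ns (?t g')"
      unfolding rowflag_def using same g'(3) trunc by simp
    then show "F \<in> piP n ns Y" unfolding piP_def M(3) using g'(1,2) by blast
  }
qed

lemma leads_SchubU_iff:
  assumes "1 \<le> n" "w permutes {1..n}" "g \<in> SLn n" "leads n u g"
  shows "coset n g \<in> SchubU n w \<longleftrightarrow> bruhat_le n u w"
  using SchubU_iff[OF assms(1,2,3) idm_Bor, of u] assms(4) SLn_supp[OF assms(3)] by simp

text \<open>Independence of the rows identifies nonzero coefficient families with nonzero vectors,
  which turns the relations of \<open>quadric_eq_0_iff\<close> into \<nu> and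
  \<open>x\<close>.\<close>

lemma quadric_eq_0_iff_wedge_dep:
  assumes i: "a < i" "i < c" and c: "c \<le> n" and M: "indep_rows n c M"
  shows "(\<Sum>J | J \<subseteq> {1..min i (n - c + (i - a))} \<and> card J = i - a.
      (-1) ^ (\<Sum>J) * plucker M ({1..i} - J) * plucker M (J \<union> {n - c + (i - a)<..n})) = 0 \<longleftrightarrow>
    wedge_dep n i (n - c + (i - a)) (rowspan n a M) (rowspan n c M)"
proof -
  let ?m = "n - c + (i - a)"
  let ?v = "\<lambda>q d b. if b \<in> {1..n} then \<Sum>r=1..q. d r * M r b else 0"
  have v_in: "?v q d \<in> rowspan n q M" for q d
    by (rule rowspanI[where d = d]) auto
  have v_nz: "?v q d \<noteq> (\<lambda>_. 0) \<longleftrightarrow> (\<exists>r\<in>{1..q}. d r \<noteq> 0)" if q: "q \<le> c" for q d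
  proof
    assume nz: "\<exists>r\<in>{1..q}. d r \<noteq> 0"
    show "?v q d \<noteq> (\<lambda>_. 0)"
    proof
      assume "?v q d = (\<lambda>_. 0)"
      then have "\<forall>b\<in>{1..n}. (\<Sum>r=1..q. d r * M r b) = 0" by (metis (mono_tags, lifting))
      then have "\<forall>r\<in>{1..q}. d r = 0"
        by (rule indep_rowsD[OF indep_rows_mono[OF M q]])
      then show False using nz by blast
    qed
  next
    assume nz: "?v q d \<noteq> (\<lambda>_. 0)"
    show "\<exists>r\<in>{1..q}. d r \<noteq> 0"
    proof (rule ccontr)
      assume "\<not> ?thesis"
      then have "?v q d = (\<lambda>_. 0)" by (intro ext) simp
      then show False using nz by simp
    qed
  qed
  have low: "b \<in> {1..n}" if "b \<in> {1..i}" for b using that i c by simp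
  have high: "b \<in> {1..n}" if "b \<in> {?m<..n}" for b using that by simp
  have "wedge_dep n i ?m (rowspan n a M) (rowspan n c M) \<longleftrightarrow>
    (\<exists>x y. (?v a x \<noteq> (\<lambda>_. 0) \<or> ?v c y \<noteq> (\<lambda>_. 0)) \<and> (\<forall>b\<in>{1..i}. ?v a x b + ?v c y b = 0) \<and> (\<forall>b\<in>{?m<..n}. ?v c y b = 0))"
    (is "_ \<longleftrightarrow> ?R")
  proof
    assume "wedge_dep n i ?m (rowspan n a M) (rowspan n c M)"
    then obtain \<nu> x where \<nu>x: "\<nu> \<in> rowspan n a M" "x \<in> rowspan n c M" "\<nu> \<noteq> (\<lambda>_. 0) \<or> x \<noteq> (\<lambda>_. 0)"
        "\<forall>r\<in>{1..i}. \<nu> r + x r = 0" "\<forall>r\<in>{?m<..n}. x r = 0" unfolding wedge_dep_def by blast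
    obtain d where d: "\<nu> = ?v a d" using \<nu>x(1) unfolding rowspan_def by blast
    obtain e where e: "x = ?v c e" using \<nu>x(2) unfolding rowspan_def by blast
    show ?R using \<nu>x(3-5) unfolding d e by blast
  next
    assume ?R
    then obtain x y where xy: "?v a x \<noteq> (\<lambda>_. 0) \<or> ?v c y \<noteq> (\<lambda>_. 0)"
        "\<forall>b\<in>{1..i}. ?v a x b + ?v c y b = 0" "\<forall>b\<in>{?m<..n}. ?v c y b = 0"
      by (elim exE conjE) (rule that)
    show "wedge_dep n i ?m (rowspan n a M) (rowspan n c M)"
      unfolding wedge_dep_def
      by (rule bexI[OF _ v_in[where q = a and d = x]], rule bexI[OF _ v_in[where q = c and d = y]], intro conjI xy)
  qed
  also have "?R \<longleftrightarrow> (\<exists>x y. ((\<exists>r\<in>{1..a}. x r \<noteq> 0) \<or> (\<exists>r\<in>{1..c}. y r \<noteq> 0)) \<and>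
       (\<forall>b\<in>{1..i}. (\<Sum>r=1..a. x r * M r b) + (\<Sum>r=1..c. y r * M r b) = 0) \<and>
       (\<forall>b\<in>{?m<..n}. (\<Sum>r=1..c. y r * M r b) = 0))"
    using v_nz[of a] v_nz[of c] i low high by simp
  finally show ?thesis
    using i c by (subst quadric_eq_0_iff[where s = a and c = c]) auto
qed

text \<open>The degenerate case \<open>a = 0\<close>: with \<nu> forced to be zero, the condition
  collapses to one incidence of \<open>F c\<close>.\<close>

lemma wedge_dep_zero_left:
  assumes "i \<le> m" "m \<le> n"
  shows "wedge_dep n i m {\<lambda>_. 0} A \<longleftrightarrow> (\<exists>v\<in>A. v \<noteq> (\<lambda>_. 0) \<and> (\<forall>r\<in>{1..i} \<union> {m<..n}. v r = 0))"
  unfolding wedge_dep_def by auto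

lemma Fs_0: "Fs n g 0 = {\<lambda>_. 0}"
proof -
  have "(\<lambda>b. if b \<in> {1..n} then \<Sum>a=1..0. c a * g b a else 0) = (\<lambda>_. 0)" for c
    by (intro ext) (auto intro!: sum.neutral)
  then show ?thesis unfolding Fs_def rowspan_def by (simp only: singleton_conv ex_simps simp_thms)
qed

lemma Fs_full:
  assumes g: "g \<in> SLn n" and v: "\<And>r. r \<notin> {1..n} \<Longrightarrow> v r = 0"
  shows "v \<in> Fs n g n"
proof -
  have "Fs n g n = rowspan n n (idm n)"
    unfolding Fs_def
  proof (rule rowspan_eq_of_generators[OF SLn_indep[OF g order_refl]])
    fix c
    have "g b c = (\<Sum>a=1..n. g a c * idm n a b)" if "b \<in> {1..n}" for b
    proof -
      have "(\<Sum>a=1..n. g a c * idm n a b) = (\<Sum>a=1..n. if a = b then g b c else 0)"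
        by (intro sum.cong) (auto simp: idm_def)
      then show ?thesis using that by simp
    qed
    then show "\<exists>d. \<forall>b\<in>{1..n}. g b c = (\<Sum>a=1..n. d a * idm n a b)"
      by (intro exI[of _ "\<lambda>a. g a c"] ballI)
  qed
  moreover have "v \<in> rowspan n n (idm n)"
  proof (rule rowspanI[where d = v])
    fix b assume b: "b \<in> {1..n}"
    have "(\<Sum>a=1..n. v a * idm n a b) = (\<Sum>a=1..n. if a = b then v b else 0)"
      by (intro sum.cong) (auto simp: idm_def)
    then show "v b = (\<Sum>a=1..n. v a * idm n a b)" using b by simp
  qed (rule v)
  ultimately show ?thesis by simp
qed

text \<open>The degenerate case \<open>c = n\<close>, where \<open>m = k\<close>: \<open>x\<close>
  ranges over the whole space, and the equations force it to be the negative of \<nu> on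
  \<open>{1..k}\<close> and zero elsewhere, so a condition on \<nu> alone remains.\<close>

lemma wedge_dep_full_right:
  assumes g: "g \<in> SLn n" and k: "k \<le> i" "i \<le> n" and N: "\<And>v r. v \<in> N \<Longrightarrow> r \<notin> {1..n} \<Longrightarrow> v r = 0"
  shows "wedge_dep n i k N (Fs n g n) \<longleftrightarrow> (\<exists>v\<in>N. v \<noteq> (\<lambda>_. 0) \<and> (\<forall>r\<in>{k<..i}. v r = 0))"
proof
  assume "wedge_dep n i k N (Fs n g n)"
  then obtain \<nu> x where \<nu>x: "\<nu> \<in> N" "x \<in> Fs n g n" "\<nu> \<noteq> (\<lambda>_. 0) \<or> x \<noteq> (\<lambda>_. 0)"
      "\<forall>r\<in>{1..i}. \<nu> r + x r = 0" "\<forall>r\<in>{k<..n}. x r = 0" unfolding wedge_dep_def by blast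
  have "\<nu> \<noteq> (\<lambda>_. 0)"
  proof
    assume \<nu>0: "\<nu> = (\<lambda>_. 0)"
    have "x r = 0" for r
    proof (cases "r \<in> {1..n}")
      case True
      show ?thesis
      proof (cases "r \<le> i")
        case True
        then have "\<nu> r + x r = 0" using \<open>r \<in> {1..n}\<close> \<nu>x(4) by simp
        then show ?thesis using \<nu>0 by simp
      next
        case False
        then show ?thesis using \<open>r \<in> {1..n}\<close> \<nu>x(5) k by simp
      qed
    next
      case False
      then show ?thesis using \<nu>x(2) unfolding Fs_def by (auto elim: rowspanE)
    qed
    then show False using \<nu>x(3) \<nu>0 by blast
  qed
  moreover have "\<nu> r = 0" if "r \<in> {k<..i}" for r
  proof -
    have "r \<in> {1..i}" "r \<in> {k<..n}" using that k by auto
    then have "\<nu> r + x r = 0" "x r = 0" using \<nu>x(4,5) by blast+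
    then show ?thesis by simp
  qed
  ultimately show "\<exists>v\<in>N. v \<noteq> (\<lambda>_. 0) \<and> (\<forall>r\<in>{k<..i}. v r = 0)" using \<nu>x(1) by blast
next
  assume "\<exists>v\<in>N. v \<noteq> (\<lambda>_. 0) \<and> (\<forall>r\<in>{k<..i}. v r = 0)"
  then obtain v where v: "v \<in> N" "v \<noteq> (\<lambda>_. 0)" "\<forall>r\<in>{k<..i}. v r = 0" by blast
  let ?x = "\<lambda>r. if r \<in> {1..k} then - v r else 0"
  have "?x \<in> Fs n g n" using g k by (intro Fs_full) auto
  then show "wedge_dep n i k N (Fs n g n)"
    unfolding wedge_dep_def using v by (intro bexI[of _ v] bexI[of _ ?x]) auto
qed

lemma sorted_nth_le_last:
  assumes "sorted_wrt (<) ns" "q \<in> set ns"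
  shows "q \<le> last (ns :: nat list)" "ns ! 0 \<le> q"
proof -
  obtain j where j: "j < length ns" "ns ! j = q" using assms(2) by (auto simp: in_set_conv_nth)
  have last: "last ns = ns ! (length ns - 1)" using j by (intro last_conv_nth) auto
  have "ns ! x \<le> ns ! y" if "x \<le> y" "y < length ns" for x y
    using sorted_wrt_nth_less[OF assms(1), of x y] that by (cases "x = y") auto
  then show "q \<le> last ns" "ns ! 0 \<le> q" using j unfolding last by auto
qed

lemma consec_ns:
  assumes ns: "ns \<noteq> []" "sorted_wrt (<) ns" "1 \<le> hd ns" "last ns < n"
  shows "consec ({0, n} \<union> set ns) 0 (ns ! 0)" "consec ({0, n} \<union> set ns) (last ns) n"
    "\<And>j. 1 \<le> j \<Longrightarrow> j < length ns \<Longrightarrow> consec ({0, n} \<union> set ns) (ns ! (j - 1)) (ns ! j)"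
proof -
  note bounds = sorted_nth_le_last[OF ns(2)]
  have "1 \<le> ns ! 0" using ns(1,3) by (simp add: hd_conv_nth)
  moreover have "ns ! 0 \<in> set ns" using ns(1) by simp
  ultimately show "consec ({0, n} \<union> set ns) 0 (ns ! 0)"
    unfolding consec_def using bounds ns(4) by fastforce
  have "last ns \<in> set ns" using ns(1) by simp
  then show "consec ({0, n} \<union> set ns) (last ns) n"
    unfolding consec_def using bounds ns(4) by auto
  fix j assume j: "1 \<le> j" "j < length ns"
  have mem: "ns ! (j - 1) \<in> set ns" "ns ! j \<in> set ns" using j by auto
  have between: "x \<le> ns ! (j - 1) \<or> ns ! j \<le> x" if "x \<in> set ns" for x
  proof -
    obtain t where t: "t < length ns" "ns ! t = x" using \<open>x \<in> set ns\<close> by (auto simp: in_set_conv_nth)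
    have mono: "ns ! x \<le> ns ! y" if "x \<le> y" "y < length ns" for x y
      using sorted_wrt_nth_less[OF ns(2), of x y] that by (cases "x = y") auto
    show ?thesis
    proof (cases "t \<le> j - 1")
      case True
      then show ?thesis using mono[of t "j - 1"] t j by auto
    next
      case False
      then show ?thesis using mono[of j t] t j by auto
    qed
  qed
  have "ns ! (j - 1) < ns ! j" using sorted_wrt_nth_less[OF ns(2), of "j - 1" j] j by simp
  moreover have "ns ! j \<le> n" using bounds(1)[OF mem(2)] ns(4) by simp
  ultimately show "consec ({0, n} \<union> set ns) (ns ! (j - 1)) (ns ! j)"
    unfolding consec_def using mem between by auto
qed

theorem theorem4p1:
  fixes n :: nat and ns :: "nat list" and i :: nat
  assumes "ns \<noteq> []" and "sorted_wrt (<) ns" and "1 \<le> hd ns" and "last ns < n"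
    and "1 \<le> i" and "i < n"
  shows
   "(i \<in> set ns \<longrightarrow>
       piP n ns (Richardson n id (w0 n \<circ> stra i \<circ> wP n ns))
         = cutout n ns (\<lambda>M. plucker M {n - i<..n}))
  \<and> (i \<in> set ns \<longrightarrow>
       piP n ns (Richardson n (stra i) (w0 n \<circ> wP n ns))
         = cutout n ns (\<lambda>M. plucker M {1..i}))
  \<and> (i < ns ! 0 \<longrightarrow>
       piP n ns (Richardson n (stra i) (w0 n \<circ> wP n ns))
         = cutout n ns (\<lambda>M. plucker M ({1..i} \<union> {n - ns ! 0 + i<..n})))
  \<and> (i > last ns \<longrightarrow>
       piP n ns (Richardson n (stra i) (w0 n \<circ> wP n ns))
         = cutout n ns (\<lambda>M. plucker M {i - last ns<..i}))
  \<and> (\<forall>j. 1 \<le> j \<and> j < length ns \<and> ns ! (j - 1) < i \<and> i < ns ! j \<longrightarrow>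
       (let k = i - ns ! (j - 1); l = min i (n - ns ! j + k) in
        piP n ns (Richardson n (stra i) (w0 n \<circ> wP n ns))
         = cutout n ns (\<lambda>M. \<Sum>J | J \<subseteq> {1..l} \<and> card J = k.
              (-1) ^ (\<Sum>J) * plucker M ({1..i} - J) * plucker M (J \<union> {n - ns ! j + k<..n}))))"
proof -
  define S where "S = {0, n} \<union> set ns"
  define w where "w = w0 n \<circ> wP n ns"
  have n1: "1 \<le> n" and i_n: "i \<le> n" using assms(5,6) by auto
  note bounds = sorted_nth_le_last[OF assms(2)]
  have sub: "set ns \<subseteq> {0..n}" using bounds assms(4) by fastforce
  then have S: "breaks n S" unfolding S_def breaks_def by auto
  have wP: "wP n ns = brev n S" unfolding S_def using wP_eq_brev[OF sub] .
  have w: "top_perm n S w" unfolding w_def wP by (rule top_perm_w0_brev[OF S])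
  then have wp: "w permutes {1..n}" by (simp add: top_perm_def)
  have nsS: "q \<in> S" if "q \<in> set ns" for q using that by (simp add: S_def)
  note consec = consec_ns[OF assms(1-4), folded S_def]
  note reduce = piP_eq_cutout[OF bounds(1) assms(4)]
  have ind: "indep_rows n q M" if "fullrank n (last ns) M" "q \<in> set ns" for q M
    using indep_rows_mono[OF fullrank_indep[OF that(1)] bounds(1)[OF that(2)]] .

  have part1: "piP n ns (Richardson n id (w0 n \<circ> stra i \<circ> wP n ns))
      = cutout n ns (\<lambda>M. plucker M {n - i<..n})" if i: "i \<in> set ns"
  proof (rule reduce[where C = "\<lambda>g. \<exists>v\<in>Fs n g i. v \<noteq> (\<lambda>_. 0) \<and> (\<forall>r\<in>{n - i<..n}. v r = 0)"])
    fix M g assume M: "fullrank n (last ns) M" "\<forall>q\<in>set ns. Fs n g q = rowspan n q M"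
    have "{n - i<..n} \<subseteq> {1..n}" by auto
    then show "plucker M {n - i<..n} = 0 \<longleftrightarrow> (\<exists>v\<in>Fs n g i. v \<noteq> (\<lambda>_. 0) \<and> (\<forall>r\<in>{n - i<..n}. v r = 0))"
      using plucker_eq_0_iff_rowspan[OF ind[OF M(1) i], of "{n - i<..n}"] M(2) i i_n by simp
  next
    let ?w = "stra (n - i) \<circ> w"
    have ww: "w0 n \<circ> stra i \<circ> wP n ns = ?w"
      unfolding w_def w0_comp_stra[OF assms(5,6)] by (simp only: comp_assoc)
    have w'p: "?w permutes {1..n}"
      using assms(5,6) by (intro permutes_compose[OF wp] stra_permutes) auto
    {
      fix g assume g: "g \<in> SLn n" "coset n g \<in> Richardson n id (w0 n \<circ> stra i \<circ> wP n ns)"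
      obtain u y where y: "y \<in> Bor n" "leads n u (mmul n g y)" using Bruhat_decomposition[OF g(1)] by blast
      have le: "bruhat_le n u ?w"
        using g(2) SchubU_iff[OF n1 w'p g(1) y] unfolding Richardson_def ww by simp
      \<comment> \<open>The block ending at \<open>i\<close> starts at \<open>lo + 1\<close>, where
        \<open>w\<close> has the value \<open>n - i + 1\<close>; its exchange with
        \<open>n - i\<close> produces the positive count.\<close>
      obtain lo hi where lh: "consec S lo hi" "lo < i" "i \<le> hi"
        using consec_exists[OF S assms(5) i_n] by blast
      have "hi = i" using lh nsS[OF i] by (auto simp: consec_def)
      then have "w (lo + 1) + lo + i = n + (lo + 1)" using w lh by (auto simp: top_perm_def)
      then have "w (lo + 1) = n - i + 1" using i_n by simp
      then have "?w (lo + 1) \<le> n - i" by (simp add: stra_def)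
      then have "1 \<le> cnt ?w (n - i) i" unfolding cnt_pos_iff using lh by (intro bexI[of _ "lo + 1"]) auto
      also have "\<dots> \<le> cnt u (n - i) i" using le i_n unfolding bruhat_le_def by auto
      finally have "\<exists>c\<in>{1..i}. u c \<le> n - i" unfolding cnt_pos_iff .
      then show "\<exists>v\<in>Fs n g i. v \<noteq> (\<lambda>_. 0) \<and> (\<forall>r\<in>{n - i<..n}. v r = 0)"
        unfolding leads_Fs_zero_iff[OF SLn_mmul[OF g(1) Bor_SLn[OF y(1)]] y(2) i_n, symmetric]
          Fs_mmul_Bor[OF g(1) y(1) i_n] .
    }
    {
      fix g assume g: "g \<in> SLn n" "\<exists>v\<in>Fs n g i. v \<noteq> (\<lambda>_. 0) \<and> (\<forall>r\<in>{n - i<..n}. v r = 0)"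
      obtain u y where y: "y \<in> Bor n" "leads n u (mmul n g y)" using Bruhat_decomposition[OF g(1)] by blast
      obtain g' v where g': "g' \<in> SLn n" "leads n v g'" "incr_on S v"
          and same: "\<forall>q\<in>S. v ` {1..q} = u ` {1..q} \<and> Fs n g' q = Fs n g q"
        using sort_flag[OF n1 S g(1) y] by (elim bexE exE conjE) (rule that)
      have "\<exists>c\<in>{1..i}. v c \<le> n - i"
        using g(2) same nsS[OF i] leads_Fs_zero_iff[OF g'(1,2) i_n, of "n - i"] by simp
      then have "1 \<le> cnt v (n - i) i" unfolding cnt_pos_iff .
      then have "bruhat_le n v ?w"
        using g'(2,3) nsS[OF i] assms(5,6)
        by (intro bruhat_le_stra_top_perm[OF S w]) (auto simp: leads_def)
      then have "coset n g' \<in> Richardson n id (w0 n \<circ> stra i \<circ> wP n ns)"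
        unfolding Richardson_def ww
        using leads_SchubU_iff[OF n1 w'p g'(1,2)] SchubL_id[OF n1 g'(1)] by simp
      then show "\<exists>g'\<in>SLn n. coset n g' \<in> Richardson n id (w0 n \<circ> stra i \<circ> wP n ns) \<and>
          (\<forall>q\<in>set ns. Fs n g' q = Fs n g q)"
        using g'(1) same nsS by (intro bexI[of _ g']) auto
    }
  qed

  have Rich: "coset n g \<in> Richardson n (stra i) w \<longleftrightarrow> coset n g \<in> SchubU n w \<and> meets n i (Fs n g i)"
    if "g \<in> SLn n" for g
    unfolding Richardson_def using SchubL_stra_iff[OF n1 that assms(5,6)] by blast

  have part2: "piP n ns (Richardson n (stra i) w) = cutout n ns (\<lambda>M. plucker M {1..i})" if i: "i \<in> set ns"
  proof (rule reduce[where C = "\<lambda>g. meets n i (Fs n g i)"])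
    fix M g assume M: "fullrank n (last ns) M" "\<forall>q\<in>set ns. Fs n g q = rowspan n q M"
    show "plucker M {1..i} = 0 \<longleftrightarrow> meets n i (Fs n g i)"
      unfolding meets_def using plucker_eq_0_iff_rowspan[OF ind[OF M(1) i], of "{1..i}"] M(2) i i_n by simp
  next
    fix g assume g: "g \<in> SLn n" "coset n g \<in> Richardson n (stra i) w"
    then show "meets n i (Fs n g i)" using Rich by blast
  next
    fix g assume g: "g \<in> SLn n" "meets n i (Fs n g i)"
    obtain u y where y: "y \<in> Bor n" "leads n u (mmul n g y)" using Bruhat_decomposition[OF g(1)] by blast
    obtain g' v where g': "g' \<in> SLn n" "leads n v g'" "incr_on S v"
        and same: "\<forall>q\<in>S. v ` {1..q} = u ` {1..q} \<and> Fs n g' q = Fs n g q"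
      using sort_flag[OF n1 S g(1) y] by (elim bexE exE conjE) (rule that)
    \<comment> \<open>A sorted lift meets the rank conditions of \<open>w0 wP\<close> automatically,
      and the incidence survives sorting because \<open>i\<close> is itself a dimension of the
      partial flag.\<close>
    have "bruhat_le n v w"
      using g'(2,3) by (intro bruhat_le_top_perm[OF S w]) (auto simp: leads_def)
    then have "coset n g' \<in> SchubU n w" using leads_SchubU_iff[OF n1 wp g'(1,2)] by simp
    moreover have "meets n i (Fs n g' i)" using g(2) same nsS[OF i] by simp
    ultimately show "\<exists>g'\<in>SLn n. coset n g' \<in> Richardson n (stra i) w \<and> (\<forall>q\<in>set ns. Fs n g' q = Fs n g q)"
      using g'(1) same nsS Rich by (intro bexI[of _ g']) auto
  qed

  \<comment> \<open>Uniform treatment of \<open>i\<close> strictly inside a block; the remaining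
    cases differ only in how their equation expresses \<open>wedge_dep\<close>.\<close>
  have general: "piP n ns (Richardson n (stra i) w) = cutout n ns E"
    if ac: "consec S a c" "a < i" "i < c"
      and E: "\<And>M g. fullrank n (last ns) M \<Longrightarrow> g \<in> SLn n \<Longrightarrow> \<forall>q\<in>set ns. Fs n g q = rowspan n q M \<Longrightarrow>
        E M = 0 \<longleftrightarrow> wedge_dep n i (n - c + (i - a)) (Fs n g a) (Fs n g c)" for a c E
  proof (rule reduce[where C = "\<lambda>g. wedge_dep n i (n - c + (i - a)) (Fs n g a) (Fs n g c)"])
    fix g assume g: "g \<in> SLn n" "coset n g \<in> Richardson n (stra i) w"
    then show "wedge_dep n i (n - c + (i - a)) (Fs n g a) (Fs n g c)"
      using Rich by (intro wedge_dep_of_Richardson[OF n1 S w ac]) blast+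
  next
    fix g assume g: "g \<in> SLn n" "wedge_dep n i (n - c + (i - a)) (Fs n g a) (Fs n g c)"
    then show "\<exists>g'\<in>SLn n. coset n g' \<in> Richardson n (stra i) w \<and> (\<forall>q\<in>set ns. Fs n g' q = Fs n g q)"
      using wedge_dep_lift[OF n1 S w ac g] Rich nsS by blast
  qed (assumption, rule E)

  have part3: "piP n ns (Richardson n (stra i) w)
      = cutout n ns (\<lambda>M. plucker M ({1..i} \<union> {n - ns ! 0 + i<..n}))" if i: "i < ns ! 0"
  \<comment> \<open>The first block, \<open>a = 0\<close> and \<open>c = ns ! 0\<close>; the step
    \<open>F 0\<close> is trivial.\<close>
  proof (rule general[OF consec(1)])
    fix M g assume M: "fullrank n (last ns) M" "\<forall>q\<in>set ns. Fs n g q = rowspan n q M"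
    let ?c = "ns ! 0"
    have c: "?c \<in> set ns" "?c \<le> n" using assms(1) sub by force+
    have "card ({1..i} \<union> {n - ?c + i<..n}) = card {1..i} + card {n - ?c + i<..n}"
      using c i by (intro card_Un_disjoint) auto
    then have "card ({1..i} \<union> {n - ?c + i<..n}) = ?c" using c i by simp
    then have "plucker M ({1..i} \<union> {n - ?c + i<..n}) = 0 \<longleftrightarrow>
        (\<exists>v\<in>rowspan n ?c M. v \<noteq> (\<lambda>_. 0) \<and> (\<forall>b\<in>{1..i} \<union> {n - ?c + i<..n}. v b = 0))"
      using i_n by (intro plucker_eq_0_iff_rowspan[OF ind[OF M(1) c(1)]]) auto
    then show "plucker M ({1..i} \<union> {n - ?c + i<..n}) = 0 \<longleftrightarrow>
        wedge_dep n i (n - ?c + (i - 0)) (Fs n g 0) (Fs n g ?c)"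
      unfolding Fs_0 using wedge_dep_zero_left[of i "n - ?c + i" n] c i M(2) by simp
  qed (use i assms(5) in auto)

  have part4: "piP n ns (Richardson n (stra i) w)
      = cutout n ns (\<lambda>M. plucker M {i - last ns<..i})" if i: "last ns < i"
  \<comment> \<open>The last block, \<open>a = last ns\<close> and \<open>c = n\<close>; then
    \<open>n - c\<close> is 0 and \<open>m\<close> reduces to \<open>i - last ns\<close>.\<close>
  proof (rule general[OF consec(2)])
    fix M g assume M: "fullrank n (last ns) M" "g \<in> SLn n" "\<forall>q\<in>set ns. Fs n g q = rowspan n q M"
    let ?a = "last ns"
    have a: "?a \<in> set ns" using assms(1) by simp
    have "plucker M {i - ?a<..i} = 0 \<longleftrightarrow>
        (\<exists>v\<in>rowspan n ?a M. v \<noteq> (\<lambda>_. 0) \<and> (\<forall>b\<in>{i - ?a<..i}. v b = 0))"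
      using i i_n by (intro plucker_eq_0_iff_rowspan[OF ind[OF M(1) a]]) auto
    moreover have "wedge_dep n i (i - ?a) (Fs n g ?a) (Fs n g n) \<longleftrightarrow>
        (\<exists>v\<in>Fs n g ?a. v \<noteq> (\<lambda>_. 0) \<and> (\<forall>r\<in>{i - ?a<..i}. v r = 0))"
      using i_n unfolding Fs_def[of n g ?a]
      by (intro wedge_dep_full_right[OF M(2)]) (auto elim: rowspanE)
    ultimately show "plucker M {i - ?a<..i} = 0 \<longleftrightarrow> wedge_dep n i (n - n + (i - ?a)) (Fs n g ?a) (Fs n g n)"
      using M(3) a by simp
  qed (use i assms(6) in auto)

  have part5: "piP n ns (Richardson n (stra i) w)
         = cutout n ns (\<lambda>M. \<Sum>J | J \<subseteq> {1..min i (n - ns ! j + (i - ns ! (j - 1)))} \<and> card J = i - ns ! (j - 1).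
              (-1) ^ (\<Sum>J) * plucker M ({1..i} - J) * plucker M (J \<union> {n - ns ! j + (i - ns ! (j - 1))<..n}))"
    if j: "1 \<le> j" "j < length ns" "ns ! (j - 1) < i" "i < ns ! j" for j
  proof (rule general[OF consec(3)[OF j(1,2)] j(3,4)])
    fix M g assume M: "fullrank n (last ns) M" "\<forall>q\<in>set ns. Fs n g q = rowspan n q M"
    have mem: "ns ! (j - 1) \<in> set ns" "ns ! j \<in> set ns" using j by auto
    then have "ns ! j \<le> n" using sub by auto
    then show "(\<Sum>J | J \<subseteq> {1..min i (n - ns ! j + (i - ns ! (j - 1)))} \<and> card J = i - ns ! (j - 1).
        (-1) ^ (\<Sum>J) * plucker M ({1..i} - J) * plucker M (J \<union> {n - ns ! j + (i - ns ! (j - 1))<..n})) = 0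
      \<longleftrightarrow> wedge_dep n i (n - ns ! j + (i - ns ! (j - 1))) (Fs n g (ns ! (j - 1))) (Fs n g (ns ! j))"
      using quadric_eq_0_iff_wedge_dep[OF j(3,4) _ ind[OF M(1) mem(2)]] M(2) mem by simp
  qed

  show ?thesis
    unfolding Let_def using part1 part2 part3 part4 part5 unfolding w_def by blast
qed

end
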